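(* Let $n \ge 3$. Suppose that $A_1 \subseteq A_2 \subseteq \cdots$ and $A'_1 \subseteq A'_2 \subseteq \cdots$ are towers of direct sums of $2n$-cycle algebras, where the inclusions are rigid, and let $\mathcal{A}_0$, $\mathcal{A}'_0$ be their algebraic direct limits. Then $\mathcal{A}_0$ and $\mathcal{A}'_0$ are star-extendibly isomorphic by a map $\phi:\mathcal{A}_0\to\mathcal{A}_0'$ with inverse $\psi=\phi^{-1}$ if and only if there are indices $m_1<m_2<\cdots$ and $n_1<n_2<\cdots$ and rigid embeddings $\phi_1 : A_1 \to A'_{n_1}$, $\psi_k : A'_{n_k} \to A_{m_k}$ ($k\ge 1$), $\phi_{k+1} : A_{m_k} \to A'_{n_{k+1}}$ ($k\ge 1$) such that the resulting diagram commutes (all compositions $\psi_k\circ\phi_k$ and $\phi_{k+1}\circ\psi_k$ are the given inclusions of the towers) and $\phi = \varinjlim \phi_k$.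
   Context: Digraph algebras. A digraph is a finite directed graph with no multiple directed edges of the same orientation. For a transitive, reflexive digraph $G$ on vertices $v_1,\dots,v_N$, the digraph algebra $A(G)\subseteq M_N(\mathbb{C})$ is the span of the standard matrix units $e_{i,j}$ such that $G$ has an edge from $v_j$ to $v_i$. The reduced digraph $G_r$ is obtained by identifying vertices $v_i,v_j$ whenever both edges $v_i\to v_j$ and $v_j\to v_i$ occur. $D_{2n}$ is the digraph on vertices $1,\dots,2n$ with a loop at each vertex and one further edge between each pair of cyclically successive vertices, with alternating orientations, vertex $1$ (hence each odd vertex) being a range vertex; thus $A(D_{2n})$ is spanned by the $e_{ii}$ and the $e_{ij}$ with $i$ odd, $j$ even, $i,j$ cyclically adjacent. A $2n$-cycle algebra is a digraph algebra $A(G)$ whose reduced digraph is isomorphic to $D_{2n}$. Maps. A star-extendible map $A\to A'$ between (direct sums of) digraph algebras is one that is the restriction of a star-algebra homomorphism $C^*(A)\to C^*(A')$ of the generated star-algebras; embeddings are injective and star-extendible. A multiplicity one embedding $i:A(D_{2n})\to A$ (each $i(e_{jj})$ has rank one) is proper if the projections $i(e_{jj})$, $1\le j\le 2n$, are pairwise inequivalent in $A\cap A^*$. A star-extendible embedding of $A(D_{2n})$ into a (direct sum of) $2n$-cycle algebra(s) is rigid if it is a direct sum of proper multiplicity one embeddings. An embedding $\phi:A\to A'$ between (direct sums of) $2n$-cycle algebras is rigid if $\phi\circ\eta$ is rigid for every proper $\eta:A(D_{2n})\to A$. Limits. $\mathcal{A}_0$ is the algebraic direct limit (union) of the $A_k$,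 contained in the algebraic direct limit of the $C^*(A_k)$. A star-extendible isomorphism $\mathcal{A}_0\to\mathcal{A}_0'$ is an algebra isomorphism that is the restriction of a star-isomorphism of the generated star-algebras. *)

theory Defs
  imports
    "Jordan_Normal_Form.DL_Rank"
    "Jordan_Normal_Form.Schur_Decomposition"
    "Graph_Theory.Graph_Theory"
begin

text \<open>
  Complex star-algebras. The operations are split off into a purely syntactic class so that
  homomorphisms and generated star-subalgebras also make sense for \<^typ>\<open>complex mat\<close>, where the
  algebra laws only hold on each \<^term>\<open>carrier_mat N N\<close>. Algebras need not have a unit and
  homomorphisms need not preserve one.
\<close>

class star_ops = plus + times +
  fixes scaleC :: "complex \<Rightarrow> 'a \<Rightarrow> 'a"
    and star :: "'a \<Rightarrow> 'a"

class complex_star_algebra = ring + star_ops +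
  assumes scaleC_add_right: "scaleC c (x + y) = scaleC c x + scaleC c y"
    and scaleC_add_left: "scaleC (c + d) x = scaleC c x + scaleC d x"
    and scaleC_scaleC: "scaleC c (scaleC d x) = scaleC (c * d) x"
    and scaleC_one: "scaleC 1 x = x"
    and mult_scaleC_left: "scaleC c x * y = scaleC c (x * y)"
    and mult_scaleC_right: "x * scaleC c y = scaleC c (x * y)"
    and star_star: "star (star x) = x"
    and star_add: "star (x + y) = star x + star y"
    and star_mult: "star (x * y) = star y * star x"
    and star_scaleC: "star (scaleC c x) = scaleC (cnj c) (star x)"

instantiation complex :: complex_star_algebra
begin
definition scaleC_complex :: "complex \<Rightarrow> complex \<Rightarrow> complex" where
  "scaleC_complex c x = c * x"
definition star_complex :: "complex \<Rightarrow> complex" where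
  "star_complex x = cnj x"
instance
  by standard (simp_all add: scaleC_complex_def star_complex_def algebra_simps)
end

instantiation mat :: ("{semiring_0, star_ops}") star_ops
begin
definition scaleC_mat :: "complex \<Rightarrow> 'a mat \<Rightarrow> 'a mat" where
  "scaleC_mat c M = map_mat (scaleC c) M"
definition star_mat :: "'a mat \<Rightarrow> 'a mat" where
  "star_mat M = transpose_mat (map_mat star M)"
instance ..
end

lemma scaleC_mat_eq_smult: "scaleC c M = c \<cdot>\<^sub>m M" for M :: "complex mat"
  by (rule eq_matI) (simp_all add: scaleC_mat_def scaleC_complex_def)

lemma star_mat_eq_mat_adjoint: "star M = mat_adjoint M" for M :: "complex mat"
  by (rule eq_matI)
    (simp_all add: star_mat_def star_complex_def mat_adjoint_def mat_of_rows_def)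

inductive_set star_gen :: "'a::star_ops set \<Rightarrow> 'a set" for S where
  star_gen_incl: "x \<in> S \<Longrightarrow> x \<in> star_gen S"
| star_gen_add: "x \<in> star_gen S \<Longrightarrow> y \<in> star_gen S \<Longrightarrow> x + y \<in> star_gen S"
| star_gen_mult: "x \<in> star_gen S \<Longrightarrow> y \<in> star_gen S \<Longrightarrow> x * y \<in> star_gen S"
| star_gen_scaleC: "x \<in> star_gen S \<Longrightarrow> scaleC c x \<in> star_gen S"
| star_gen_star: "x \<in> star_gen S \<Longrightarrow> star x \<in> star_gen S"

definition star_hom :: "'a::star_ops set \<Rightarrow> 'b::star_ops set \<Rightarrow> ('a \<Rightarrow> 'b) \<Rightarrow> bool" where
  "star_hom B C \<Phi> \<longleftrightarrow>
     \<Phi> ` B \<subseteq> C \<and>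
     (\<forall>x\<in>B. \<forall>y\<in>B. \<Phi> (x + y) = \<Phi> x + \<Phi> y) \<and>
     (\<forall>x\<in>B. \<forall>y\<in>B. \<Phi> (x * y) = \<Phi> x * \<Phi> y) \<and>
     (\<forall>c. \<forall>x\<in>B. \<Phi> (scaleC c x) = scaleC c (\<Phi> x)) \<and>
     (\<forall>x\<in>B. \<Phi> (star x) = star (\<Phi> x))"

text \<open>
  Maps between subalgebras are total functions of which only the values on the domain matter.
\<close>

definition star_extendible ::
  "'a::star_ops set \<Rightarrow> 'b::star_ops set \<Rightarrow> ('a \<Rightarrow> 'b) \<Rightarrow> bool" where
  "star_extendible A A' \<phi> \<longleftrightarrow>
     \<phi> ` A \<subseteq> A' \<and> (\<exists>\<Phi>. star_hom (star_gen A) (star_gen A') \<Phi> \<and> (\<forall>x\<in>A. \<phi> x = \<Phi> x))"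

definition star_ext_embedding ::
  "'a::star_ops set \<Rightarrow> 'b::star_ops set \<Rightarrow> ('a \<Rightarrow> 'b) \<Rightarrow> bool" where
  "star_ext_embedding A A' \<phi> \<longleftrightarrow> star_extendible A A' \<phi> \<and> inj_on \<phi> A"

definition star_ext_iso ::
  "'a::star_ops set \<Rightarrow> 'b::star_ops set \<Rightarrow> ('a \<Rightarrow> 'b) \<Rightarrow> bool" where
  "star_ext_iso A A' \<phi> \<longleftrightarrow>
     bij_betw \<phi> A A' \<and>
     (\<exists>\<Phi>. star_hom (star_gen A) (star_gen A') \<Phi> \<and> bij_betw \<Phi> (star_gen A) (star_gen A') \<and>
          (\<forall>x\<in>A. \<phi> x = \<Phi> x))"

text \<open>
  Digraphs without parallel arcs; the vertices \<open>v\<^sub>1, \<dots>, v\<^sub>N\<close> are numbered from \<open>0\<close>, like the rows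
  and columns of matrices.
\<close>

definition trans_refl_digraph :: "nat pair_pre_digraph \<Rightarrow> bool" where
  "trans_refl_digraph G \<longleftrightarrow>
     pair_fin_digraph G \<and> pverts G = {..<card (pverts G)} \<and>
     refl_on (pverts G) (parcs G) \<and> trans (parcs G)"

text \<open>
  The span of the matrix units \<open>e\<^sub>i\<^sub>j\<close> for which there is an arc from \<open>v\<^sub>j\<close> to \<open>v\<^sub>i\<close>: the sum of
  \<open>c i j\<close> times \<open>e\<^sub>i\<^sub>j\<close> over these arcs, written entrywise.
\<close>

definition digraph_algebra :: "nat pair_pre_digraph \<Rightarrow> complex mat set" where
  "digraph_algebra G =
     {mat (card (pverts G)) (card (pverts G)) (\<lambda>(i, j). if (j, i) \<in> parcs G then c i j else 0)
      | c :: nat \<Rightarrow> nat \<Rightarrow> complex. True}"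

definition digraph_algebra_sum :: "nat pair_pre_digraph list \<Rightarrow> complex mat set" where
  "digraph_algebra_sum Gs =
     {diag_block_mat Ms | Ms. list_all2 (\<lambda>M G. M \<in> digraph_algebra G) Ms Gs}"

definition mutual_arcs :: "'v pair_pre_digraph \<Rightarrow> 'v rel" where
  "mutual_arcs G = {(u, v). (u, v) \<in> parcs G \<and> (v, u) \<in> parcs G}"

definition reduced_digraph :: "'v pair_pre_digraph \<Rightarrow> 'v set pair_pre_digraph" where
  "reduced_digraph G =
     \<lparr> pverts = pverts G // mutual_arcs G,
       parcs = {(U, V). U \<in> pverts G // mutual_arcs G \<and> V \<in> pverts G // mutual_arcs G \<and>
                        (\<exists>u\<in>U. \<exists>v\<in>V. (u, v) \<in> parcs G)} \<rparr>"

text \<open>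
  The digraph \<open>D\<^sub>2\<^sub>n\<close>. Numbering vertices from \<open>0\<close> turns the odd (range) vertices \<open>1, 3, \<dots>\<close> into
  the even numbers \<open>0, 2, \<dots>\<close>.
\<close>

definition cycle_digraph :: "nat \<Rightarrow> nat pair_pre_digraph" where
  "cycle_digraph n =
     \<lparr> pverts = {..<2 * n},
       parcs = {(v, v) | v. v < 2 * n} \<union>
               {(j, i). i < 2 * n \<and> j < 2 * n \<and> even i \<and> odd j \<and>
                        (j = Suc i mod (2 * n) \<or> i = Suc j mod (2 * n))} \<rparr>"

abbreviation cycle_alg :: "nat \<Rightarrow> complex mat set" where
  "cycle_alg n \<equiv> digraph_algebra (cycle_digraph n)"

text \<open>The diagonal matrix unit \<open>e\<^sub>j\<^sub>j\<close> of \<open>A(D\<^sub>2\<^sub>n)\<close>.\<close>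

definition cycle_proj :: "nat \<Rightarrow> nat \<Rightarrow> complex mat" where
  "cycle_proj n j = mat (2 * n) (2 * n) (\<lambda>(r, c). if r = j \<and> c = j then 1 else 0)"

definition is_cycle_type :: "nat \<Rightarrow> nat pair_pre_digraph \<Rightarrow> bool" where
  "is_cycle_type n G \<longleftrightarrow>
     trans_refl_digraph G \<and>
     digraph_iso (with_proj (reduced_digraph G)) (with_proj (cycle_digraph n))"

text \<open>
  A subalgebra of an abstract star-algebra is regarded as a direct sum of digraph algebras through
  a star-extendible isomorphism with a concrete algebra of block diagonal matrices.
\<close>

definition digraph_sum_realization ::
  "'a::complex_star_algebra set \<Rightarrow> nat pair_pre_digraph list \<Rightarrow> ('a \<Rightarrow> complex mat) \<Rightarrow> bool" where
  "digraph_sum_realization A Gs \<theta> \<longleftrightarrow>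
     (\<forall>G\<in>set Gs. trans_refl_digraph G) \<and>
     star_hom (star_gen A) (star_gen (digraph_algebra_sum Gs)) \<theta> \<and>
     bij_betw \<theta> (star_gen A) (star_gen (digraph_algebra_sum Gs)) \<and>
     \<theta> ` A = digraph_algebra_sum Gs"

definition cycle_algebra_sum :: "nat \<Rightarrow> 'a::complex_star_algebra set \<Rightarrow> bool" where
  "cycle_algebra_sum n A \<longleftrightarrow>
     (\<exists>Gs \<theta>. Gs \<noteq> [] \<and> (\<forall>G\<in>set Gs. is_cycle_type n G) \<and> digraph_sum_realization A Gs \<theta>)"

text \<open>
  The rank does not depend on the realization: star-isomorphisms between the generated
  star-algebras, which are direct sums of full matrix algebras, preserve it.
\<close>

definition has_rank_in :: "'a::complex_star_algebra set \<Rightarrow> 'a \<Rightarrow> nat \<Rightarrow> bool" where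
  "has_rank_in A x r \<longleftrightarrow>
     (\<exists>Gs \<theta>. digraph_sum_realization A Gs \<theta> \<and> vec_space.rank (dim_row (\<theta> x)) (\<theta> x) = r)"

definition equivalent_projections_in ::
  "'a::complex_star_algebra set \<Rightarrow> 'a \<Rightarrow> 'a \<Rightarrow> bool" where
  "equivalent_projections_in C p q \<longleftrightarrow> (\<exists>v\<in>C. star v * v = p \<and> v * star v = q)"

definition multiplicity_one ::
  "nat \<Rightarrow> 'a::complex_star_algebra set \<Rightarrow> (complex mat \<Rightarrow> 'a) \<Rightarrow> bool" where
  "multiplicity_one n A \<eta> \<longleftrightarrow>
     star_ext_embedding (cycle_alg n) A \<eta> \<and> (\<forall>j<2 * n. has_rank_in A (\<eta> (cycle_proj n j)) 1)"

definition proper_embedding ::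
  "nat \<Rightarrow> 'a::complex_star_algebra set \<Rightarrow> (complex mat \<Rightarrow> 'a) \<Rightarrow> bool" where
  "proper_embedding n A \<eta> \<longleftrightarrow>
     multiplicity_one n A \<eta> \<and>
     (\<forall>i<2 * n. \<forall>j<2 * n. i \<noteq> j \<longrightarrow>
        \<not> equivalent_projections_in (A \<inter> star ` A) (\<eta> (cycle_proj n i)) (\<eta> (cycle_proj n j)))"

text \<open>Direct sum of maps: a sum of maps with mutually orthogonal ranges.\<close>

definition rigid_cycle_embedding ::
  "nat \<Rightarrow> 'a::complex_star_algebra set \<Rightarrow> (complex mat \<Rightarrow> 'a) \<Rightarrow> bool" where
  "rigid_cycle_embedding n A \<rho> \<longleftrightarrow>
     star_ext_embedding (cycle_alg n) A \<rho> \<and>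
     (\<exists>(r::nat) \<eta>.
        (\<forall>s<r. proper_embedding n A (\<eta> s)) \<and>
        (\<forall>s<r. \<forall>t<r. s \<noteq> t \<longrightarrow> (\<forall>x\<in>cycle_alg n. \<forall>y\<in>cycle_alg n. \<eta> s x * \<eta> t y = 0)) \<and>
        (\<forall>x\<in>cycle_alg n. \<rho> x = (\<Sum>s<r. \<eta> s x)))"

definition rigid_embedding ::
  "nat \<Rightarrow> 'a::complex_star_algebra set \<Rightarrow> 'b::complex_star_algebra set \<Rightarrow> ('a \<Rightarrow> 'b) \<Rightarrow> bool" where
  "rigid_embedding n A A' \<phi> \<longleftrightarrow>
     star_ext_embedding A A' \<phi> \<and>
     (\<forall>\<eta>. proper_embedding n A \<eta> \<longrightarrow> rigid_cycle_embedding n A' (\<phi> \<circ> \<eta>))"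

text \<open>Towers are indexed from \<open>0\<close>, i.e. \<open>A 0 \<subseteq> A 1 \<subseteq> \<dots>\<close> stands for \<open>A\<^sub>1 \<subseteq> A\<^sub>2 \<subseteq> \<dots>\<close>.\<close>

definition rigid_tower :: "nat \<Rightarrow> (nat \<Rightarrow> 'a::complex_star_algebra set) \<Rightarrow> bool" where
  "rigid_tower n A \<longleftrightarrow>
     (\<forall>k. cycle_algebra_sum n (A k)) \<and>
     (\<forall>k. A k \<subseteq> A (Suc k)) \<and>
     (\<forall>k. rigid_embedding n (A k) (A (Suc k)) (\<lambda>x. x))"

definition tower_limit :: "(nat \<Rightarrow> 'a set) \<Rightarrow> 'a set" where
  "tower_limit A = (\<Union>k. A k)"

end

theory Submission
  imports Defs
begin

text \<open>
  A star-extendible embedding of \<open>A(D\<^sub>2\<^sub>n)\<close> amounts to matrix units \<open>v\<^sub>i\<^sub>j\<close>. If its target is a sum of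
  \<open>2n\<close>-cycle algebras with block projections \<open>Q\<^sub>\<alpha>\<close>, put \<open>E\<^sub>j(\<alpha>) = v\<^sub>0\<^sub>j Q\<^sub>\<alpha> v\<^sub>j\<^sub>0\<close>; for each \<open>j\<close> these are
  orthogonal projections with sum \<open>v\<^sub>0\<^sub>0\<close>. The embedding is rigid if and only if
  \<open>E\<^sub>j(\<alpha>) E\<^sub>j\<^sub>+\<^sub>1(\<alpha>) = 0\<close> and \<open>E\<^sub>j(\<alpha>) E\<^sub>j\<^sub>+\<^sub>1(\<beta>) E\<^sub>j\<^sub>+\<^sub>2(\<alpha>) = 0\<close> for all blocks and cyclic indices: for \<open>n \<ge> 3\<close> the
  first condition makes \<open>E\<^sub>j(\<alpha>)\<close> and \<open>E\<^sub>j\<^sub>+\<^sub>1(\<beta>)\<close> commute, so \<open>v\<^sub>0\<^sub>0\<close> is a sum of minimal projections below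
  products \<open>E\<^sub>0(\<alpha>) E\<^sub>1(\<beta>)\<close>, and by the second each of them traces a walk round the cycle that never
  turns back, that is, a proper multiplicity one embedding. Both conditions only concern elements of
  diagonal blocks, and a star-extendible embedding \<open>\<psi>\<close> maps these to elements commuting with the block
  projections of its target. So if \<open>\<psi> \<circ> \<phi>\<close> is rigid, then so is \<open>\<phi>\<close>, and the theorem follows by the
  usual intertwining argument for finite-dimensional stages.
\<close>

section \<open>Generated star-algebras and star-homomorphisms\<close>

text \<open>The obstacle is the middle projection of a backtrack. \<open>\<psi>\<close> sends a
  block projection \<open>Q \<beta>\<close> to an element that commutes with the block projections
  of its target but is in general only a sum of subprojections of them. Between two matrix units it
  therefore does not meet the backtrack condition for \<open>\<psi> \<circ> \<rho>\<close>, which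
  has whole block projections there. It is moved out: with h = \<open>Q\<^sub>\<alpha>
  v\<^sub>j\<^sub>k Q\<^sub>\<beta> v\<^sub>k\<^sub>j\<close> one has h
  \<open>v\<^sub>j\<^sub>k\<close> =
  \<open>Q\<^sub>\<alpha> v\<^sub>j\<^sub>k Q\<^sub>\<beta>\<close>, and h lies in the diagonal
  block of \<alpha>, so that only diagonal elements stand at the ends. That h is diagonal is again
  the commutation statement, whose source is that in a cycle of length at least six two vertices
  have at most one common neighbour. A second difficulty is the rank. \<open>has_rank_in\<close>
  speaks of some realization, possibly another one than that from which the labels are read. Rank
  one is therefore replaced by minimality of a projection in \<open>star_gen A\<close>, a notion
  that mentions no realization.\<close>

lemma scaleC_zero_left [simp]: "scaleC 0 x = (0 :: 'a::complex_star_algebra)"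
  using scaleC_add_left[of 0 0 x] by simp

lemma scaleC_zero_right [simp]: "scaleC c 0 = (0 :: 'a::complex_star_algebra)"
  using scaleC_add_right[of c 0 0] by simp

lemma star_zero [simp]: "star (0 :: 'a::complex_star_algebra) = 0"
  using star_add[of "0 :: 'a" 0] by simp

lemma star_minus: "star (x - y) = star x - star (y :: 'a::complex_star_algebra)"
  using star_add[of "x - y" y] by (simp add: algebra_simps)

lemma scaleC_minus_one: "scaleC (- 1) x = - (x :: 'a::complex_star_algebra)"
  using scaleC_add_left[of 1 "- 1" x] by (simp add: scaleC_one eq_neg_iff_add_eq_0 add.commute)

lemma star_sum: "star (sum f I) = (\<Sum>i\<in>I. star (f i :: 'a::complex_star_algebra))"
  by (induction I rule: infinite_finite_induct) (simp_all add: star_add)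

lemma scaleC_sum: "scaleC c (sum f I) = (\<Sum>i\<in>I. scaleC c (f i :: 'a::complex_star_algebra))"
  by (induction I rule: infinite_finite_induct) (simp_all add: scaleC_add_right)

lemma scaleC_eq_0_iff: "scaleC c x = 0 \<longleftrightarrow> c = 0 \<or> x = (0 :: 'a::complex_star_algebra)"
proof
  assume *: "scaleC c x = 0"
  show "c = 0 \<or> x = 0"
  proof (rule disjCI, rule ccontr)
    assume "x \<noteq> 0" "c \<noteq> 0"
    then have "scaleC (inverse c) (scaleC c x) = x"
      by (simp add: scaleC_scaleC scaleC_one)
    with * \<open>x \<noteq> 0\<close> show False by simp
  qed
qed auto

lemma scaleC_right_cancel:
  assumes "scaleC c x = scaleC d x" "x \<noteq> (0 :: 'a::complex_star_algebra)"
  shows "c = d"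
proof -
  have "scaleC (c - d) x = scaleC c x + scaleC (- 1) (scaleC d x)"
    unfolding scaleC_scaleC scaleC_add_left[symmetric] by simp
  then have "scaleC (c - d) x = 0" using assms(1) by (simp add: scaleC_minus_one)
  with assms(2) show ?thesis by (simp add: scaleC_eq_0_iff)
qed

lemma star_gen_mono: "S \<subseteq> T \<Longrightarrow> star_gen S \<subseteq> star_gen T"
proof
  fix x assume "S \<subseteq> T" "x \<in> star_gen S"
  from this(2,1) show "x \<in> star_gen T"
    by (induction) (auto intro: star_gen.intros)
qed

lemma subset_star_gen: "S \<subseteq> star_gen S"
  by (auto intro: star_gen_incl)

lemma star_gen_zero:
  "x \<in> star_gen S \<Longrightarrow> (0 :: 'a::complex_star_algebra) \<in> star_gen S"
  using star_gen_scaleC[of x S 0] by simp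

lemma star_gen_minus:
  fixes x y :: "'a::complex_star_algebra"
  assumes "x \<in> star_gen S" "y \<in> star_gen S" shows "x - y \<in> star_gen S"
  using star_gen_add[OF assms(1) star_gen_scaleC[OF assms(2), of "- 1"]]
  by (simp add: scaleC_minus_one)

lemma star_gen_sum:
  fixes f :: "'i \<Rightarrow> 'a::complex_star_algebra"
  assumes "S \<noteq> {}" "\<And>i. i \<in> I \<Longrightarrow> f i \<in> star_gen S"
  shows "sum f I \<in> star_gen S"
proof -
  have 0: "0 \<in> star_gen S" using assms(1) by (auto intro: star_gen_zero star_gen_incl)
  show ?thesis using assms(2)
    by (induction I rule: infinite_finite_induct) (auto intro: star_gen_add 0)
qed

lemma star_homD:
  assumes "star_hom B C \<Phi>"
  shows "x \<in> B \<Longrightarrow> \<Phi> x \<in> C"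
    and "x \<in> B \<Longrightarrow> y \<in> B \<Longrightarrow> \<Phi> (x + y) = \<Phi> x + \<Phi> y"
    and "x \<in> B \<Longrightarrow> y \<in> B \<Longrightarrow> \<Phi> (x * y) = \<Phi> x * \<Phi> y"
    and "x \<in> B \<Longrightarrow> \<Phi> (scaleC c x) = scaleC c (\<Phi> x)"
    and "x \<in> B \<Longrightarrow> \<Phi> (star x) = star (\<Phi> x)"
  using assms unfolding star_hom_def by auto

lemma star_hom_zero:
  fixes \<Phi> :: "'a::complex_star_algebra \<Rightarrow> 'b::complex_star_algebra"
  assumes "star_hom B C \<Phi>" "0 \<in> B"
  shows "\<Phi> 0 = 0"
  using star_homD(4)[OF assms, of 0] by simp

lemma star_hom_sum:
  fixes \<Phi> :: "'a::complex_star_algebra \<Rightarrow> 'b::complex_star_algebra"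
  assumes "star_hom (star_gen S) C \<Phi>" "S \<noteq> {}" "\<And>i. i \<in> I \<Longrightarrow> f i \<in> star_gen S"
  shows "\<Phi> (sum f I) = (\<Sum>i\<in>I. \<Phi> (f i))"
proof -
  have 0: "0 \<in> star_gen S" using assms(2) by (auto intro: star_gen_zero star_gen_incl)
  show ?thesis using assms(3)
  proof (induction I rule: infinite_finite_induct)
    case (insert i I)
    then show ?case
      by (simp add: star_homD(2)[OF assms(1)] star_gen_sum[OF assms(2)])
  qed (simp_all add: star_hom_zero[OF assms(1) 0])
qed

lemma star_hom_subset:
  assumes "star_hom B C \<Phi>" "B' \<subseteq> B" "\<Phi> ` B' \<subseteq> C'"
  shows "star_hom B' C' \<Phi>"
  using assms by (simp add: star_hom_def subset_iff image_subset_iff)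

text \<open>This allows an extension to be built into any convenient codomain and narrowed
  afterwards by looking at the generators alone.\<close>

lemma star_hom_star_gen:
  assumes "star_hom (star_gen S) C \<Phi>" "\<Phi> ` S \<subseteq> T"
  shows "star_hom (star_gen S) (star_gen T) \<Phi>"
proof -
  have "\<Phi> x \<in> star_gen T" if "x \<in> star_gen S" for x
    using that
  proof induction
    case (star_gen_incl x)
    then show ?case using assms(2) by (blast intro: star_gen.star_gen_incl)
  qed (simp_all add: star_homD[OF assms(1)] star_gen.intros)
  then show ?thesis
    using assms(1) by (intro star_hom_subset[OF assms(1)]) auto
qed

lemma star_hom_comp:
  assumes "star_hom B C \<Phi>" "star_hom C D \<Psi>"
  shows "star_hom B D (\<Psi> \<circ> \<Phi>)"
  using assms unfolding star_hom_def by (simp add: image_subset_iff)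

lemma star_hom_eq_on_star_gen:
  assumes "star_hom (star_gen S) C \<Phi>" "star_hom (star_gen S) D \<Psi>" "\<And>x. x \<in> S \<Longrightarrow> \<Phi> x = \<Psi> x"
    and "x \<in> star_gen S"
  shows "\<Phi> x = \<Psi> x"
  using assms(4)
  by induction (auto simp: assms(3) star_homD[OF assms(1)] star_homD[OF assms(2)])

lemma star_hom_ident: "star_hom B B (\<lambda>x. x)"
  by (simp add: star_hom_def)

lemma star_hom_inv_into:
  assumes hom: "star_hom (star_gen S) C \<Phi>" and bij: "bij_betw \<Phi> (star_gen S) C"
  shows "star_hom C (star_gen S) (inv_into (star_gen S) \<Phi>)"
proof -
  let ?\<Psi> = "inv_into (star_gen S) \<Phi>"
  have inj: "inj_on \<Phi> (star_gen S)" and img: "\<Phi> ` star_gen S = C"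
    using bij by (auto simp: bij_betw_def)
  have 1: "?\<Psi> y \<in> star_gen S" if "y \<in> C" for y
    using that img by (auto intro: inv_into_into)
  have 2: "\<Phi> (?\<Psi> y) = y" if "y \<in> C" for y
    using that img by (auto intro: f_inv_into_f)
  have 3: "?\<Psi> y = x" if "x \<in> star_gen S" "\<Phi> x = y" for x y
    using inj that by (metis inv_into_f_f)
  have "?\<Psi> (x + y) = ?\<Psi> x + ?\<Psi> y" "?\<Psi> (x * y) = ?\<Psi> x * ?\<Psi> y" if "x \<in> C" "y \<in> C" for x y
    by (rule 3; simp add: 1 2 that star_homD[OF hom] star_gen.intros)+
  moreover have "?\<Psi> (scaleC c x) = scaleC c (?\<Psi> x)" "?\<Psi> (star x) = star (?\<Psi> x)" if "x \<in> C" for x c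
    by (rule 3; simp add: 1 2 that star_homD[OF hom] star_gen.intros)+
  ultimately show ?thesis
    using 1 unfolding star_hom_def by blast
qed

lemma star_extendibleI:
  assumes "star_hom (star_gen A) C \<Phi>" "\<And>x. x \<in> A \<Longrightarrow> \<phi> x = \<Phi> x" "\<phi> ` A \<subseteq> A'"
  shows "star_extendible A A' \<phi>"
proof -
  have "\<Phi> ` A \<subseteq> A'" using assms(2,3) by (metis image_cong)
  then show ?thesis
    unfolding star_extendible_def using star_hom_star_gen[OF assms(1)] assms by blast
qed

lemma star_ext_embedding_extension:
  assumes "star_ext_embedding A A' \<phi>"
  shows "\<exists>\<Phi>. star_hom (star_gen A) (star_gen A') \<Phi> \<and> (\<forall>x\<in>A. \<phi> x = \<Phi> x)"
    and "\<phi> ` A \<subseteq> A'" and "inj_on \<phi> A"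
  using assms by (simp_all add: star_ext_embedding_def star_extendible_def)

lemma star_ext_embedding_comp:
  assumes "star_ext_embedding A A' \<phi>" "star_ext_embedding A' A'' \<psi>"
  shows "star_ext_embedding A A'' (\<psi> \<circ> \<phi>)"
proof -
  obtain \<Phi> where \<Phi>: "star_hom (star_gen A) (star_gen A') \<Phi>"
    "\<And>x. x \<in> A \<Longrightarrow> \<phi> x = \<Phi> x" "\<phi> ` A \<subseteq> A'" "inj_on \<phi> A"
    using assms(1) unfolding star_ext_embedding_def star_extendible_def by blast
  obtain \<Psi> where \<Psi>: "star_hom (star_gen A') (star_gen A'') \<Psi>"
    "\<And>x. x \<in> A' \<Longrightarrow> \<psi> x = \<Psi> x" "\<psi> ` A' \<subseteq> A''" "inj_on \<psi> A'"
    using assms(2) unfolding star_ext_embedding_def star_extendible_def by blast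
  have "inj_on (\<psi> \<circ> \<phi>) A"
    using comp_inj_on[OF \<Phi>(4) inj_on_subset[OF \<Psi>(4) \<Phi>(3)]] .
  moreover have "star_extendible A A'' (\<psi> \<circ> \<phi>)"
  proof (rule star_extendibleI[OF star_hom_comp[OF \<Phi>(1) \<Psi>(1)]])
    show "(\<psi> \<circ> \<phi>) x = (\<Psi> \<circ> \<Phi>) x" if "x \<in> A" for x
      using \<Phi>(3) that by (simp add: \<Psi>(2) \<Phi>(2)[symmetric] image_subset_iff)
    show "(\<psi> \<circ> \<phi>) ` A \<subseteq> A''" using \<Phi>(3) \<Psi>(3) by auto
  qed
  ultimately show ?thesis by (simp add: star_ext_embedding_def)
qed

lemma star_ext_embedding_cong:
  assumes "\<And>x. x \<in> A \<Longrightarrow> \<phi> x = \<psi> x"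
  shows "star_ext_embedding A A' \<phi> \<longleftrightarrow> star_ext_embedding A A' \<psi>"
proof -
  have "\<phi> ` A = \<psi> ` A" "inj_on \<phi> A = inj_on \<psi> A"
    using assms by (auto cong: inj_on_cong)
  then show ?thesis
    using assms by (simp add: star_ext_embedding_def star_extendible_def)
qed

section \<open>Matrix units\<close>

definition unit_mat :: "nat \<Rightarrow> nat \<Rightarrow> nat \<Rightarrow> complex mat" where
  "unit_mat N i j = mat N N (\<lambda>(a, b). if a = i \<and> b = j then 1 else 0)"

lemma star_mat_carrier [simp]: "M \<in> carrier_mat N K \<Longrightarrow> star (M :: complex mat) \<in> carrier_mat K N"
  by (auto simp: star_mat_def)

lemma scaleC_mat_carrier [simp]: "M \<in> carrier_mat N K \<Longrightarrow> scaleC c (M :: complex mat) \<in> carrier_mat N K"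
  by (auto simp: scaleC_mat_def)

lemma index_star_mat:
  "M \<in> carrier_mat N K \<Longrightarrow> a < K \<Longrightarrow> b < N \<Longrightarrow> star (M :: complex mat) $$ (a, b) = cnj (M $$ (b, a))"
  by (auto simp: star_mat_def star_complex_def)

lemma index_scaleC_mat:
  "M \<in> carrier_mat N K \<Longrightarrow> a < N \<Longrightarrow> b < K \<Longrightarrow> scaleC c (M :: complex mat) $$ (a, b) = c * (M $$ (a, b))"
  by (auto simp: scaleC_mat_def scaleC_complex_def)

lemma index_mult_mat_sum:
  "M \<in> carrier_mat N K \<Longrightarrow> M' \<in> carrier_mat K L \<Longrightarrow> a < N \<Longrightarrow> b < L \<Longrightarrow>
    ((M :: complex mat) * M') $$ (a, b) = (\<Sum>k<K. M $$ (a, k) * M' $$ (k, b))"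
  by (auto simp: scalar_prod_def lessThan_atLeast0)

lemma star_gen_carrier_mat:
  assumes "S \<subseteq> carrier_mat N N"
  shows "star_gen S \<subseteq> (carrier_mat N N :: complex mat set)"
proof
  fix x assume "x \<in> star_gen S"
  then show "x \<in> carrier_mat N N"
    by induction (use assms in auto)
qed

lemma dim_unit_mat [simp]: "dim_row (unit_mat N i j) = N" "dim_col (unit_mat N i j) = N"
  by (simp_all add: unit_mat_def)

lemma unit_mat_carrier [simp]: "unit_mat N i j \<in> carrier_mat N N"
  by (simp add: unit_mat_def)

lemma index_unit_mat [simp]:
  "a < N \<Longrightarrow> b < N \<Longrightarrow> unit_mat N i j $$ (a, b) = (if a = i \<and> b = j then 1 else 0)"
  by (simp add: unit_mat_def)

lemma mat_eqI:
  assumes "M \<in> carrier_mat N K" "M' \<in> carrier_mat N K"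
    and "\<And>a b. a < N \<Longrightarrow> b < K \<Longrightarrow> M $$ (a, b) = M' $$ (a, b)"
  shows "M = M'"
  using assms by (intro eq_matI) auto

lemma index_unit_mat_mult_left:
  assumes "M \<in> carrier_mat N N" "a < N" "b < N" "j < N"
  shows "(unit_mat N i j * M) $$ (a, b) = (if a = i then M $$ (j, b) else 0)"
proof -
  have "(unit_mat N i j * M) $$ (a, b) = (\<Sum>k<N. (if a = i \<and> k = j then 1 else 0) * M $$ (k, b))"
    using assms by (subst index_mult_mat_sum[of _ N N _ N]) (auto intro!: sum.cong)
  also have "\<dots> = (\<Sum>k<N. if k = j then (if a = i then M $$ (j, b) else 0) else 0)"
    by (rule sum.cong) auto
  finally show ?thesis using assms(4) by simp
qed

lemma index_unit_mat_mult_right: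
  assumes "M \<in> carrier_mat N N" "a < N" "b < N" "i < N"
  shows "(M * unit_mat N i j) $$ (a, b) = (if b = j then M $$ (a, i) else 0)"
proof -
  have "(M * unit_mat N i j) $$ (a, b) = (\<Sum>k<N. M $$ (a, k) * (if k = i \<and> b = j then 1 else 0))"
    using assms by (subst index_mult_mat_sum[of _ N N _ N]) (auto intro!: sum.cong)
  also have "\<dots> = (\<Sum>k<N. if k = i then (if b = j then M $$ (a, i) else 0) else 0)"
    by (rule sum.cong) auto
  finally show ?thesis using assms(4) by simp
qed

lemma unit_mat_mult:
  assumes "j < N" "k < N"
  shows "unit_mat N i j * unit_mat N k l = (if j = k then unit_mat N i l else 0\<^sub>m N N)"
  using assms
  by (intro mat_eqI[of _ N N] mult_carrier_mat[of _ N N])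
     (auto simp: index_unit_mat_mult_left simp del: index_mult_mat)

lemma star_unit_mat: "star (unit_mat N i j) = unit_mat N j i"
  by (intro mat_eqI[of _ N N]) (auto simp: index_star_mat[of _ N N])

lemma unit_mat_sandwich:
  assumes "M \<in> carrier_mat N N" "j < N" "k < N"
  shows "unit_mat N i j * M * unit_mat N k l = scaleC (M $$ (j, k)) (unit_mat N i l)"
proof (rule mat_eqI[of _ N N])
  have *: "unit_mat N i j * M \<in> carrier_mat N N"
    using assms(1) by (intro mult_carrier_mat) simp_all
  fix a b assume "a < N" "b < N"
  then show "(unit_mat N i j * M * unit_mat N k l) $$ (a, b)
      = scaleC (M $$ (j, k)) (unit_mat N i l) $$ (a, b)"
    using assms * by (simp add: index_unit_mat_mult_left index_unit_mat_mult_right[OF *]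
      index_scaleC_mat[of _ N N] del: index_mult_mat)
qed (use assms in \<open>auto intro!: mult_carrier_mat[of _ N N] simp: scaleC_mat_carrier\<close>)

section \<open>The cycle algebra and its embeddings as systems of matrix units\<close>

lemma digraph_algebra_iff:
  "M \<in> digraph_algebra G \<longleftrightarrow> M \<in> carrier_mat (card (pverts G)) (card (pverts G)) \<and>
     (\<forall>i<card (pverts G). \<forall>j<card (pverts G). (j, i) \<notin> parcs G \<longrightarrow> M $$ (i, j) = 0)"
  (is "_ \<longleftrightarrow> ?R")
proof
  assume "M \<in> digraph_algebra G"
  then show ?R by (auto simp: digraph_algebra_def)
next
  assume R: ?R
  then have "M = mat (card (pverts G)) (card (pverts G))
      (\<lambda>(i, j). if (j, i) \<in> parcs G then M $$ (i, j) else 0)"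
    by (intro mat_eqI[of _ "card (pverts G)" "card (pverts G)"]) auto
  then show "M \<in> digraph_algebra G"
    unfolding digraph_algebra_def by (intro CollectI exI[of _ "\<lambda>i j. M $$ (i, j)"]) simp
qed

lemma card_pverts_cycle_digraph [simp]: "card (pverts (cycle_digraph n)) = 2 * n"
  by (simp add: cycle_digraph_def)

lemma parcs_cycle_digraph_iff:
  "(j, i) \<in> parcs (cycle_digraph n) \<longleftrightarrow> i < 2 * n \<and> j < 2 * n \<and>
     (i = j \<or> even i \<and> odd j \<and> (j = Suc i mod (2 * n) \<or> i = Suc j mod (2 * n)))"
  by (auto simp: cycle_digraph_def)

lemma cycle_alg_carrier: "cycle_alg n \<subseteq> carrier_mat (2 * n) (2 * n)"
  by (auto simp: digraph_algebra_iff)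

lemma unit_mat_in_cycle_alg:
  "(j, i) \<in> parcs (cycle_digraph n) \<Longrightarrow> unit_mat (2 * n) i j \<in> cycle_alg n"
  by (auto simp: digraph_algebra_iff)

lemma one_in_cycle_alg: "1\<^sub>m (2 * n) \<in> cycle_alg n"
  by (auto simp: digraph_algebra_iff parcs_cycle_digraph_iff)

lemma cycle_proj_eq_unit_mat: "cycle_proj n j = unit_mat (2 * n) j j"
  by (simp add: cycle_proj_def unit_mat_def)

text \<open>\<open>D\<^sub>2\<^sub>n\<close> is connected as an undirected graph: the unit from 0 to
  \<open>j\<close> is the product of the units along the path 0, 1, ..., \<open>j\<close>, each
  taken directly or as an adjoint. Hence the generated star-algebra is the full matrix
  algebra.\<close>

lemma unit_mat_in_star_gen_cycle_alg:
  assumes "i < 2 * n" "j < 2 * n"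
  shows "unit_mat (2 * n) i j \<in> star_gen (cycle_alg n)"
proof -
  have *: "unit_mat (2 * n) 0 j \<in> star_gen (cycle_alg n)" if "j < 2 * n" for j
    using that
  proof (induction j)
    case 0
    then show ?case
      by (intro star_gen_incl unit_mat_in_cycle_alg) (simp add: parcs_cycle_digraph_iff)
  next
    case (Suc j)
    \<comment> \<open>Orientations alternate: for odd \<open>j\<close> the arc gives the reversed
      unit, whose adjoint is taken.\<close>
    have "unit_mat (2 * n) j (Suc j) \<in> star_gen (cycle_alg n)"
    proof (cases "even j")
      case True
      with Suc.prems show ?thesis
        by (intro star_gen_incl unit_mat_in_cycle_alg) (simp add: parcs_cycle_digraph_iff)
    next
      case False
      with Suc.prems have "unit_mat (2 * n) (Suc j) j \<in> star_gen (cycle_alg n)"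
        by (intro star_gen_incl unit_mat_in_cycle_alg) (simp add: parcs_cycle_digraph_iff)
      then show ?thesis using star_gen_star by (metis star_unit_mat)
    qed
    with Suc have "unit_mat (2 * n) 0 j * unit_mat (2 * n) j (Suc j) \<in> star_gen (cycle_alg n)"
      by (intro star_gen_mult) auto
    then show ?case using Suc.prems by (simp add: unit_mat_mult)
  qed
  have "star (unit_mat (2 * n) 0 i) * unit_mat (2 * n) 0 j \<in> star_gen (cycle_alg n)"
    using assms by (intro star_gen_mult star_gen_star *)
  then show ?thesis using assms by (simp add: star_unit_mat unit_mat_mult)
qed

text \<open>Such a family is the same thing as a star-extendible embedding of the cycle algebra, by
  \<open>cycle_units_of_embedding\<close> and \<open>star_ext_embedding_unit_comb\<close>. All the
  units lie in the generated star-algebra, but only those along arcs have to lie in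
  \<open>A\<close>.\<close>

definition cycle_units :: "nat \<Rightarrow> 'a::complex_star_algebra set \<Rightarrow> (nat \<Rightarrow> nat \<Rightarrow> 'a) \<Rightarrow> bool" where
  "cycle_units n A v \<longleftrightarrow>
     (\<forall>i<2 * n. v i i \<noteq> 0 \<and> (\<forall>j<2 * n. v i j \<in> star_gen A \<and> star (v i j) = v j i \<and>
        (\<forall>k<2 * n. \<forall>l<2 * n. v i j * v k l = (if j = k then v i l else 0)))) \<and>
     (\<forall>i j. (j, i) \<in> parcs (cycle_digraph n) \<longrightarrow> v i j \<in> A)"

definition unit_comb :: "nat \<Rightarrow> (nat \<Rightarrow> nat \<Rightarrow> 'a::complex_star_algebra) \<Rightarrow> complex mat \<Rightarrow> 'a" where
  "unit_comb n v x = (\<Sum>i<2 * n. \<Sum>j<2 * n. scaleC (x $$ (i, j)) (v i j))"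

lemma cycle_unitsD:
  assumes "cycle_units n A v" "i < 2 * n" "j < 2 * n"
  shows "v i i \<noteq> 0" "v i j \<in> star_gen A" "star (v i j) = v j i"
    and "k < 2 * n \<Longrightarrow> l < 2 * n \<Longrightarrow> v i j * v k l = (if j = k then v i l else 0)"
    and "(j, i) \<in> parcs (cycle_digraph n) \<Longrightarrow> v i j \<in> A"
  using assms unfolding cycle_units_def by auto

lemma unit_comb_unit_mat:
  assumes "i < 2 * n" "j < 2 * n"
  shows "unit_comb n v (unit_mat (2 * n) i j) = v i j"
proof -
  have "unit_comb n v (unit_mat (2 * n) i j)
      = (\<Sum>k<2 * n. \<Sum>l<2 * n. if l = j then (if k = i then v i j else 0) else 0)"
    unfolding unit_comb_def by (intro sum.cong) (auto simp: scaleC_one)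
  then show ?thesis using assms by simp
qed

lemma unit_comb_sandwich:
  assumes v: "cycle_units n A v" and ij: "i < 2 * n" "j < 2 * n"
  shows "v i i * unit_comb n v x * v j j = scaleC (x $$ (i, j)) (v i j)"
proof -
  have "v i i * unit_comb n v x * v j j
      = (\<Sum>k<2 * n. \<Sum>l<2 * n. v i i * scaleC (x $$ (k, l)) (v k l) * v j j)"
    by (simp add: unit_comb_def sum_distrib_left sum_distrib_right mult.assoc)
  also have "\<dots> = (\<Sum>k<2 * n. \<Sum>l<2 * n. if l = j then (if k = i then scaleC (x $$ (i, j)) (v i j) else 0) else 0)"
    using ij by (intro sum.cong refl)
      (auto simp: mult_scaleC_left mult_scaleC_right cycle_unitsD(4)[OF v])
  finally show ?thesis using ij by simp
qed

text \<open>The value at the unit matrix is computed along the partial diagonal sums, since matrices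
  of a fixed size carry no additive type class instance.\<close>

lemma cycle_units_extension:
  fixes \<Phi> :: "complex mat \<Rightarrow> 'a::complex_star_algebra"
  assumes n: "n \<ge> 1" and hom: "star_hom (star_gen (cycle_alg n)) (star_gen A) \<Phi>"
    and img: "\<Phi> ` cycle_alg n \<subseteq> A" and inj: "inj_on \<Phi> (cycle_alg n)"
  defines "v \<equiv> \<lambda>i j. \<Phi> (unit_mat (2 * n) i j)"
  shows "cycle_units n A v"
    and "\<And>x. x \<in> star_gen (cycle_alg n) \<Longrightarrow> \<Phi> x = unit_comb n v x"
proof -
  let ?U = "unit_mat (2 * n)" and ?B = "star_gen (cycle_alg n)"
  note U = unit_mat_in_star_gen_cycle_alg[of _ n]
  have pos: "0 < 2 * n" using n by simp
  \<comment> \<open>\<open>star_hom_zero\<close> asks for a domain of class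
    \<open>complex_star_algebra\<close>, which \<open>complex mat\<close> is not; the value at the
    zero matrix comes from homogeneity instead.\<close>
  have z: "0\<^sub>m (2 * n) (2 * n) = scaleC 0 (?U 0 0)"
    by (intro mat_eqI[of _ "2 * n" "2 * n"]) (simp_all add: index_scaleC_mat[of _ "2 * n" "2 * n"])
  have zA: "0\<^sub>m (2 * n) (2 * n) \<in> cycle_alg n"
    by (auto simp: digraph_algebra_iff)
  have \<Phi>0: "\<Phi> (0\<^sub>m (2 * n) (2 * n)) = 0"
    unfolding z star_homD(4)[OF hom U[OF pos pos]] by simp
  have mult: "v i j * v k l = (if j = k then v i l else 0)"
    if "i < 2 * n" "j < 2 * n" "k < 2 * n" "l < 2 * n" for i j k l
    using that unfolding v_def by (simp add: star_homD(3)[OF hom U U, symmetric] unit_mat_mult \<Phi>0)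
  have "v i i \<noteq> 0" if "i < 2 * n" for i
  proof
    assume "v i i = 0"
    moreover have "?U i i \<in> cycle_alg n"
      using that by (intro unit_mat_in_cycle_alg) (simp add: parcs_cycle_digraph_iff)
    ultimately have "?U i i = 0\<^sub>m (2 * n) (2 * n)"
      using zA \<Phi>0 by (intro inj_onD[OF inj]) (auto simp: v_def)
    then have "?U i i $$ (i, i) = 0" using that by simp
    then show False using that by simp
  qed
  moreover have "v i j \<in> A" if "(j, i) \<in> parcs (cycle_digraph n)" for i j
    using img unit_mat_in_cycle_alg[OF that] by (auto simp: v_def)
  ultimately show "cycle_units n A v"
    unfolding cycle_units_def using mult
    by (auto simp: v_def star_homD(1)[OF hom U] star_homD(5)[OF hom U, symmetric] star_unit_mat)
  define D where "D k = mat (2 * n) (2 * n) (\<lambda>(i, j). if i = j \<and> i < k then 1 else (0 :: complex))" for k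
  have D: "D k \<in> ?B \<and> \<Phi> (D k) = (\<Sum>i<k. v i i)" if "k \<le> 2 * n" for k
    using that
  proof (induction k)
    case 0
    have "D 0 = 0\<^sub>m (2 * n) (2 * n)" by (intro eq_matI) (auto simp: D_def)
    then show ?case using zA \<Phi>0 by (simp add: star_gen_incl)
  next
    case (Suc k)
    have eq: "D (Suc k) = D k + ?U k k"
      by (intro mat_eqI[of _ "2 * n" "2 * n"]) (auto simp: D_def)
    show ?case
      using Suc unfolding eq
      by (auto simp: star_gen_add U star_homD(2)[OF hom] v_def)
  qed
  fix x assume x: "x \<in> ?B"
  then have xc: "x \<in> carrier_mat (2 * n) (2 * n)"
    using star_gen_carrier_mat[OF cycle_alg_carrier] by blast
  have "D (2 * n) = 1\<^sub>m (2 * n)" by (intro eq_matI) (auto simp: D_def)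
  then have "x = D (2 * n) * x * D (2 * n)" using xc by simp
  then have "\<Phi> x = \<Phi> (D (2 * n) * x * D (2 * n))" by simp
  also have "\<dots> = (\<Sum>i<2 * n. v i i) * \<Phi> x * (\<Sum>i<2 * n. v i i)"
    using D[of "2 * n"] x by (simp add: star_homD(3)[OF hom] star_gen_mult)
  also have "\<dots> = (\<Sum>i<2 * n. \<Sum>j<2 * n. v i i * \<Phi> x * v j j)"
    by (simp add: sum_distrib_left sum_distrib_right mult.assoc)
      (rule sum.swap)
  also have "\<dots> = unit_comb n v x"
    unfolding unit_comb_def
  proof (intro sum.cong refl)
    fix i j assume ij: "i \<in> {..<2 * n}" "j \<in> {..<2 * n}"
    then have "v i i * \<Phi> x * v j j = \<Phi> (?U i i * x * ?U j j)"
      using x by (simp add: v_def star_homD(3)[OF hom] star_gen_mult U)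
    also have "\<dots> = scaleC (x $$ (i, j)) (v i j)"
      using ij xc by (simp add: unit_mat_sandwich star_homD(4)[OF hom U] v_def)
    finally show "v i i * \<Phi> x * v j j = scaleC (x $$ (i, j)) (v i j)" .
  qed
  finally show "\<Phi> x = unit_comb n v x" .
qed

lemma cycle_units_of_embedding:
  assumes n: "n \<ge> 1" and "star_ext_embedding (cycle_alg n) A \<rho>"
  obtains v where "cycle_units n A v" "\<And>x. x \<in> cycle_alg n \<Longrightarrow> \<rho> x = unit_comb n v x"
proof -
  obtain \<Phi> where \<Phi>: "star_hom (star_gen (cycle_alg n)) (star_gen A) \<Phi>"
    "\<forall>x\<in>cycle_alg n. \<rho> x = \<Phi> x"
    using star_ext_embedding_extension(1)[OF assms(2)] by blast
  have "\<Phi> ` cycle_alg n \<subseteq> A" "inj_on \<Phi> (cycle_alg n)"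
    using star_ext_embedding_extension(2,3)[OF assms(2)] \<Phi>(2) by (auto simp: inj_on_def)
  from cycle_units_extension[OF n \<Phi>(1) this] show ?thesis
    using \<Phi>(2) by (intro that) (auto intro: star_gen_incl)
qed

text \<open>Multiplicativity is the matrix product rule written out for the units \<open>v\<close>.
  Injectivity holds because the corner between \<open>v i i\<close> and \<open>v j j\<close>
  recovers the entry at (i, j).\<close>

lemma star_ext_embedding_unit_comb:
  assumes n: "n \<ge> 1" and v: "cycle_units n A v"
    and add: "\<And>x y. x \<in> A \<Longrightarrow> y \<in> A \<Longrightarrow> x + y \<in> A"
    and scale: "\<And>c x. x \<in> A \<Longrightarrow> scaleC c x \<in> A"
  shows "star_ext_embedding (cycle_alg n) A (unit_comb n v)"
proof -
  let ?B = "star_gen (cycle_alg n)"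
  note vD = cycle_unitsD[OF v]
  have v00: "v 0 0 \<in> A" using n by (intro vD(5)) (auto simp: parcs_cycle_digraph_iff)
  have "0 \<in> A" using scale[OF v00, of 0] by simp
  have sumA: "sum f I \<in> A" if "\<And>i. i \<in> I \<Longrightarrow> f i \<in> A" for f :: "nat \<Rightarrow> 'a" and I
    using that by (induction I rule: infinite_finite_induct) (auto intro: add \<open>0 \<in> A\<close>)
  have car: "x \<in> carrier_mat (2 * n) (2 * n)" if "x \<in> ?B" for x
    using star_gen_carrier_mat[OF cycle_alg_carrier] that by blast
  have "unit_comb n v x \<in> A" if "x \<in> cycle_alg n" for x
    unfolding unit_comb_def
  proof (intro sumA)
    fix i j assume "i \<in> {..<2 * n}" "j \<in> {..<2 * n}"
    then show "scaleC (x $$ (i, j)) (v i j) \<in> A"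
      using that vD(5)[of i j] \<open>0 \<in> A\<close>
      by (cases "(j, i) \<in> parcs (cycle_digraph n)") (auto simp: digraph_algebra_iff intro: scale)
  qed
  then have img: "unit_comb n v ` cycle_alg n \<subseteq> A" by blast
  \<comment> \<open>The codomain stays open here; \<open>star_extendibleI\<close> narrows it to
    \<open>star_gen A\<close>.\<close>
  have hom: "star_hom ?B UNIV (unit_comb n v)"
    unfolding star_hom_def
  proof (intro conjI ballI allI)
    fix x y assume xy: "x \<in> ?B" "y \<in> ?B"
    note c = car[OF xy(1)] car[OF xy(2)]
    show "unit_comb n v (x + y) = unit_comb n v x + unit_comb n v y"
      using c by (simp add: unit_comb_def scaleC_add_left sum.distrib)
    have "unit_comb n v x * unit_comb n v y = (\<Sum>i<2 * n. \<Sum>k<2 * n. \<Sum>j<2 * n. \<Sum>l<2 * n.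
        scaleC (x $$ (i, j) * y $$ (k, l)) (v i j * v k l))"
      unfolding unit_comb_def sum_product
      by (simp only: mult_scaleC_left mult_scaleC_right scaleC_scaleC
          mult.commute[where 'a = complex])
    also have "\<dots> = (\<Sum>i<2 * n. \<Sum>j<2 * n. \<Sum>k<2 * n. \<Sum>l<2 * n.
        scaleC (x $$ (i, j) * y $$ (k, l)) (v i j * v k l))"
      by (rule sum.cong[OF refl], rule sum.swap)
    also have "\<dots> = (\<Sum>i<2 * n. \<Sum>j<2 * n. \<Sum>k<2 * n. \<Sum>l<2 * n.
        if k = j then scaleC (x $$ (i, j) * y $$ (j, l)) (v i l) else 0)"
      by (intro sum.cong refl) (auto simp: vD(4))
    also have "\<dots> = (\<Sum>i<2 * n. \<Sum>j<2 * n. \<Sum>l<2 * n. scaleC (x $$ (i, j) * y $$ (j, l)) (v i l))"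
    proof (rule sum.cong[OF refl], rule sum.cong[OF refl])
      fix i j assume "j \<in> {..<2 * n}"
      then show "(\<Sum>k<2 * n. \<Sum>l<2 * n. if k = j then scaleC (x $$ (i, j) * y $$ (j, l)) (v i l) else 0)
          = (\<Sum>l<2 * n. scaleC (x $$ (i, j) * y $$ (j, l)) (v i l))"
        by (subst sum.swap) simp
    qed
    also have "\<dots> = (\<Sum>i<2 * n. \<Sum>l<2 * n. \<Sum>j<2 * n. scaleC (x $$ (i, j) * y $$ (j, l)) (v i l))"
      by (rule sum.cong[OF refl], rule sum.swap)
    also have "\<dots> = unit_comb n v (x * y)"
      unfolding unit_comb_def
    proof (rule sum.cong[OF refl], rule sum.cong[OF refl])
      fix i l assume "i \<in> {..<2 * n}" "l \<in> {..<2 * n}"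
      then have "(x * y) $$ (i, l) = (\<Sum>j<2 * n. x $$ (i, j) * y $$ (j, l))"
        using c by (intro index_mult_mat_sum) auto
      moreover have "(\<Sum>j\<in>J. scaleC (f j) z) = scaleC (sum f J) z"
        for J :: "nat set" and f and z :: 'a
        by (induction J rule: infinite_finite_induct) (simp_all add: scaleC_add_left)
      ultimately show "(\<Sum>j<2 * n. scaleC (x $$ (i, j) * y $$ (j, l)) (v i l))
          = scaleC ((x * y) $$ (i, l)) (v i l)" by simp
    qed
    finally show "unit_comb n v (x * y) = unit_comb n v x * unit_comb n v y" ..
    show "unit_comb n v (scaleC a x) = scaleC a (unit_comb n v x)" for a
      using c by (simp add: unit_comb_def index_scaleC_mat scaleC_sum scaleC_scaleC)
    have "star (unit_comb n v x) = (\<Sum>i<2 * n. \<Sum>j<2 * n. scaleC (cnj (x $$ (i, j))) (v j i))"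
      by (simp add: unit_comb_def star_sum star_scaleC vD(3))
    also have "\<dots> = (\<Sum>j<2 * n. \<Sum>i<2 * n. scaleC (cnj (x $$ (i, j))) (v j i))"
      by (rule sum.swap)
    also have "\<dots> = unit_comb n v (star x)"
      using c(1) by (simp add: unit_comb_def index_star_mat)
    finally show "unit_comb n v (star x) = star (unit_comb n v x)" ..
  qed auto
  have "inj_on (unit_comb n v) (cycle_alg n)"
  proof (rule inj_onI)
    fix x y assume xy: "x \<in> cycle_alg n" "y \<in> cycle_alg n" "unit_comb n v x = unit_comb n v y"
    show "x = y"
    proof (rule mat_eqI)
      fix i j assume ij: "i < 2 * n" "j < 2 * n"
      have "v i j * v j i = v i i" using ij by (simp add: vD(4))
      then have "v i j \<noteq> 0" using vD(1)[OF ij] by auto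
      then show "x $$ (i, j) = y $$ (i, j)"
        using unit_comb_sandwich[OF v ij, of x] unit_comb_sandwich[OF v ij, of y] xy(3)
        by (intro scaleC_right_cancel[of _ "v i j"]) auto
    qed (use xy cycle_alg_carrier in auto)
  qed
  then show ?thesis
    using star_extendibleI[OF hom _ img] by (simp add: star_ext_embedding_def)
qed

section \<open>Rank one projections and pattern matrices\<close>

text \<open>The bridge between rank and minimality: vanishing 2 by 2 minors are what makes
  \<open>M * X * M\<close> a multiple of \<open>M\<close>, and they are also what minimality of a
  projection yields entry by entry.\<close>

lemma rank_one_iff:
  fixes M :: "complex mat"
  assumes M: "M \<in> carrier_mat N N"
  shows "vec_space.rank N M = 1 \<longleftrightarrow> M \<noteq> 0\<^sub>m N N \<and>
    (\<forall>i<N. \<forall>j<N. \<forall>k<N. \<forall>l<N. M $$ (i, j) * M $$ (k, l) = M $$ (i, l) * M $$ (k, j))"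
    (is "_ \<longleftrightarrow> _ \<and> ?minors")
proof -
  interpret vec_space "TYPE(complex)" N .
  have colc: "col M j \<in> carrier_vec N" for j using M by auto
  have colset: "col M j \<in> set (cols M)" if "j < N" for j
    using that M by (auto simp: cols_def)
  show ?thesis
  proof
    assume r: "rank M = 1"
    have "M \<noteq> 0\<^sub>m N N" using r rank_0I[of N] by auto
    moreover have "M $$ (i, j) * M $$ (k, l) = M $$ (i, l) * M $$ (k, j)"
      if ijkl: "i < N" "j < N" "k < N" "l < N" for i j k l
    proof -
      define c where "c = col M j"
      define d where "d = col M l"
      have ix: "c $ i = M $$ (i, j)" "c $ k = M $$ (k, j)" "d $ i = M $$ (i, l)" "d $ k = M $$ (k, l)"
        using M ijkl by (auto simp: c_def d_def)
      show ?thesis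
      proof (cases "c = d")
        case False
        have sub: "{c, d} \<subseteq> set (cols M)" using ijkl colset by (auto simp: c_def d_def)
        have "lin_dep {c, d}"
        proof (rule ccontr)
          assume "\<not> lin_dep {c, d}"
          then have "card {c, d} \<le> rank M" by (intro rank_ge_card_indpt[OF M sub])
          with False r show False by simp
        qed
        then obtain a v where a: "lincomb a {c, d} = 0\<^sub>v N" "v \<in> {c, d}" "a v \<noteq> 0"
          using finite_lin_dep[of "{c, d}"] colc by (auto simp: c_def d_def)
        have "a c * c $ m + a d * d $ m = 0" if "m < N" for m
          using lincomb_index[OF that, of "{c, d}" a] colc False that a(1)
          by (simp add: c_def d_def)
        from this[OF ijkl(1)] this[OF ijkl(3)]
        have eqs: "a c * c $ i + a d * d $ i = 0" "a c * c $ k + a d * d $ k = 0" .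
        \<comment> \<open>Eliminating either unknown from the dependence relation in rows
          \<open>i\<close> and \<open>k\<close> shows that both coefficients annihilate the
          minor.\<close>
        have "a c * (c $ i * d $ k - d $ i * c $ k)
            = d $ k * (a c * c $ i + a d * d $ i) - d $ i * (a c * c $ k + a d * d $ k)"
          "a d * (c $ i * d $ k - d $ i * c $ k)
            = c $ i * (a c * c $ k + a d * d $ k) - c $ k * (a c * c $ i + a d * d $ i)"
          by (simp_all add: algebra_simps)
        then have "a c * (c $ i * d $ k - d $ i * c $ k) = 0" "a d * (c $ i * d $ k - d $ i * c $ k) = 0"
          by (simp_all add: eqs)
        with a(2,3) show ?thesis by (auto simp: ix)
      qed (use ix in auto)
    qed
    ultimately show "M \<noteq> 0\<^sub>m N N \<and> ?minors" by blast
  next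
    assume R: "M \<noteq> 0\<^sub>m N N \<and> ?minors"
    then obtain k l where kl: "k < N" "l < N" "M $$ (k, l) \<noteq> 0"
      using mat_eqI[OF M zero_carrier_mat] by force
    have "rank M \<le> 1"
    proof (rule rank_le_1_product_entries[OF M])
      fix i j assume "i < dim_row M" "j < dim_col M"
      then show "M $$ (i, j) = M $$ (i, l) * (M $$ (k, j) / M $$ (k, l))"
        using R kl M by (simp add: field_simps)
    qed
    moreover have "card {col M l} \<le> rank M"
    proof (rule rank_ge_card_indpt[OF M])
      show "{col M l} \<subseteq> set (cols M)" using kl colset by auto
      show "lin_indpt {col M l}"
      proof
        assume "lin_dep {col M l}"
        then obtain a v where a: "lincomb a {col M l} = 0\<^sub>v N" "v \<in> {col M l}" "a v \<noteq> 0"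
          using finite_lin_dep[of "{col M l}"] colc by auto
        then show False
          using lincomb_index[OF kl(1), of "{col M l}" a] colc kl M by auto
      qed
    qed
    ultimately show "rank M = 1" by simp
  qed
qed

section \<open>Direct sums of cycle algebras as pattern matrices\<close>

lemma star_gen_digraph_algebra_sum_carrier:
  "star_gen (digraph_algebra_sum Gs)
    \<subseteq> carrier_mat (\<Sum>G\<leftarrow>Gs. card (pverts G)) (\<Sum>G\<leftarrow>Gs. card (pverts G))"
proof (rule star_gen_carrier_mat, rule subsetI)
  fix X assume "X \<in> digraph_algebra_sum Gs"
  then obtain Ms where X: "X = diag_block_mat Ms" and "list_all2 (\<lambda>M G. M \<in> digraph_algebra G) Ms Gs"
    by (auto simp: digraph_algebra_sum_def)
  from this(2) have "map dim_row Ms = map (\<lambda>G. card (pverts G)) Gs"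
    "map dim_col Ms = map (\<lambda>G. card (pverts G)) Gs"
    by (induction) (auto simp: digraph_algebra_iff)
  then show "X \<in> carrier_mat (\<Sum>G\<leftarrow>Gs. card (pverts G)) (\<Sum>G\<leftarrow>Gs. card (pverts G))"
    unfolding X carrier_mat_def by (simp add: dim_diag_block_mat)
qed

text \<open>By transitivity an arc between two classes of mutually joined vertices is an arc between
  all their members. So \<open>G\<close> is the pullback of \<open>D\<^sub>2\<^sub>n\<close> along
  the class map followed by the isomorphism.\<close>

lemma cycle_type_labelling:
  assumes "is_cycle_type n G"
  obtains l where "\<And>u. u < card (pverts G) \<Longrightarrow> l u < 2 * n"
    and "\<And>u v. u < card (pverts G) \<Longrightarrow> v < card (pverts G) \<Longrightarrow>
           (u, v) \<in> parcs G \<longleftrightarrow> (l u, l v) \<in> parcs (cycle_digraph n)"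
proof -
  let ?R = "reduced_digraph G" and ?C = "cycle_digraph n"
  have V: "pverts G = {..<card (pverts G)}" and refl: "refl_on (pverts G) (parcs G)"
    and trans: "trans (parcs G)"
    using assms by (auto simp: is_cycle_type_def trans_refl_digraph_def)
  obtain f where iso: "pre_digraph.digraph_isomorphism (with_proj ?R) f"
    and C: "with_proj ?C = app_iso f (with_proj ?R)"
    using assms by (auto simp: is_cycle_type_def digraph_iso_def)
  have verts: "pverts ?C = iso_verts f ` pverts ?R" and arcs: "parcs ?C = iso_arcs f ` parcs ?R"
    and tail: "fst = iso_tail f" and head: "snd = iso_head f"
    using arg_cong[OF C, of verts] arg_cong[OF C, of arcs] arg_cong[OF C, of tail]
      arg_cong[OF C, of head] by simp_all
  define cl where "cl u = mutual_arcs G `` {u}" for u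
  define l where "l u = iso_verts f (cl u)" for u
  have inj: "inj_on (iso_verts f) (pverts ?R)"
    using iso by (simp add: pre_digraph.digraph_isomorphism_def)
  \<comment> \<open>Tail and head are \<open>fst\<close> and \<open>snd\<close> on both sides, so
    the vertex part of the isomorphism determines its arc part.\<close>
  have arc: "iso_arcs f (U, W) = (iso_verts f U, iso_verts f W)" if "(U, W) \<in> parcs ?R" for U W
  proof -
    have "iso_verts f U = fst (iso_arcs f (U, W))" "iso_verts f W = snd (iso_arcs f (U, W))"
      using iso that unfolding pre_digraph.digraph_isomorphism_def by (fastforce simp: tail head)+
    then show ?thesis by (simp add: prod_eq_iff)
  qed
  have cl: "cl u \<in> pverts ?R" "u \<in> cl u" if "u \<in> pverts G" for u
    using that refl by (auto simp: cl_def reduced_digraph_def mutual_arcs_def quotient_def refl_on_def)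
  have "l u < 2 * n" if "u < card (pverts G)" for u
  proof -
    have "l u \<in> pverts ?C" using cl(1)[of u] that V unfolding verts l_def by blast
    then show ?thesis by (simp add: cycle_digraph_def)
  qed
  moreover have "(u, v) \<in> parcs G \<longleftrightarrow> (l u, l v) \<in> parcs ?C"
    if "u < card (pverts G)" "v < card (pverts G)" for u v
  proof -
    have uv: "u \<in> pverts G" "v \<in> pverts G" using that V by blast+
    have "(u, v) \<in> parcs G \<longleftrightarrow> (cl u, cl v) \<in> parcs ?R"
    proof
      assume "(u, v) \<in> parcs G"
      then show "(cl u, cl v) \<in> parcs ?R"
        using cl[OF uv(1)] cl[OF uv(2)] by (auto simp: reduced_digraph_def)
    next
      assume "(cl u, cl v) \<in> parcs ?R"
      then obtain u' v' where "(u, u') \<in> parcs G" "(u', v') \<in> parcs G" "(v', v) \<in> parcs G"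
        by (auto simp: reduced_digraph_def cl_def mutual_arcs_def)
      then show "(u, v) \<in> parcs G" using trans by (meson transD)
    qed
    also have "\<dots> \<longleftrightarrow> (l u, l v) \<in> parcs ?C"
    proof
      assume "(cl u, cl v) \<in> parcs ?R"
      then show "(l u, l v) \<in> parcs ?C" unfolding arcs l_def using arc by force
    next
      assume "(l u, l v) \<in> parcs ?C"
      then obtain U W where UW: "(U, W) \<in> parcs ?R" "(l u, l v) = iso_arcs f (U, W)"
        unfolding arcs by auto
      then have "iso_verts f U = iso_verts f (cl u)" "iso_verts f W = iso_verts f (cl v)"
        by (simp_all add: arc l_def)
      moreover have "U \<in> pverts ?R" "W \<in> pverts ?R" using UW(1) by (auto simp: reduced_digraph_def)
      ultimately have "U = cl u" "W = cl v" using cl(1) uv inj by (auto dest: inj_onD)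
      with UW(1) show "(cl u, cl v) \<in> parcs ?R" by simp
    qed
    finally show ?thesis .
  qed
  ultimately show ?thesis by (rule that)
qed

text \<open>A direct sum of \<open>2n\<close>-cycle algebras is a single algebra of pattern matrices: the label of a
  row or column index is its summand together with the vertex of \<open>D\<^sub>2\<^sub>n\<close> that it is identified with.\<close>

definition label_arc :: "nat \<Rightarrow> nat \<times> nat \<Rightarrow> nat \<times> nat \<Rightarrow> bool" where
  "label_arc n \<alpha> \<beta> \<longleftrightarrow> fst \<alpha> = fst \<beta> \<and> (snd \<alpha>, snd \<beta>) \<in> parcs (cycle_digraph n)"

definition pattern_algebra :: "nat \<Rightarrow> nat \<Rightarrow> (nat \<Rightarrow> nat \<times> nat) \<Rightarrow> complex mat set" where
  "pattern_algebra n N lab = {M \<in> carrier_mat N N.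
     \<forall>a<N. \<forall>b<N. \<not> label_arc n (lab b) (lab a) \<longrightarrow> M $$ (a, b) = 0}"

lemma cycle_digraph_algebra_sum_pattern:
  assumes "\<forall>G\<in>set Gs. is_cycle_type n G"
  obtains N lab where "digraph_algebra_sum Gs = pattern_algebra n N lab" "\<And>a. a < N \<Longrightarrow> snd (lab a) < 2 * n"
  using assms
proof (induction Gs arbitrary: thesis)
  case Nil
  have "digraph_algebra_sum [] = pattern_algebra n 0 (\<lambda>a. (0, 0))"
    by (auto simp: digraph_algebra_sum_def pattern_algebra_def intro!: eq_matI)
  then show ?case by (intro Nil.prems) auto
next
  case (Cons G Gs)
  obtain N lab where IH: "digraph_algebra_sum Gs = pattern_algebra n N lab"
    "\<And>a. a < N \<Longrightarrow> snd (lab a) < 2 * n"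
    using Cons by auto
  obtain l where l: "\<And>u. u < card (pverts G) \<Longrightarrow> l u < 2 * n"
    "\<And>u v. u < card (pverts G) \<Longrightarrow> v < card (pverts G) \<Longrightarrow>
           (u, v) \<in> parcs G \<longleftrightarrow> (l u, l v) \<in> parcs (cycle_digraph n)"
    using cycle_type_labelling[of n G] Cons.prems by auto
  define K where "K = card (pverts G)"
  \<comment> \<open>The new summand gets index 0 and the earlier indices move up by one, so no label
    arc crosses between blocks.\<close>
  define lab' where "lab' a = (if a < K then (0, l a) else (Suc (fst (lab (a - K))), snd (lab (a - K))))" for a
  have block: "digraph_algebra_sum (G # Gs) = {four_block_mat M (0\<^sub>m K N) (0\<^sub>m N K) M' | M M'.
      M \<in> digraph_algebra G \<and> M' \<in> pattern_algebra n N lab}" (is "?L = ?R")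
  proof (intro equalityI subsetI)
    fix X assume "X \<in> ?L"
    then obtain M Ms where X: "X = diag_block_mat (M # Ms)" and M: "M \<in> digraph_algebra G"
      and Ms: "list_all2 (\<lambda>M G. M \<in> digraph_algebra G) Ms Gs"
      by (auto simp: digraph_algebra_sum_def list_all2_Cons2)
    have "diag_block_mat Ms \<in> pattern_algebra n N lab"
      using Ms unfolding IH(1)[symmetric] digraph_algebra_sum_def by blast
    moreover from this have "diag_block_mat Ms \<in> carrier_mat N N" by (simp add: pattern_algebra_def)
    moreover have "M \<in> carrier_mat K K" using M by (simp add: digraph_algebra_iff K_def)
    ultimately show "X \<in> ?R" using M unfolding X by (auto simp: Let_def)
  next
    fix X assume "X \<in> ?R"
    then obtain M M' where X: "X = four_block_mat M (0\<^sub>m K N) (0\<^sub>m N K) M'" and M: "M \<in> digraph_algebra G"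
      and M': "M' \<in> digraph_algebra_sum Gs" and M'c: "M' \<in> carrier_mat N N"
      unfolding IH(1) by (auto simp: pattern_algebra_def)
    obtain Ms where "M' = diag_block_mat Ms" "list_all2 (\<lambda>M G. M \<in> digraph_algebra G) Ms Gs"
      using M' by (auto simp: digraph_algebra_sum_def)
    moreover have "M \<in> carrier_mat K K" using M by (simp add: digraph_algebra_iff K_def)
    ultimately show "X \<in> ?L"
      using M M'c unfolding digraph_algebra_sum_def X
      by (intro CollectI exI[of _ "M # Ms"]) (auto simp: Let_def)
  qed
  have "{four_block_mat M (0\<^sub>m K N) (0\<^sub>m N K) M' | M M'.
      M \<in> digraph_algebra G \<and> M' \<in> pattern_algebra n N lab} = pattern_algebra n (K + N) lab'"
  proof (intro equalityI subsetI)
    fix X assume "X \<in> {four_block_mat M (0\<^sub>m K N) (0\<^sub>m N K) M' | M M'.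
      M \<in> digraph_algebra G \<and> M' \<in> pattern_algebra n N lab}"
    then show "X \<in> pattern_algebra n (K + N) lab'"
      by (auto simp: pattern_algebra_def digraph_algebra_iff K_def[symmetric] lab'_def label_arc_def l(2)
          split: if_splits)
  next
    fix X assume X: "X \<in> pattern_algebra n (K + N) lab'"
    then have Xc: "X \<in> carrier_mat (K + N) (K + N)"
      and X0: "\<And>a b. a < K + N \<Longrightarrow> b < K + N \<Longrightarrow> \<not> label_arc n (lab' b) (lab' a) \<Longrightarrow> X $$ (a, b) = 0"
      by (auto simp: pattern_algebra_def)
    define M where "M = mat K K (\<lambda>(a, b). X $$ (a, b))"
    define M' where "M' = mat N N (\<lambda>(a, b). X $$ (K + a, K + b))"
    have "M \<in> digraph_algebra G" "M' \<in> pattern_algebra n N lab"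
      using X0 by (auto simp: M_def M'_def digraph_algebra_iff pattern_algebra_def K_def[symmetric]
          lab'_def label_arc_def l(2))
    moreover have "X = four_block_mat M (0\<^sub>m K N) (0\<^sub>m N K) M'"
    proof (rule mat_eqI[OF Xc])
      fix a b assume "a < K + N" "b < K + N"
      then show "X $$ (a, b) = four_block_mat M (0\<^sub>m K N) (0\<^sub>m N K) M' $$ (a, b)"
        using X0[of a b] by (auto simp: M_def M'_def lab'_def label_arc_def)
    qed (auto simp: M_def M'_def)
    ultimately show "X \<in> {four_block_mat M (0\<^sub>m K N) (0\<^sub>m N K) M' | M M'.
      M \<in> digraph_algebra G \<and> M' \<in> pattern_algebra n N lab}" by blast
  qed
  moreover have "snd (lab' a) < 2 * n" if "a < K + N" for a
    using that l(1) IH(2) by (auto simp: lab'_def K_def)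
  ultimately show ?case using block by (intro Cons.prems(1)[of "K + N" lab']) auto
qed

text \<open>The substitute for rank one that refers to no realization: the corner at
  \<open>p\<close> is one-dimensional.\<close>

definition min_projection :: "'a::complex_star_algebra set \<Rightarrow> 'a \<Rightarrow> bool" where
  "min_projection A p \<longleftrightarrow> p \<in> star_gen A \<and> star p = p \<and> p * p = p \<and> p \<noteq> 0 \<and>
     (\<forall>x\<in>star_gen A. \<exists>c. p * x * p = scaleC c p)"

lemma min_projectionD:
  assumes "min_projection A p"
  shows "p \<in> star_gen A" "star p = p" "p * p = p" "p \<noteq> 0"
    and "x \<in> star_gen A \<Longrightarrow> \<exists>c. p * x * p = scaleC c p"
  using assms unfolding min_projection_def by blast+

text \<open>This works in whichever realization witnesses the rank. With vanishing minors, M X M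
  equals the trace of X M times M, and injectivity of \<open>\<theta>\<close> carries the identity
  back to \<open>star_gen A\<close>.\<close>

lemma min_projection_of_rank_one:
  assumes rank: "has_rank_in A p 1" and p: "p \<in> star_gen A" "star p = p" "p * p = p"
  shows "min_projection A p"
proof -
  obtain Gs \<theta> where real: "digraph_sum_realization A Gs \<theta>"
    and r: "vec_space.rank (dim_row (\<theta> p)) (\<theta> p) = 1"
    using rank unfolding has_rank_in_def by blast
  define N where "N = (\<Sum>G\<leftarrow>Gs. card (pverts G))"
  have hom: "star_hom (star_gen A) (star_gen (digraph_algebra_sum Gs)) \<theta>"
    and inj: "inj_on \<theta> (star_gen A)"
    using real by (auto simp: digraph_sum_realization_def bij_betw_def)
  have car: "\<theta> x \<in> carrier_mat N N" if "x \<in> star_gen A" for x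
    using star_homD(1)[OF hom that] star_gen_digraph_algebra_sum_carrier[of Gs] by (auto simp: N_def)
  define M where "M = \<theta> p"
  have M: "M \<in> carrier_mat N N" using car[OF p(1)] by (simp add: M_def)
  have "M \<noteq> 0\<^sub>m N N" and minors: "\<And>i j k l. i < N \<Longrightarrow> j < N \<Longrightarrow> k < N \<Longrightarrow> l < N \<Longrightarrow>
      M $$ (i, j) * M $$ (k, l) = M $$ (i, l) * M $$ (k, j)"
    using r rank_one_iff[OF M] M unfolding M_def[symmetric] by simp_all
  have "p \<noteq> 0"
  proof
    assume "p = 0"
    then have "M = scaleC 0 M"
      unfolding M_def using star_homD(4)[OF hom p(1), of 0] by simp
    also have "\<dots> = 0\<^sub>m N N"
      using M by (intro mat_eqI[of _ N N]) (auto simp: index_scaleC_mat)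
    finally show False using \<open>M \<noteq> 0\<^sub>m N N\<close> by simp
  qed
  moreover have "\<exists>c. p * x * p = scaleC c p" if x: "x \<in> star_gen A" for x
  proof -
    define X where "X = \<theta> x"
    have X: "X \<in> carrier_mat N N" using car[OF x] by (simp add: X_def)
    define c where "c = (\<Sum>l<N. \<Sum>k<N. X $$ (k, l) * M $$ (l, k))"
    have "\<theta> (p * x * p) = M * X * M"
      using p(1) x by (simp add: star_homD(3)[OF hom] star_gen_mult M_def X_def)
    also have "\<dots> = scaleC c M"
    proof (rule mat_eqI[of _ N N])
      fix i j assume ij: "i < N" "j < N"
      have "M * X \<in> carrier_mat N N" using M X by (rule mult_carrier_mat)
      then have "(M * X * M) $$ (i, j) = (\<Sum>l<N. (M * X) $$ (i, l) * M $$ (l, j))"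
        using M ij by (rule index_mult_mat_sum)
      also have "\<dots> = (\<Sum>l<N. (\<Sum>k<N. M $$ (i, k) * X $$ (k, l)) * M $$ (l, j))"
        using ij by (intro sum.cong refl arg_cong2[of _ _ _ _ "(*)"] index_mult_mat_sum[OF M X]) auto
      also have "\<dots> = (\<Sum>l<N. \<Sum>k<N. X $$ (k, l) * (M $$ (i, k) * M $$ (l, j)))"
        unfolding sum_distrib_right by (intro sum.cong refl) (simp add: mult_ac)
      also have "\<dots> = (\<Sum>l<N. \<Sum>k<N. X $$ (k, l) * M $$ (l, k)) * M $$ (i, j)"
        unfolding sum_distrib_right
      proof (intro sum.cong refl)
        fix l k assume "l \<in> {..<N}" "k \<in> {..<N}"
        then show "X $$ (k, l) * (M $$ (i, k) * M $$ (l, j)) = X $$ (k, l) * M $$ (l, k) * M $$ (i, j)"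
          using minors[of i k l j] ij by (simp add: mult_ac)
      qed
      finally show "(M * X * M) $$ (i, j) = scaleC c M $$ (i, j)"
        using ij M by (simp add: index_scaleC_mat c_def)
    qed (use M X in \<open>auto intro!: mult_carrier_mat[of _ N N]\<close>)
    also have "\<dots> = \<theta> (scaleC c p)" using star_homD(4)[OF hom p(1)] by (simp add: M_def)
    finally have "p * x * p = scaleC c p"
      by (rule inj_onD[OF inj]) (intro star_gen_mult star_gen_scaleC p(1) x)+
    then show ?thesis by blast
  qed
  ultimately show ?thesis using p by (simp add: min_projection_def)
qed

lemma label_arc_refl: "snd \<alpha> < 2 * n \<Longrightarrow> label_arc n \<alpha> \<alpha>"
  by (simp add: label_arc_def parcs_cycle_digraph_iff)

lemma label_arc_antisym: "label_arc n \<alpha> \<beta> \<Longrightarrow> label_arc n \<beta> \<alpha> \<Longrightarrow> \<alpha> = \<beta>"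
  unfolding label_arc_def parcs_cycle_digraph_iff by (metis prod_eqI)

section \<open>Realized direct sums of cycle algebras\<close>

text \<open>One \<open>\<theta>\<close> is fixed, and identities in \<open>star_gen A\<close> are
  then checked on matrix entries. \<open>Gs\<close> is kept as a parameter because
  \<open>has_rank_in\<close> is stated through realizations.\<close>

locale cycle_realization =
  fixes n :: nat and A :: "'a::complex_star_algebra set" and Gs :: "nat pair_pre_digraph list"
    and \<theta> :: "'a \<Rightarrow> complex mat" and N :: nat and lab :: "nat \<Rightarrow> nat \<times> nat"
  assumes realization: "digraph_sum_realization A Gs \<theta>"
    and pattern: "digraph_algebra_sum Gs = pattern_algebra n N lab"
    and lab_less: "a < N \<Longrightarrow> snd (lab a) < 2 * n"
begin

abbreviation B :: "'a set" where "B \<equiv> star_gen A"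

lemma hom: "star_hom B (star_gen (pattern_algebra n N lab)) \<theta>"
  and inj: "inj_on \<theta> B"
  and img: "\<theta> ` A = pattern_algebra n N lab"
  using realization unfolding digraph_sum_realization_def pattern bij_betw_def by blast+

lemma A_in_B: "x \<in> A \<Longrightarrow> x \<in> B"
  by (rule star_gen_incl)

lemma A_nonempty: "A \<noteq> {}"
proof -
  have "0\<^sub>m N N \<in> pattern_algebra n N lab" by (simp add: pattern_algebra_def)
  then show ?thesis using img by auto
qed

lemma zero_in_B: "0 \<in> B"
proof -
  obtain x where "x \<in> A" using A_nonempty by blast
  then show ?thesis by (rule star_gen_zero[OF A_in_B])
qed

lemma carrier:
  assumes "x \<in> B" shows "\<theta> x \<in> carrier_mat N N"
proof -
  have "pattern_algebra n N lab \<subseteq> carrier_mat N N" by (auto simp: pattern_algebra_def)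
  from star_gen_carrier_mat[OF this] star_homD(1)[OF hom assms] show ?thesis by blast
qed

lemma entry_add: "x \<in> B \<Longrightarrow> y \<in> B \<Longrightarrow> a < N \<Longrightarrow> b < N \<Longrightarrow> \<theta> (x + y) $$ (a, b) = \<theta> x $$ (a, b) + \<theta> y $$ (a, b)"
  using carrier[of x] carrier[of y] by (simp add: star_homD(2)[OF hom])

lemma entry_mult: "x \<in> B \<Longrightarrow> y \<in> B \<Longrightarrow> a < N \<Longrightarrow> b < N \<Longrightarrow>
    \<theta> (x * y) $$ (a, b) = (\<Sum>k<N. \<theta> x $$ (a, k) * \<theta> y $$ (k, b))"
  using carrier[of x] carrier[of y] by (simp add: star_homD(3)[OF hom] index_mult_mat_sum del: index_mult_mat)

lemma entry_scaleC: "x \<in> B \<Longrightarrow> a < N \<Longrightarrow> b < N \<Longrightarrow> \<theta> (scaleC c x) $$ (a, b) = c * \<theta> x $$ (a, b)"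
  using carrier[of x] by (simp add: star_homD(4)[OF hom] index_scaleC_mat)

lemma entry_star: "x \<in> B \<Longrightarrow> a < N \<Longrightarrow> b < N \<Longrightarrow> \<theta> (star x) $$ (a, b) = cnj (\<theta> x $$ (b, a))"
  using carrier[of x] by (simp add: star_homD(5)[OF hom] index_star_mat)

lemma entry_zero: "a < N \<Longrightarrow> b < N \<Longrightarrow> \<theta> 0 $$ (a, b) = 0"
  using entry_scaleC[OF zero_in_B, of a b 0] by simp

lemma entry_sum:
  "(\<And>i. i \<in> I \<Longrightarrow> f i \<in> B) \<Longrightarrow> a < N \<Longrightarrow> b < N \<Longrightarrow> \<theta> (sum f I) $$ (a, b) = (\<Sum>i\<in>I. \<theta> (f i) $$ (a, b))"
  by (induction I rule: infinite_finite_induct)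
    (simp_all add: entry_zero entry_add star_gen_sum[OF A_nonempty])

lemma eq_by_entries:
  assumes "x \<in> B" "y \<in> B" "\<And>a b. a < N \<Longrightarrow> b < N \<Longrightarrow> \<theta> x $$ (a, b) = \<theta> y $$ (a, b)"
  shows "x = y"
  using mat_eqI[OF carrier[OF assms(1)] carrier[OF assms(2)] assms(3)] inj assms(1,2)
  by (auto dest: inj_onD)

lemma in_A_iff:
  assumes "x \<in> B"
  shows "x \<in> A \<longleftrightarrow> (\<forall>a<N. \<forall>b<N. \<not> label_arc n (lab b) (lab a) \<longrightarrow> \<theta> x $$ (a, b) = 0)" (is "_ \<longleftrightarrow> ?R")
proof
  assume "x \<in> A"
  then have "\<theta> x \<in> pattern_algebra n N lab" using img by blast
  then show ?R by (simp add: pattern_algebra_def)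
next
  assume ?R
  then have "\<theta> x \<in> \<theta> ` A" unfolding img using carrier[OF assms] by (simp add: pattern_algebra_def)
  then obtain y where "y \<in> A" "\<theta> x = \<theta> y" by blast
  then show "x \<in> A" using inj assms A_in_B by (metis inj_onD)
qed

lemma add_in_A: "x \<in> A \<Longrightarrow> y \<in> A \<Longrightarrow> x + y \<in> A"
  using in_A_iff[OF A_in_B, of x] in_A_iff[OF A_in_B, of y]
  by (auto simp: in_A_iff[OF star_gen_add] A_in_B entry_add)

lemma scaleC_in_A: "x \<in> A \<Longrightarrow> scaleC c x \<in> A"
  using in_A_iff[OF A_in_B, of x]
  by (auto simp: in_A_iff[OF star_gen_scaleC] A_in_B entry_scaleC)

section \<open>Diagonal elements, block projections and coordinate projections\<close>

definition element :: "complex mat \<Rightarrow> 'a" where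
  "element M = (SOME x. x \<in> A \<and> \<theta> x = M)"

lemma element:
  assumes "M \<in> pattern_algebra n N lab"
  shows "element M \<in> A" "\<theta> (element M) = M"
proof -
  have "\<exists>x. x \<in> A \<and> \<theta> x = M" using assms unfolding img[symmetric] by auto
  from someI_ex[OF this] show "element M \<in> A" "\<theta> (element M) = M" by (auto simp: element_def)
qed

text \<open>The common form of the block projections \<open>Q\<close> and the coordinate projections
  \<open>e\<close>, so that both share one set of entry rules.\<close>

definition diag :: "(nat \<Rightarrow> bool) \<Rightarrow> 'a" where
  "diag P = element (mat N N (\<lambda>(a, b). if a = b \<and> P a then 1 else 0))"

lemma diag_in_A: "diag P \<in> A"
  and entry_diag: "a < N \<Longrightarrow> b < N \<Longrightarrow> \<theta> (diag P) $$ (a, b) = (if a = b \<and> P a then 1 else 0)"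
proof -
  have "mat N N (\<lambda>(a, b). if a = b \<and> P a then 1 else 0) \<in> pattern_algebra n N lab"
    by (auto simp: pattern_algebra_def label_arc_refl lab_less)
  from element[OF this] show "diag P \<in> A"
    and "a < N \<Longrightarrow> b < N \<Longrightarrow> \<theta> (diag P) $$ (a, b) = (if a = b \<and> P a then 1 else 0)"
    by (simp_all add: diag_def)
qed

lemma diag_in_B: "diag P \<in> B"
  by (rule A_in_B[OF diag_in_A])

lemma entry_diag_mult:
  assumes "x \<in> B" "a < N" "b < N"
  shows "\<theta> (diag P * x) $$ (a, b) = (if P a then \<theta> x $$ (a, b) else 0)"
proof -
  have "\<theta> (diag P * x) $$ (a, b) = (\<Sum>k<N. if k = a then (if P a then \<theta> x $$ (a, b) else 0) else 0)"
    unfolding entry_mult[OF diag_in_B assms]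
    by (intro sum.cong) (use assms in \<open>auto simp: entry_diag\<close>)
  then show ?thesis using assms by simp
qed

lemma entry_mult_diag:
  assumes "x \<in> B" "a < N" "b < N"
  shows "\<theta> (x * diag P) $$ (a, b) = (if P b then \<theta> x $$ (a, b) else 0)"
proof -
  have "\<theta> (x * diag P) $$ (a, b) = (\<Sum>k<N. if k = b then (if P b then \<theta> x $$ (a, b) else 0) else 0)"
    unfolding entry_mult[OF assms(1) diag_in_B assms(2,3)]
    by (intro sum.cong) (use assms in \<open>auto simp: entry_diag\<close>)
  then show ?thesis using assms by simp
qed

lemmas B_closed = star_gen_add star_gen_mult star_gen_scaleC star_gen_star diag_in_B zero_in_B
lemmas entries = entry_diag entry_diag_mult entry_mult_diag entry_star entry_scaleC entry_zero

lemma star_diag: "star (diag P) = diag P"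
  by (rule eq_by_entries) (auto simp: entries B_closed)

lemma diag_mult_diag: "diag P * diag R = diag (\<lambda>a. P a \<and> R a)"
  by (rule eq_by_entries) (auto simp: entries B_closed)

lemma diag_all: "x \<in> B \<Longrightarrow> diag (\<lambda>_. True) * x = x" "x \<in> B \<Longrightarrow> x * diag (\<lambda>_. True) = x"
  by (rule eq_by_entries; simp add: entries B_closed)+

lemma diag_eq_zero: "(\<And>a. a < N \<Longrightarrow> \<not> P a) \<Longrightarrow> diag P = 0"
  by (rule eq_by_entries) (auto simp: entries B_closed)

text \<open>For \<alpha> in \<open>labels\<close> these are the minimal central projections of the
  diagonal part, the intersection of \<open>A\<close> with its adjoint; for other \<alpha> they
  vanish. Each \<open>e a\<close> with \<open>a < N\<close> is a minimal projection of
  \<open>star_gen A\<close>.\<close>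

definition Q :: "nat \<times> nat \<Rightarrow> 'a" where "Q \<alpha> = diag (\<lambda>a. lab a = \<alpha>)"
definition e :: "nat \<Rightarrow> 'a" where "e a = diag (\<lambda>b. b = a)"
definition labels :: "(nat \<times> nat) set" where "labels = lab ` {..<N}"

lemma finite_labels [simp]: "finite labels"
  by (simp add: labels_def)

lemma Q_in_A: "Q \<alpha> \<in> A" and Q_in_B: "Q \<alpha> \<in> B" and star_Q: "star (Q \<alpha>) = Q \<alpha>"
  by (simp_all add: Q_def diag_in_A diag_in_B star_diag)

lemma e_in_B: "e a \<in> B" and star_e: "star (e a) = e a"
  by (simp_all add: e_def diag_in_B star_diag)

lemma Q_mult_Q: "Q \<alpha> * Q \<beta> = (if \<alpha> = \<beta> then Q \<alpha> else 0)"
  by (auto simp: Q_def diag_mult_diag intro: diag_eq_zero)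

lemma e_mult_e: "e a * e b = (if a = b then e a else 0)"
  by (auto simp: e_def diag_mult_diag intro: diag_eq_zero)

lemma Q_mult_e: "Q \<alpha> * e a = (if lab a = \<alpha> then e a else 0)"
proof -
  have "(\<lambda>b. lab b = \<alpha> \<and> b = a) = (if lab a = \<alpha> then (\<lambda>b. b = a) else (\<lambda>_. False))" by auto
  then show ?thesis by (auto simp: Q_def e_def diag_mult_diag intro: diag_eq_zero)
qed

lemma sum_Q: "(\<Sum>\<alpha>\<in>labels. Q \<alpha>) = diag (\<lambda>_. True)"
proof (rule eq_by_entries)
  fix a b assume ab: "a < N" "b < N"
  have "\<theta> (\<Sum>\<alpha>\<in>labels. Q \<alpha>) $$ (a, b) = (\<Sum>\<alpha>\<in>labels. \<theta> (Q \<alpha>) $$ (a, b))"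
    using ab by (intro entry_sum Q_in_B)
  also have "\<dots> = (\<Sum>\<alpha>\<in>labels. if \<alpha> = lab a then (if a = b then 1 else 0) else 0)"
    by (intro sum.cong refl) (use ab in \<open>auto simp: Q_def entries\<close>)
  also have "\<dots> = \<theta> (diag (\<lambda>_. True)) $$ (a, b)"
    using ab by (auto simp: entries labels_def)
  finally show "\<theta> (\<Sum>\<alpha>\<in>labels. Q \<alpha>) $$ (a, b) = \<theta> (diag (\<lambda>_. True)) $$ (a, b)" .
qed (auto intro: star_gen_sum[OF A_nonempty] Q_in_B diag_in_B)

lemma sum_e: "(\<Sum>a<N. e a) = diag (\<lambda>_. True)"
proof (rule eq_by_entries)
  fix a b assume ab: "a < N" "b < N"
  have "\<theta> (\<Sum>k<N. e k) $$ (a, b) = (\<Sum>k<N. \<theta> (e k) $$ (a, b))"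
    using ab by (intro entry_sum e_in_B)
  also have "\<dots> = (\<Sum>k<N. if k = a then (if a = b then 1 else 0) else 0)"
    by (intro sum.cong refl) (use ab in \<open>auto simp: e_def entries\<close>)
  also have "\<dots> = \<theta> (diag (\<lambda>_. True)) $$ (a, b)"
    using ab by (auto simp: entries)
  finally show "\<theta> (\<Sum>k<N. e k) $$ (a, b) = \<theta> (diag (\<lambda>_. True)) $$ (a, b)" .
qed (auto intro: star_gen_sum[OF A_nonempty] e_in_B diag_in_B)

lemma sum_Q_mult: "x \<in> B \<Longrightarrow> (\<Sum>\<alpha>\<in>labels. Q \<alpha> * x) = x"
  and sum_mult_Q: "x \<in> B \<Longrightarrow> (\<Sum>\<alpha>\<in>labels. x * Q \<alpha>) = x"
  by (simp_all add: sum_distrib_left[symmetric] sum_distrib_right[symmetric] sum_Q diag_all)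

lemma sum_mult_e: "x \<in> B \<Longrightarrow> (\<Sum>a<N. x * e a) = x"
  by (simp add: sum_distrib_left[symmetric] sum_e diag_all)

lemma Q_mult_A_mult_Q:
  assumes "x \<in> A" "\<not> label_arc n \<beta> \<alpha>"
  shows "Q \<alpha> * x * Q \<beta> = 0"
proof (rule eq_by_entries)
  show "Q \<alpha> * x * Q \<beta> \<in> B" using assms(1) by (intro B_closed Q_in_B A_in_B)
  fix a b assume "a < N" "b < N"
  then show "\<theta> (Q \<alpha> * x * Q \<beta>) $$ (a, b) = \<theta> 0 $$ (a, b)"
    using assms in_A_iff[OF A_in_B, of x] by (auto simp: Q_def entries B_closed A_in_B)
qed (rule zero_in_B)

lemma Q_mult_B_mult_Q:
  assumes "x \<in> B" "label_arc n \<beta> \<alpha>"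
  shows "Q \<alpha> * x * Q \<beta> \<in> A"
proof -
  have "Q \<alpha> * x * Q \<beta> \<in> B" using assms(1) by (intro B_closed Q_in_B)
  then show ?thesis using assms by (auto simp: in_A_iff Q_def entries B_closed)
qed

lemma Q_block_in_A:
  assumes "x \<in> B"
  shows "Q \<alpha> * x * Q \<alpha> \<in> A" "star (Q \<alpha> * x * Q \<alpha>) \<in> A"
proof -
  have *: "Q \<alpha> * y * Q \<alpha> \<in> A" if "y \<in> B" for y
  proof -
    have "Q \<alpha> * y * Q \<alpha> \<in> B" using that by (intro B_closed Q_in_B)
    then show ?thesis using that by (auto simp: in_A_iff Q_def entries B_closed label_arc_refl lab_less)
  qed
  show "Q \<alpha> * x * Q \<alpha> \<in> A" by (rule *[OF assms])
  show "star (Q \<alpha> * x * Q \<alpha>) \<in> A"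
    using *[of "star x"] assms by (simp add: star_mult star_Q mult.assoc B_closed)
qed

text \<open>An entry of \<open>x\<close> between distinct labels needs an arc in one direction
  because \<open>x\<close> is in \<open>A\<close>, and in the other because \<open>star x\<close>
  is. \<open>D\<^sub>2\<^sub>n\<close> has no such pair of arcs, so \<open>x\<close> is block
  diagonal.\<close>

lemma Q_commute:
  assumes "x \<in> A" "star x \<in> A"
  shows "Q \<alpha> * x = x * Q \<alpha>"
proof (rule eq_by_entries)
  fix a b assume ab: "a < N" "b < N"
  have "\<theta> x $$ (a, b) = 0" if "lab a \<noteq> lab b"
    using assms in_A_iff[of x] in_A_iff[of "star x"] label_arc_antisym[of n "lab a" "lab b"] ab that
    by (auto simp: A_in_B entries)
  then show "\<theta> (Q \<alpha> * x) $$ (a, b) = \<theta> (x * Q \<alpha>) $$ (a, b)"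
    using ab assms by (auto simp: Q_def entries A_in_B)
qed (use assms in \<open>auto intro: B_closed Q_in_B A_in_B\<close>)

lemma e_nonzero: "a < N \<Longrightarrow> e a \<noteq> 0"
  using entry_diag[of a a "\<lambda>b. b = a"] entry_zero[of a a] by (auto simp: e_def)

lemma e_sandwich:
  assumes "x \<in> B" "a < N"
  shows "e a * x * e a = scaleC (\<theta> x $$ (a, a)) (e a)"
proof (rule eq_by_entries)
  fix i j assume "i < N" "j < N"
  then show "\<theta> (e a * x * e a) $$ (i, j) = \<theta> (scaleC (\<theta> x $$ (a, a)) (e a)) $$ (i, j)"
    using assms by (auto simp: e_def entries B_closed)
qed (use assms in \<open>auto intro: B_closed e_in_B\<close>)

text \<open>This is p = p* p read on the diagonal. Its use is that a vanishing diagonal entry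
  annihilates the whole column.\<close>

lemma entry_projection:
  assumes "p \<in> B" "star p = p" "p * p = p" "a < N"
  shows "\<theta> p $$ (a, a) = complex_of_real (\<Sum>k<N. (cmod (\<theta> p $$ (k, a)))\<^sup>2)"
proof -
  have "\<theta> p $$ (a, a) = (\<Sum>k<N. \<theta> (star p) $$ (a, k) * \<theta> p $$ (k, a))"
    using entry_mult[OF assms(1,1) assms(4,4)] assms by simp
  also have "\<dots> = (\<Sum>k<N. complex_of_real ((cmod (\<theta> p $$ (k, a)))\<^sup>2))"
    using assms(4) by (intro sum.cong refl, subst entry_star[OF assms(1)])
      (simp_all add: complex_norm_square mult.commute del: of_real_power)
  finally show ?thesis by simp
qed

lemma e_projection:
  assumes p: "p \<in> B" "star p = p" "p * p = p" and a: "a < N"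
  obtains c :: real where "c \<ge> 0" "e a * p * e a = scaleC (complex_of_real c) (e a)"
    "c = 0 \<Longrightarrow> p * e a = 0"
proof
  let ?c = "\<Sum>k<N. (cmod (\<theta> p $$ (k, a)))\<^sup>2"
  show "?c \<ge> 0" by (simp add: sum_nonneg)
  show "e a * p * e a = scaleC (complex_of_real ?c) (e a)"
    using e_sandwich[OF p(1) a] entry_projection[OF p a] by simp
  assume "?c = 0"
  then have *: "\<theta> p $$ (k, a) = 0" if "k < N" for k
    using that by (subst (asm) sum_nonneg_eq_0_iff) auto
  show "p * e a = 0"
    by (rule eq_by_entries) (use p a * in \<open>auto simp: e_def entries B_closed\<close>)
qed

text \<open>Minimality is tested on a coordinate projection \<open>e l\<close> for which column
  \<open>l\<close> of \<open>p\<close> is nonzero. The product \<open>p * e l * p\<close> is the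
  outer product of column \<open>l\<close> and row \<open>l\<close>, and it is a nonzero multiple of
  \<open>p\<close>, so the minors of \<open>p\<close> vanish.\<close>

lemma has_rank_one_of_min_projection:
  assumes "min_projection A p"
  shows "has_rank_in A p 1"
proof -
  note p = min_projectionD[OF assms]
  let ?M = "\<theta> p"
  have M: "?M \<in> carrier_mat N N" by (rule carrier[OF p(1)])
  obtain k l where kl: "k < N" "l < N" "?M $$ (k, l) \<noteq> 0"
    using eq_by_entries[OF p(1) zero_in_B] p(4) entry_zero by metis
  have Ml: "?M $$ (l, l) \<noteq> 0"
  proof
    assume "?M $$ (l, l) = 0"
    then have "(\<Sum>k<N. (cmod (?M $$ (k, l)))\<^sup>2) = 0"
      using entry_projection[OF p(1-3) kl(2)] by (simp del: of_real_sum)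
    then have "(cmod (?M $$ (k, l)))\<^sup>2 = 0"
      using kl by (subst (asm) sum_nonneg_eq_0_iff) auto
    with kl show False by simp
  qed
  obtain c where c: "p * e l * p = scaleC c p" using p(5)[OF e_in_B] by blast
  have prod: "?M $$ (i, l) * ?M $$ (l, j) = c * ?M $$ (i, j)" if "i < N" "j < N" for i j
  proof -
    have "\<theta> (p * e l * p) $$ (i, j) = (\<Sum>m<N. \<theta> (p * e l) $$ (i, m) * ?M $$ (m, j))"
      using p(1) that by (intro entry_mult) (auto intro: B_closed e_in_B)
    also have "\<dots> = (\<Sum>m<N. if m = l then ?M $$ (i, l) * ?M $$ (l, j) else 0)"
      using p(1) that by (intro sum.cong) (auto simp: e_def entries)
    finally show ?thesis using c kl p(1) that by (simp add: entry_scaleC)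
  qed
  have "c = ?M $$ (l, l)" using prod[OF kl(2,2)] Ml by simp
  then have c0: "c \<noteq> 0" using Ml by simp
  have "?M $$ (i, j) * ?M $$ (k, m) = ?M $$ (i, m) * ?M $$ (k, j)"
    if "i < N" "j < N" "k < N" "m < N" for i j k m
  proof -
    have "(c * ?M $$ (i, j)) * (c * ?M $$ (k, m)) = (c * ?M $$ (i, m)) * (c * ?M $$ (k, j))"
      using that by (simp add: prod[symmetric] mult_ac)
    then show ?thesis using c0 by (simp add: mult_ac)
  qed
  moreover have "?M \<noteq> 0\<^sub>m N N" using kl by auto
  ultimately have "vec_space.rank N ?M = 1" using rank_one_iff[OF M] by blast
  then show ?thesis unfolding has_rank_in_def using realization M by auto
qed

lemma partial_isometry_in_block:
  assumes "a < N" "b < N" "lab a = lab b"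
  obtains u where "u \<in> A" "star u \<in> A" "star u * u = e a" "u * star u = e b"
proof -
  have pat: "unit_mat N i j \<in> pattern_algebra n N lab" if "i < N" "j < N" "lab i = lab j" for i j
    using that by (auto simp: pattern_algebra_def label_arc_refl lab_less)
  note u = element[OF pat[of b a]] and w = element[OF pat[of a b]]
  let ?u = "element (unit_mat N b a)" and ?w = "element (unit_mat N a b)"
  have uw: "?u \<in> B" "?w \<in> B" using u w assms by (auto intro: A_in_B)
  have "star ?u = ?w"
    by (rule eq_by_entries) (use u w uw assms in \<open>auto simp: entries B_closed\<close>)
  moreover have "?w * ?u = e a" "?u * ?w = e b"
  proof -
    have th: "\<theta> (element (unit_mat N i j) * element (unit_mat N j i)) $$ (k, l)
        = (if k = i \<and> l = i then 1 else 0)"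
      if "i < N" "j < N" "lab i = lab j" "k < N" "l < N" for i j k l
    proof -
      have "\<theta> (element (unit_mat N i j) * element (unit_mat N j i)) $$ (k, l)
        = (unit_mat N i j * unit_mat N j i) $$ (k, l)"
        using that element[OF pat[of i j]] element[OF pat[of j i]]
        by (simp add: star_homD(3)[OF hom] A_in_B del: index_mult_mat)
      then show ?thesis using that by (simp add: unit_mat_mult)
    qed
    show "?w * ?u = e a"
    proof (rule eq_by_entries)
      fix k l assume "k < N" "l < N"
      then show "\<theta> (?w * ?u) $$ (k, l) = \<theta> (e a) $$ (k, l)"
        using th[OF assms, of k l] by (simp add: e_def entry_diag)
    qed (use uw in \<open>auto intro: star_gen_mult e_in_B\<close>)
    show "?u * ?w = e b"
    proof (rule eq_by_entries)
      fix k l assume "k < N" "l < N"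
      then show "\<theta> (?u * ?w) $$ (k, l) = \<theta> (e b) $$ (k, l)"
        using th[OF assms(2,1) assms(3)[symmetric], of k l] by (simp add: e_def entry_diag)
    qed (use uw in \<open>auto intro: star_gen_mult e_in_B\<close>)
  qed
  ultimately show ?thesis using u w assms by (intro that[of ?u]) auto
qed

lemma finite_spanning_set:
  obtains T :: "(nat \<times> nat) set" and \<epsilon> where "finite T" "\<And>t. t \<in> T \<Longrightarrow> \<epsilon> t \<in> A"
    "\<And>x. x \<in> A \<Longrightarrow> \<exists>c. x = (\<Sum>t\<in>T. scaleC (c t) (\<epsilon> t))"
proof -
  define T where "T = {(a, b). a < N \<and> b < N \<and> label_arc n (lab b) (lab a)}"
  define \<epsilon> where "\<epsilon> = (\<lambda>(a, b). element (unit_mat N a b))"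
  have "finite T" by (rule finite_subset[of _ "{..<N} \<times> {..<N}"]) (auto simp: T_def)
  have \<epsilon>: "\<epsilon> (a, b) \<in> A" "\<theta> (\<epsilon> (a, b)) = unit_mat N a b" if "(a, b) \<in> T" for a b
  proof -
    have "unit_mat N a b \<in> pattern_algebra n N lab"
      using that by (auto simp: T_def pattern_algebra_def)
    from element[OF this] show "\<epsilon> (a, b) \<in> A" "\<theta> (\<epsilon> (a, b)) = unit_mat N a b"
      by (simp_all add: \<epsilon>_def)
  qed
  have "x = (\<Sum>t\<in>T. scaleC (\<theta> x $$ t) (\<epsilon> t))" if x: "x \<in> A" for x
  proof (rule eq_by_entries)
    have B: "scaleC (\<theta> x $$ t) (\<epsilon> t) \<in> B" if "t \<in> T" for t
      using that \<epsilon>(1) by (cases t) (auto intro: star_gen_scaleC A_in_B)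
    show "(\<Sum>t\<in>T. scaleC (\<theta> x $$ t) (\<epsilon> t)) \<in> B"
      by (rule star_gen_sum[OF A_nonempty B])
    fix a b assume ab: "a < N" "b < N"
    have "\<theta> (\<Sum>t\<in>T. scaleC (\<theta> x $$ t) (\<epsilon> t)) $$ (a, b)
        = (\<Sum>t\<in>T. \<theta> (scaleC (\<theta> x $$ t) (\<epsilon> t)) $$ (a, b))"
      using B ab by (rule entry_sum)
    also have "\<dots> = (\<Sum>t\<in>T. if t = (a, b) then \<theta> x $$ (a, b) else 0)"
      using ab by (intro sum.cong) (auto simp: entries A_in_B \<epsilon> split: if_splits)
    also have "\<dots> = \<theta> x $$ (a, b)"
      using \<open>finite T\<close> ab x in_A_iff[OF A_in_B[OF x]] by (auto simp: T_def)
    finally show "\<theta> x $$ (a, b) = \<theta> (\<Sum>t\<in>T. scaleC (\<theta> x $$ t) (\<epsilon> t)) $$ (a, b)" by simp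
  qed (rule A_in_B[OF x])
  then show ?thesis using \<open>finite T\<close> \<epsilon>(1) by (intro that[of T \<epsilon>]) auto
qed

end

lemma cycle_algebra_sumE:
  assumes "cycle_algebra_sum n A"
  obtains Gs \<theta> N lab where "cycle_realization n A Gs \<theta> N lab"
proof -
  obtain Gs \<theta> where Gs: "\<forall>G\<in>set Gs. is_cycle_type n G" "digraph_sum_realization A Gs \<theta>"
    using assms unfolding cycle_algebra_sum_def by blast
  obtain N lab where "digraph_algebra_sum Gs = pattern_algebra n N lab" "\<And>a. a < N \<Longrightarrow> snd (lab a) < 2 * n"
    using cycle_digraph_algebra_sum_pattern[OF Gs(1)] by blast
  with Gs(2) show ?thesis by (intro that) (unfold_locales, auto)
qed

section \<open>Minimal projections: labels, equivalence and decompositions\<close>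

context cycle_realization
begin

text \<open>Being self-adjoint, a projection in \<open>A\<close> commutes with every
  \<open>Q \<alpha>\<close>. By minimality \<open>p * Q \<alpha>\<close> is a multiple of
  \<open>p\<close>; it is idempotent, so a nonzero one is \<open>p\<close> itself, and some
  \<open>\<alpha>\<close> gives a nonzero one because the block projections sum to the unit.\<close>

lemma min_projection_label:
  assumes p: "min_projection A p" and pA: "p \<in> A"
  obtains \<alpha> where "\<alpha> \<in> labels" "Q \<alpha> * p = p" "p * Q \<alpha> = p"
proof -
  note pD = min_projectionD[OF p]
  have comm: "Q \<alpha> * p = p * Q \<alpha>" for \<alpha> using pA pD(2) by (intro Q_commute) auto
  have "\<exists>\<alpha>\<in>labels. p * Q \<alpha> \<noteq> 0"
    using sum_mult_Q[OF pD(1)] pD(4) by (metis (no_types, lifting) sum.neutral)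
  then obtain \<alpha> where \<alpha>: "\<alpha> \<in> labels" "p * Q \<alpha> \<noteq> 0" by blast
  obtain c where "p * Q \<alpha> * p = scaleC c p" using pD(5)[OF Q_in_B] by blast
  then have c: "p * Q \<alpha> = scaleC c p" by (simp add: mult.assoc comm) (simp add: mult.assoc[symmetric] pD(3))
  have "p * Q \<alpha> * Q \<alpha> = p * Q \<alpha>" by (simp add: mult.assoc Q_mult_Q)
  then have "scaleC c (p * Q \<alpha>) = scaleC 1 (p * Q \<alpha>)"
    by (simp add: c mult_scaleC_left scaleC_one)
  then have "c = 1" using \<alpha>(2) by (rule scaleC_right_cancel)
  then show ?thesis using \<alpha>(1) c comm by (intro that) (simp_all add: scaleC_one)
qed

lemma in_block_diagonal:
  assumes "x \<in> B" "Q \<alpha> * x = x" "x * Q \<alpha> = x"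
  shows "x \<in> A \<inter> star ` A"
proof -
  have "Q \<alpha> * x * Q \<alpha> = x" using assms by simp
  with Q_block_in_A[OF assms(1), of \<alpha>] have "x \<in> A" "star x \<in> A" by simp_all
  moreover have "x = star (star x)" by (simp add: star_star)
  ultimately show ?thesis by blast
qed

text \<open>Polar decomposition of \<open>p * e a\<close> for some coordinate \<open>a\<close> where
  it is nonzero. The coordinate has label \<alpha> because \<open>p\<close> lies under
  \<open>Q \<alpha>\<close>.\<close>

lemma min_projection_equivalent_e:
  assumes p: "min_projection A p" and Qp: "Q \<alpha> * p = p" "p * Q \<alpha> = p"
  obtains a v where "a < N" "lab a = \<alpha>" "v \<in> B" "star v * v = e a" "v * star v = p"
proof -
  note pD = min_projectionD[OF p]
  have "\<exists>a\<in>{..<N}. p * e a \<noteq> 0"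
    using sum_mult_e[OF pD(1)] pD(4) by (metis (no_types, lifting) sum.neutral)
  then obtain a where a: "a < N" "p * e a \<noteq> 0" by blast
  have "p * e a = p * (Q \<alpha> * e a)" by (simp add: mult.assoc[symmetric] Qp)
  with a have la: "lab a = \<alpha>" by (auto simp: Q_mult_e split: if_splits)
  obtain c :: real where c: "c \<ge> 0" "e a * p * e a = scaleC (complex_of_real c) (e a)"
    "c = 0 \<Longrightarrow> p * e a = 0"
    using e_projection[OF pD(1-3) a(1)] by blast
  then have c0: "c > 0" using a(2) by force
  obtain d where d: "p * e a * p = scaleC d p" using pD(5)[OF e_in_B] by blast
  have "scaleC d (p * e a) = p * e a * p * e a" by (simp add: d mult_scaleC_left)
  also have "\<dots> = p * (e a * p * e a)" by (simp add: mult.assoc)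
  also have "\<dots> = scaleC (complex_of_real c) (p * e a)" by (simp add: c(2) mult_scaleC_right)
  finally have dc: "d = complex_of_real c" using a(2) by (rule scaleC_right_cancel)
  \<comment> \<open>Both corners of \<open>p * e a\<close> carry the same positive scalar
    \<open>c\<close>, so division by its root produces a partial isometry.\<close>
  define s where "s = complex_of_real (1 / sqrt c)"
  have s: "cnj s = s" "s * s * complex_of_real c = 1"
    using c0 by (simp_all add: s_def of_real_mult[symmetric] real_sqrt_mult_self del: of_real_mult)
  define v where "v = scaleC s (p * e a)"
  have sv: "star v = scaleC s (e a * p)"
    by (simp add: v_def star_scaleC star_mult s(1) pD(2) star_e)
  have "star v * v = scaleC (s * s) (e a * (p * p) * e a)"
    unfolding sv by (simp add: v_def mult_scaleC_left mult_scaleC_right scaleC_scaleC mult.assoc)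
  also have "\<dots> = e a" by (simp add: pD(3) c(2) scaleC_scaleC s(2) scaleC_one)
  finally have 1: "star v * v = e a" .
  have "v * star v = scaleC (s * s) (p * (e a * e a) * p)"
    unfolding sv by (simp add: v_def mult_scaleC_left mult_scaleC_right scaleC_scaleC mult.assoc)
  also have "\<dots> = p" by (simp add: e_mult_e d dc scaleC_scaleC s(2) scaleC_one)
  finally have 2: "v * star v = p" .
  have "v \<in> B" unfolding v_def by (intro star_gen_scaleC star_gen_mult pD(1) e_in_B)
  then show ?thesis using a(1) la 1 2 by (intro that) auto
qed

text \<open>Both are equivalent to coordinate projections of the same label, and those are joined by
  a matrix unit of the diagonal block. The chain is composed in \<open>star_gen A\<close> and the
  composite is then placed in the block.\<close>

lemma min_projections_equivalent:
  assumes p: "min_projection A p" "Q \<alpha> * p = p" "p * Q \<alpha> = p"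
    and q: "min_projection A q" "Q \<alpha> * q = q" "q * Q \<alpha> = q"
  shows "equivalent_projections_in (A \<inter> star ` A) p q"
proof -
  obtain a v where a: "a < N" "lab a = \<alpha>" and v: "v \<in> B" "star v * v = e a" "v * star v = p"
    using min_projection_equivalent_e[OF p] by blast
  obtain b w where b: "b < N" "lab b = \<alpha>" and w: "w \<in> B" "star w * w = e b" "w * star w = q"
    using min_projection_equivalent_e[OF q] by blast
  obtain u where u: "u \<in> A" "star u * u = e a" "u * star u = e b"
    using partial_isometry_in_block[of a b] a b by auto
  define x where "x = w * u * star v"
  have sx: "star x = v * star u * star w" by (simp add: x_def star_mult star_star mult.assoc)
  have "star x * x = v * (star u * (star w * w) * u) * star v" unfolding sx by (simp add: x_def mult.assoc)
  also have "star u * (star w * w) * u = star u * u * (star u * u)"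
    unfolding w(2) u(3)[symmetric] by (simp add: mult.assoc)
  also have "v * \<dots> * star v = v * star v * (v * star v)"
    unfolding u(2) e_mult_e by (simp add: v(2)[symmetric] mult.assoc)
  also have "\<dots> = p" by (simp add: v(3) min_projectionD(3)[OF p(1)])
  finally have 1: "star x * x = p" .
  have "x * star x = w * (u * (star v * v) * star u) * star w" unfolding sx by (simp add: x_def mult.assoc)
  also have "u * (star v * v) * star u = u * star u * (u * star u)"
    unfolding v(2) u(2)[symmetric] by (simp add: mult.assoc)
  also have "w * \<dots> * star w = w * star w * (w * star w)"
    unfolding u(3) e_mult_e by (simp add: w(2)[symmetric] mult.assoc)
  also have "\<dots> = q" by (simp add: w(3) min_projectionD(3)[OF q(1)])
  finally have 2: "x * star x = q" .
  have xB: "x \<in> B" unfolding x_def by (intro star_gen_mult star_gen_star v(1) w(1) A_in_B[OF u(1)])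
  \<comment> \<open>Cutting with \<open>q\<close> and \<open>p\<close> changes neither product, and
    makes it evident that the element lies in the block of \<alpha>.\<close>
  define y where "y = q * x * p"
  note pD = min_projectionD[OF p(1)] and qD = min_projectionD[OF q(1)]
  have sy: "star y = p * star x * q" by (simp add: y_def star_mult pD(2) qD(2) mult.assoc)
  have "star y * y = p * star x * (q * q) * x * p" unfolding sy by (simp add: y_def mult.assoc)
  also have "\<dots> = p * (star x * x) * (star x * x) * p"
    unfolding qD(3) by (simp add: 2[symmetric] mult.assoc)
  finally have y1: "star y * y = p" by (simp add: 1 pD(3))
  have "y * star y = q * x * (p * p) * star x * q" unfolding sy by (simp add: y_def mult.assoc)
  also have "\<dots> = q * (x * star x) * (x * star x) * q"
    unfolding pD(3) by (simp add: 1[symmetric] mult.assoc)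
  finally have y2: "y * star y = q" by (simp add: 2 qD(3))
  have "y \<in> A \<inter> star ` A"
  proof (rule in_block_diagonal)
    show "y \<in> B" unfolding y_def by (intro star_gen_mult pD(1) qD(1) xB)
    show "Q \<alpha> * y = y" by (simp add: y_def mult.assoc[symmetric] q(2))
    show "y * Q \<alpha> = y" by (simp add: y_def mult.assoc p(3))
  qed
  with y1 y2 show ?thesis unfolding equivalent_projections_in_def by blast
qed

text \<open>A partial isometry of the diagonal part commutes with \<open>Q \<alpha>\<close>, so it
  carries the label of its initial projection over to its final projection.\<close>

lemma inequivalent_projections:
  assumes "Q \<alpha> * p = p" "q * q = q" "Q \<beta> * q = q" "q * Q \<beta> = q" "\<alpha> \<noteq> \<beta>" "q \<noteq> 0"
  shows "\<not> equivalent_projections_in (A \<inter> star ` A) p q"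
proof
  assume "equivalent_projections_in (A \<inter> star ` A) p q"
  then obtain v where v: "v \<in> A" "star v \<in> A" "star v * v = p" "v * star v = q"
    unfolding equivalent_projections_in_def by (auto simp: star_star)
  have "q = v * (star v * v) * star v"
    using assms(2) by (simp add: v(4)[symmetric] mult.assoc)
  also have "\<dots> = v * Q \<alpha> * p * star v" by (simp add: v(3) assms(1) mult.assoc)
  also have "v * Q \<alpha> = Q \<alpha> * v" using Q_commute[OF v(1,2)] by simp
  finally have q: "q = Q \<alpha> * (v * p * star v)" by (simp add: mult.assoc)
  have "q = Q \<beta> * q" by (simp add: assms(3))
  also have "\<dots> = Q \<beta> * Q \<alpha> * (v * p * star v)" by (subst q) (simp add: mult.assoc)
  also have "\<dots> = 0" using assms(5) by (simp add: Q_mult_Q)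
  finally show False using assms(6) by simp
qed

text \<open>Greedy orthogonalization over the coordinates: if \<open>r * e m\<close> is nonzero, the
  minimal projection onto its range is split off from the remainder \<open>r\<close>. The last
  clause is the progress measure; at \<open>m = N\<close> it forces the remainder to vanish.\<close>

lemma projection_decomposition_aux:
  assumes p: "p \<in> B" "star p = p" "p * p = p" and "m \<le> N"
  shows "\<exists>S r. finite S \<and> (\<forall>g\<in>S. min_projection A g \<and> g * p = g \<and> g * r = 0) \<and>
    (\<forall>g\<in>S. \<forall>h\<in>S. g \<noteq> h \<longrightarrow> g * h = 0) \<and> \<Sum>S + r = p \<and>
    r \<in> B \<and> star r = r \<and> r * r = r \<and> r * p = r \<and> (\<forall>a<m. r * e a = 0)"
    (is "\<exists>S r. ?D m S r")
  using \<open>m \<le> N\<close>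
proof (induction m)
  case 0
  show ?case by (rule exI[of _ "{}"], rule exI[of _ p]) (use p in auto)
next
  case (Suc m)
  obtain S r where D: "?D m S r" using Suc.IH[OF Suc_leD[OF Suc.prems]] by iprover
  then have S: "finite S" "\<And>g. g \<in> S \<Longrightarrow> min_projection A g \<and> g * p = g \<and> g * r = 0"
    "\<And>g h. g \<in> S \<Longrightarrow> h \<in> S \<Longrightarrow> g \<noteq> h \<Longrightarrow> g * h = 0" "\<Sum>S + r = p"
    and r: "r \<in> B" "star r = r" "r * r = r" "r * p = r" "\<And>a. a < m \<Longrightarrow> r * e a = 0"
    by simp_all
  have m: "m < N" using Suc.prems by simp
  obtain c :: real where c: "c \<ge> 0" "e m * r * e m = scaleC (complex_of_real c) (e m)"
    "c = 0 \<Longrightarrow> r * e m = 0"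
    using e_projection[OF r(1-3) m] by blast
  show ?case
  proof (cases "c = 0")
    case True
    show ?thesis
      by (rule exI[of _ S], rule exI[of _ r]) (use S r c(3) True in \<open>auto simp: less_Suc_eq\<close>)
  next
    case False
    \<comment> \<open>The square of \<open>r * e m * r\<close> is \<open>c\<close> times itself, so
      \<open>1 / c\<close> is the factor that makes it idempotent.\<close>
    define d where "d = complex_of_real (1 / c)"
    have d: "d * complex_of_real c = 1" "cnj d = d" "d \<noteq> 0"
      using False by (simp_all add: d_def)
    define g where "g = scaleC d (r * e m * r)"
    have gr: "g * r = g" "r * g = g"
      using r(3) by (simp_all add: g_def mult_scaleC_left mult_scaleC_right mult.assoc)
        (simp_all add: mult.assoc[symmetric])
    have gB: "g \<in> B" unfolding g_def by (intro star_gen_scaleC star_gen_mult r(1) e_in_B)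
    have sg: "star g = g"
      by (simp add: g_def star_scaleC star_mult d(2) r(2) star_e mult.assoc)
    have ere: "e m * (r * e m) = scaleC (complex_of_real c) (e m)"
      using c(2) by (simp add: mult.assoc)
    have ge: "g * e m = r * e m"
      by (simp add: g_def mult_scaleC_left mult.assoc ere mult_scaleC_right scaleC_scaleC d scaleC_one)
    have gxg: "\<exists>k. g * x * g = scaleC k g" if x: "x \<in> B" for x
    proof -
      obtain k where k: "e m * (r * x * r) * e m = scaleC k (e m)"
        using e_sandwich[OF _ m] x r(1) by (blast intro: star_gen_mult)
      have "g * x * g = scaleC (d * d) (r * (e m * (r * x * r) * e m) * r)"
        by (simp add: g_def mult_scaleC_left mult_scaleC_right scaleC_scaleC mult.assoc)
      also have "\<dots> = scaleC (d * k) g"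
        unfolding k by (simp add: g_def mult_scaleC_left mult_scaleC_right scaleC_scaleC mult.assoc)
          (simp add: mult.left_commute mult.commute)
      finally show ?thesis by blast
    qed
    have gg: "g * g = g"
    proof -
      have "g * g = scaleC d (g * e m * r)"
        by (subst (2) g_def) (simp add: mult_scaleC_right gr(1) mult.assoc[symmetric])
      then show ?thesis unfolding ge by (simp add: g_def)
    qed
    have g0: "g \<noteq> 0"
    proof
      assume "g = 0"
      then have "r * e m = 0" using ge by simp
      then have "scaleC (complex_of_real c) (e m) = 0" using ere by simp
      then show False using False e_nonzero[OF m] by (simp add: scaleC_eq_0_iff)
    qed
    have gp: "g * p = g" using gr(1) r(4) by (metis mult.assoc)
    have hg: "h * g = 0" "g * h = 0" if "h \<in> S" for h
    proof -
      have "h * g = h * r * g" by (simp add: mult.assoc gr)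
      then show hg: "h * g = 0" using S(2)[OF that] by simp
      have "g * h = star (h * g)"
        using min_projectionD(2)[of A h] S(2)[OF that] sg by (simp add: star_mult)
      then show "g * h = 0" using hg by simp
    qed
    have gS: "g \<notin> S" using hg(1)[of g] gg g0 by auto
    define r' where "r' = r - g"
    have r': "r' \<in> B" "star r' = r'" "r' * r' = r'" "r' * p = r'" "g * r' = 0"
      using gB r gg gr gp by (simp_all add: r'_def star_gen_minus star_minus sg algebra_simps)
    have re: "r' * e a = 0" if "a < Suc m" for a
    proof (cases "a = m")
      case True
      then show ?thesis by (simp add: r'_def left_diff_distrib ge)
    next
      case False
      then have "r * e a = 0" using that r(5) by simp
      moreover have "g * e a = g * (r * e a)" using gr(1) by (simp add: mult.assoc[symmetric])
      ultimately show ?thesis by (simp add: r'_def left_diff_distrib)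
    qed
    have hr: "h * r' = 0" if "h \<in> S" for h
      using S(2)[OF that] hg(1)[OF that] by (simp add: r'_def right_diff_distrib)
    have "\<Sum>(insert g S) + r' = p" using S(1,4) gS by (simp add: r'_def add.commute)
    moreover have "min_projection A g"
      unfolding min_projection_def using gB sg gg g0 gxg by blast
    ultimately show ?thesis
      by (intro exI[of _ "insert g S"] exI[of _ r']) (use S r' re hr gp hg in auto)
  qed
qed

lemma projection_decomposition:
  assumes p: "p \<in> B" "star p = p" "p * p = p"
  obtains S where "finite S" "\<And>g. g \<in> S \<Longrightarrow> min_projection A g" "\<And>g. g \<in> S \<Longrightarrow> g * p = g"
    "\<And>g h. g \<in> S \<Longrightarrow> h \<in> S \<Longrightarrow> g \<noteq> h \<Longrightarrow> g * h = 0" "\<Sum>S = p"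
proof -
  obtain S r where D: "finite S \<and> (\<forall>g\<in>S. min_projection A g \<and> g * p = g \<and> g * r = 0) \<and>
    (\<forall>g\<in>S. \<forall>h\<in>S. g \<noteq> h \<longrightarrow> g * h = 0) \<and> \<Sum>S + r = p \<and>
    r \<in> B \<and> star r = r \<and> r * r = r \<and> r * p = r \<and> (\<forall>a<N. r * e a = 0)"
    using projection_decomposition_aux[OF p order_refl] by iprover
  then have S: "finite S" "\<And>g. g \<in> S \<Longrightarrow> min_projection A g \<and> g * p = g"
    "\<And>g h. g \<in> S \<Longrightarrow> h \<in> S \<Longrightarrow> g \<noteq> h \<Longrightarrow> g * h = 0" "\<Sum>S + r = p"
    and r: "r \<in> B" "\<And>a. a < N \<Longrightarrow> r * e a = 0"
    by simp_all
  have "r = 0" using sum_mult_e[OF r(1)] r(2) by simp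
  then show ?thesis using S by (intro that[of S]) auto
qed

end

section \<open>Walks on the cycle\<close>

text \<open>Orientation is dropped here; in \<open>block_arc\<close> the parity of the position in
  the walk restores it.\<close>

definition adjacent :: "nat \<Rightarrow> nat \<times> nat \<Rightarrow> nat \<times> nat \<Rightarrow> bool" where
  "adjacent n \<alpha> \<beta> \<longleftrightarrow> fst \<alpha> = fst \<beta> \<and> snd \<alpha> < 2 * n \<and> snd \<beta> < 2 * n \<and>
     (snd \<beta> = Suc (snd \<alpha>) mod (2 * n) \<or> snd \<alpha> = Suc (snd \<beta>) mod (2 * n))"

lemma adjacent_sym: "adjacent n \<alpha> \<beta> \<Longrightarrow> adjacent n \<beta> \<alpha>"
  by (auto simp: adjacent_def)

lemma label_arc_adjacent: "label_arc n \<alpha> \<beta> \<Longrightarrow> \<alpha> \<noteq> \<beta> \<Longrightarrow> adjacent n \<alpha> \<beta>"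
  unfolding label_arc_def adjacent_def parcs_cycle_digraph_iff by (metis prod_eqI)

lemma adjacent_cases:
  assumes "adjacent n \<alpha> \<beta>"
  shows "snd \<alpha> = (if Suc (snd \<beta>) = 2 * n then 0 else Suc (snd \<beta>)) \<or>
    snd \<alpha> = (if snd \<beta> = 0 then 2 * n - 1 else snd \<beta> - 1)"
  using assms unfolding adjacent_def
proof (elim conjE disjE)
  assume "snd \<alpha> < 2 * n" "snd \<beta> = Suc (snd \<alpha>) mod (2 * n)"
  then show ?thesis by (cases "Suc (snd \<alpha>) = 2 * n"; simp add: mod_Suc; arith)
next
  assume "snd \<beta> < 2 * n" "snd \<alpha> = Suc (snd \<beta>) mod (2 * n)"
  then show ?thesis by (simp add: mod_Suc)
qed

text \<open>Two distinct common neighbours of two distinct vertices would close a cycle of length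
  four inside a cycle of length 2n, which is at least six.\<close>

lemma common_neighbour_unique:
  assumes "n \<ge> 3" "adjacent n \<alpha> \<beta>" "adjacent n \<alpha>' \<beta>" "adjacent n \<alpha> \<beta>'" "adjacent n \<alpha>' \<beta>'" "\<alpha> \<noteq> \<alpha>'"
  shows "\<beta> = \<beta>'"
proof -
  define up where "up x = (if Suc x = 2 * n then 0 else Suc x)" for x
  define dn where "dn x = (if x = 0 then 2 * n - 1 else x - 1)" for x :: nat
  have up: "up x = up y \<Longrightarrow> x = y" if "x < 2 * n" "y < 2 * n" for x y
    using that by (simp add: up_def split: if_splits)
  have dn: "dn x = dn y \<Longrightarrow> x = y" if "x < 2 * n" "y < 2 * n" for x y
    using that by (simp add: dn_def split: if_splits)
  \<comment> \<open>Here \<open>y\<close> would be two steps after \<open>x\<close> and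
    \<open>x\<close> two steps after \<open>y\<close>, so 2n would divide 4.\<close>
  have ud: "\<not> (up x = dn y \<and> up y = dn x)" if "x < 2 * n" "y < 2 * n" for x y
    using that assms(1) unfolding up_def dn_def by (simp split: if_split) linarith
  have less: "snd \<beta> < 2 * n" "snd \<beta>' < 2 * n" and fst: "fst \<beta> = fst \<beta>'" "fst \<alpha> = fst \<alpha>'"
    using assms(2-5) by (auto simp: adjacent_def)
  have "snd \<alpha> \<noteq> snd \<alpha>'" using assms(6) fst(2) by (auto simp: prod_eq_iff)
  moreover have "snd \<alpha> = up (snd \<beta>) \<or> snd \<alpha> = dn (snd \<beta>)" "snd \<alpha>' = up (snd \<beta>) \<or> snd \<alpha>' = dn (snd \<beta>)"
    "snd \<alpha> = up (snd \<beta>') \<or> snd \<alpha> = dn (snd \<beta>')" "snd \<alpha>' = up (snd \<beta>') \<or> snd \<alpha>' = dn (snd \<beta>')"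
    unfolding up_def dn_def by (fact assms(2-5)[THEN adjacent_cases])+
  ultimately have "snd \<beta> = snd \<beta>'" using up[OF less] dn[OF less] ud[OF less] by metis
  then show ?thesis using fst(1) by (simp add: prod_eq_iff)
qed

lemma neighbour_unique:
  assumes "adjacent n \<alpha> \<beta>" "adjacent n \<gamma> \<beta>" "adjacent n \<gamma>' \<beta>" "\<gamma> \<noteq> \<alpha>" "\<gamma>' \<noteq> \<alpha>"
  shows "\<gamma> = \<gamma>'"
proof -
  have fst: "fst \<alpha> = fst \<beta>" "fst \<gamma> = fst \<beta>" "fst \<gamma>' = fst \<beta>"
    using assms(1-3) by (auto simp: adjacent_def)
  then have "snd \<gamma> \<noteq> snd \<alpha>" "snd \<gamma>' \<noteq> snd \<alpha>" using assms(4,5) by (auto simp: prod_eq_iff)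
  then have "snd \<gamma> = snd \<gamma>'"
    using adjacent_cases[OF assms(1)] adjacent_cases[OF assms(2)] adjacent_cases[OF assms(3)] by metis
  then show ?thesis using fst by (simp add: prod_eq_iff)
qed

text \<open>A walk on the cycle that never turns back goes round it at unit speed.\<close>

lemma nonbacktracking_walk_inj:
  assumes adj: "\<And>j. Suc j < 2 * n \<Longrightarrow> adjacent n (f j) (f (Suc j))"
    and nb: "\<And>j. Suc (Suc j) < 2 * n \<Longrightarrow> f (Suc (Suc j)) \<noteq> f j"
  shows "inj_on f {..<2 * n}"
proof (cases "n = 0")
  case False
  define m where "m = int (2 * n)"
  define g where "g j = int (snd (f j))" for j
  have gm: "g j mod m = g j" if "j < 2 * n" for j
  proof -
    have "snd (f j) < 2 * n"
      using adj[of j] adj[of "j - 1"] that False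
      by (cases "Suc j < 2 * n"; cases j) (auto simp: adjacent_def)
    then show ?thesis by (simp add: g_def m_def del: of_nat_mult)
  qed
  have step: "g (Suc j) = (g j + 1) mod m \<or> g (Suc j) = (g j - 1) mod m" if j: "Suc j < 2 * n" for j
    using adj[OF j] unfolding adjacent_def
  proof (elim conjE disjE)
    assume "snd (f (Suc j)) = Suc (snd (f j)) mod (2 * n)"
    then show ?thesis by (simp add: g_def m_def zmod_int add.commute)
  next
    assume "snd (f j) = Suc (snd (f (Suc j))) mod (2 * n)"
    then have "g j = (g (Suc j) + 1) mod m" by (simp add: g_def m_def zmod_int add.commute)
    then have "(g j - 1) mod m = g (Suc j) mod m" by (simp add: mod_simps)
    then show ?thesis using gm[OF j] by simp
  qed
  have fst: "fst (f (Suc j)) = fst (f j)" if "Suc j < 2 * n" for j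
    using adj[OF that] by (simp add: adjacent_def)
  have "1 < 2 * n" using False by simp
  then have "g 1 = (g 0 + 1) mod m \<or> g 1 = (g 0 + (- 1)) mod m" using step[of 0] by simp
  \<comment> \<open>The first step fixes the direction \<open>d\<close>; a later change of sign
    would return to the vertex before.\<close>
  then obtain d where d: "d = 1 \<or> d = - 1" "g 1 = (g 0 + d) mod m" by blast
  have walk: "g j = (g 0 + d * int j) mod m \<and> g (Suc j) = (g 0 + d * int (Suc j)) mod m"
    if "Suc j < 2 * n" for j
    using that
  proof (induction j)
    case 0
    then show ?case using d(2) gm[of 0] by simp
  next
    case (Suc j)
    then have IH: "g j = (g 0 + d * int j) mod m" "g (Suc j) = (g 0 + d * int (Suc j)) mod m" by auto
    have "g (Suc (Suc j)) = (g (Suc j) + d) mod m \<or> g (Suc (Suc j)) = (g (Suc j) - d) mod m"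
      using step[OF Suc.prems] d(1) by auto
    moreover have "g (Suc (Suc j)) \<noteq> (g (Suc j) - d) mod m"
    proof
      assume "g (Suc (Suc j)) = (g (Suc j) - d) mod m"
      also have "\<dots> = (g 0 + d * int (Suc j) - d) mod m" unfolding IH(2) by (simp add: mod_simps)
      also have "\<dots> = g j" unfolding IH(1) by (simp add: algebra_simps)
      finally have "snd (f (Suc (Suc j))) = snd (f j)" by (simp add: g_def)
      moreover have "fst (f (Suc (Suc j))) = fst (f j)" using fst[of j] fst[of "Suc j"] Suc.prems by simp
      ultimately show False using nb[OF Suc.prems] by (simp add: prod_eq_iff)
    qed
    ultimately have "g (Suc (Suc j)) = (g (Suc j) + d) mod m" by blast
    also have "\<dots> = (g 0 + d * int (Suc j) + d) mod m" unfolding IH(2) by (simp add: mod_simps)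
    also have "\<dots> = (g 0 + d * int (Suc (Suc j))) mod m" by (simp add: algebra_simps)
    finally show ?case using IH(2) by simp
  qed
  have g: "g j = (g 0 + d * int j) mod m" if "j < 2 * n" for j
  proof (cases j)
    case 0
    then show ?thesis using gm[of 0] that by simp
  next
    case (Suc k)
    then show ?thesis using walk[of k] that by blast
  qed
  show ?thesis
  proof (rule inj_onI)
    fix i j assume ij: "i \<in> {..<2 * n}" "j \<in> {..<2 * n}" "f i = f j"
    then have "(g 0 + d * int i) mod m = (g 0 + d * int j) mod m"
      using g[of i] g[of j] by (simp add: g_def)
    then have "m dvd d * (int i - int j)"
      by (simp add: mod_eq_dvd_iff algebra_simps)
    \<comment> \<open>A second factor \<open>d\<close> cancels the first, as its square is
      1.\<close>
    then have "m dvd d * (d * (int i - int j))" by (rule dvd_mult)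
    then have dvd: "m dvd int i - int j" using d(1) by auto
    have less: "\<bar>int i - int j\<bar> < \<bar>m\<bar>" using ij by (auto simp: m_def)
    have "int i - int j = 0"
    proof (rule ccontr)
      assume "int i - int j \<noteq> 0"
      from dvd_imp_le_int[OF this dvd] less show False by simp
    qed
    then show "i = j" by simp
  qed
qed simp

text \<open>Arbitrary finite index sets serve the two constructions of summands below, which are
  indexed by minimal projections and by pairs of indices.\<close>

lemma rigid_cycle_embeddingI:
  assumes emb: "star_ext_embedding (cycle_alg n) A \<rho>" and fin: "finite S"
    and proper: "\<And>s. s \<in> S \<Longrightarrow> proper_embedding n A (\<eta> s)"
    and orth: "\<And>s t x y. s \<in> S \<Longrightarrow> t \<in> S \<Longrightarrow> s \<noteq> t \<Longrightarrow> x \<in> cycle_alg n \<Longrightarrow> y \<in> cycle_alg n \<Longrightarrow> \<eta> s x * \<eta> t y = 0"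
    and sum: "\<And>x. x \<in> cycle_alg n \<Longrightarrow> \<rho> x = (\<Sum>s\<in>S. \<eta> s x)"
  shows "rigid_cycle_embedding n A \<rho>"
proof -
  obtain h where h: "bij_betw h {..<card S} S"
    using ex_bij_betw_nat_finite[OF fin] by (auto simp: lessThan_atLeast0)
  have hS: "h s \<in> S" if "s < card S" for s using h that by (auto simp: bij_betw_def)
  have hinj: "h s \<noteq> h t" if "s < card S" "t < card S" "s \<noteq> t" for s t
    using h that by (auto simp: bij_betw_def inj_on_def)
  have "\<rho> x = (\<Sum>s<card S. \<eta> (h s) x)" if "x \<in> cycle_alg n" for x
    unfolding sum[OF that] by (rule sum.reindex_bij_betw[OF h, symmetric])
  then show ?thesis
    unfolding rigid_cycle_embedding_def
    using emb proper[OF hS] orth[OF hS hS hinj]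
    by (intro conjI exI[of _ "card S"] exI[of _ "\<eta> \<circ> h"]) auto
qed

section \<open>The cyclic successor and the arcs of the cycle digraph\<close>

definition nxt :: "nat \<Rightarrow> nat \<Rightarrow> nat" where "nxt n j = Suc j mod (2 * n)"

lemma nxt_less: "n \<ge> 1 \<Longrightarrow> nxt n j < 2 * n"
  by (simp add: nxt_def)

lemma nxt_Suc: "Suc j < 2 * n \<Longrightarrow> nxt n j = Suc j"
  by (simp add: nxt_def)

lemma even_nxt: "j < 2 * n \<Longrightarrow> even (nxt n j) \<longleftrightarrow> odd j"
  unfolding nxt_def by (cases "Suc j = 2 * n") (simp_all, presburger)

lemma nxt_arc:
  assumes "j < 2 * n"
  shows "even j \<Longrightarrow> (nxt n j, j) \<in> parcs (cycle_digraph n)"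
    and "odd j \<Longrightarrow> (j, nxt n j) \<in> parcs (cycle_digraph n)"
proof -
  have "nxt n j < 2 * n" using assms by (intro nxt_less) auto
  with assms even_nxt[OF assms]
  show "even j \<Longrightarrow> (nxt n j, j) \<in> parcs (cycle_digraph n)"
    "odd j \<Longrightarrow> (j, nxt n j) \<in> parcs (cycle_digraph n)"
    by (auto simp: parcs_cycle_digraph_iff nxt_def)
qed

lemma parcs_cycle_digraph_cases:
  assumes "(j, i) \<in> parcs (cycle_digraph n)"
  obtains "i = j" "i < 2 * n" | "even i" "j = nxt n i" "i < 2 * n" | "odd j" "i = nxt n j" "j < 2 * n"
  using assms unfolding parcs_cycle_digraph_iff nxt_def by blast

lemma nxt_nxt_neq: "n \<ge> 2 \<Longrightarrow> j < 2 * n \<Longrightarrow> nxt n (nxt n j) \<noteq> j"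
  unfolding nxt_def by (simp add: mod_Suc)

section \<open>Characterization of rigid embeddings\<close>

locale cycle_representation = cycle_realization +
  fixes v :: "nat \<Rightarrow> nat \<Rightarrow> 'a"
  assumes n3: "n \<ge> 3" and units: "cycle_units n A v"
begin

abbreviation s :: "nat \<Rightarrow> nat" where "s j \<equiv> nxt n j"

lemma s_less [simp]: "s j < 2 * n"
  using n3 by (intro nxt_less) simp

lemma n_pos [simp]: "0 < n"
  using n3 by simp

lemmas v_in_B = cycle_unitsD(2)[OF units]
lemmas star_v = cycle_unitsD(3)[OF units]
lemmas v_mult = cycle_unitsD(4)[OF units]
lemmas v_in_A = cycle_unitsD(5)[OF units]

lemma v_mult_assoc:
  "i < 2 * n \<Longrightarrow> j < 2 * n \<Longrightarrow> k < 2 * n \<Longrightarrow> l < 2 * n \<Longrightarrow>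
    v i j * (v k l * x) = (if j = k then v i l * x else 0)"
  by (simp add: mult.assoc[symmetric] v_mult)

lemma Q_commute_v:
  assumes "j < 2 * n" shows "Q \<alpha> * v j j = v j j * Q \<alpha>"
proof -
  have "v j j \<in> A" using assms by (intro v_in_A) (auto simp: parcs_cycle_digraph_iff)
  then show ?thesis using assms by (intro Q_commute) (auto simp: star_v)
qed

text \<open>The two conditions of the overview, freed from the outer units \<open>v 0 j\<close> and
  \<open>v j 0\<close>; \<open>E_mult_E\<close> and \<open>E_mult_E_mult_E\<close> translate between
  the forms. The elements required to vanish here are visibly compressions to a diagonal
  block.\<close>

definition loop_free :: bool where
  "loop_free \<longleftrightarrow> (\<forall>j<2 * n. \<forall>\<alpha>. Q \<alpha> * v j (s j) * Q \<alpha> = 0)"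

definition backtrack_free :: bool where
  "backtrack_free \<longleftrightarrow>
     (\<forall>j<2 * n. \<forall>\<alpha> \<beta>. Q \<alpha> * v j (s j) * Q \<beta> * v (s j) (s (s j)) * Q \<alpha> = 0)"

text \<open>For even \<open>j\<close> the unit \<open>v j (s j)\<close> itself belongs to
  \<open>A\<close>. For odd \<open>j\<close> it is the adjoint that does, which reverses the arc
  between the labels.\<close>

lemma block_arc:
  assumes "j < 2 * n" "Q \<alpha> * v j (s j) * Q \<beta> \<noteq> 0"
  shows "even j \<Longrightarrow> label_arc n \<beta> \<alpha>" and "odd j \<Longrightarrow> label_arc n \<alpha> \<beta>"
proof -
  show "label_arc n \<beta> \<alpha>" if "even j"
    using assms Q_mult_A_mult_Q[OF v_in_A[OF _ _ nxt_arc(1)]] that by (metis s_less)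
  show "label_arc n \<alpha> \<beta>" if "odd j"
  proof (rule ccontr)
    assume "\<not> label_arc n \<alpha> \<beta>"
    then have "Q \<beta> * v (s j) j * Q \<alpha> = 0"
      using assms that by (intro Q_mult_A_mult_Q v_in_A nxt_arc) auto
    then have "star (Q \<beta> * v (s j) j * Q \<alpha>) = 0" by simp
    then show False using assms by (simp add: star_mult star_Q star_v mult.assoc)
  qed
qed

lemma block_adjacent:
  assumes "loop_free" "j < 2 * n" "Q \<alpha> * v j (s j) * Q \<beta> \<noteq> 0"
  shows "adjacent n \<alpha> \<beta>"
proof -
  have "\<alpha> \<noteq> \<beta>" using assms(2,3) assms(1)[unfolded loop_free_def] by blast
  then show ?thesis
    using block_arc[OF assms(2,3)] by (metis label_arc_adjacent adjacent_sym)
qed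

lemma block_adjacent_star:
  assumes "loop_free" "j < 2 * n" "Q \<beta> * v (s j) j * Q \<alpha> \<noteq> 0"
  shows "adjacent n \<alpha> \<beta>"
proof (rule block_adjacent[OF assms(1,2)])
  show "Q \<alpha> * v j (s j) * Q \<beta> \<noteq> 0"
  proof
    assume "Q \<alpha> * v j (s j) * Q \<beta> = 0"
    then have "star (Q \<alpha> * v j (s j) * Q \<beta>) = 0" by simp
    then show False using assms by (simp add: star_mult star_Q star_v mult.assoc)
  qed
qed

text \<open>This fails for \<open>n = 2\<close>, where two vertices of \<open>D\<^sub>4\<close> have two common neighbours.\<close>

lemma block_projections_commute:
  assumes lf: "loop_free" and j: "j < 2 * n" and ne: "\<alpha> \<noteq> \<alpha>'"
  shows "Q \<alpha> * v j (s j) * Q \<beta> * v (s j) j * Q \<alpha>' = 0" (is "?T \<beta> = 0")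
proof (rule ccontr)
  assume nz: "?T \<beta> \<noteq> 0"
  have adj: "adjacent n \<alpha> \<gamma>" "adjacent n \<alpha>' \<gamma>" if "?T \<gamma> \<noteq> 0" for \<gamma>
  proof -
    have "Q \<alpha> * v j (s j) * Q \<gamma> \<noteq> 0" using that by auto
    then show "adjacent n \<alpha> \<gamma>" using block_adjacent[OF lf j] by blast
    have "Q \<gamma> * v (s j) j * Q \<alpha>' \<noteq> 0" using that by (auto simp: mult.assoc)
    then show "adjacent n \<alpha>' \<gamma>" using block_adjacent_star[OF lf j] by blast
  qed
  have "\<beta> \<in> labels"
  proof (rule ccontr)
    assume "\<beta> \<notin> labels"
    then have "Q \<beta> = 0" unfolding Q_def by (intro diag_eq_zero) (auto simp: labels_def)
    with nz show False by simp
  qed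
  \<comment> \<open>Summing over the middle label removes the middle projection and leaves a product
    of two different block projections, hence 0. At most one term can be nonzero, since its label is
    a common neighbour of \<alpha> and \<open>\<alpha>'\<close>; so that term vanishes too.\<close>
  have "(\<Sum>\<gamma>\<in>labels. ?T \<gamma>) = Q \<alpha> * v j (s j) * (\<Sum>\<gamma>\<in>labels. Q \<gamma> * (v (s j) j * Q \<alpha>'))"
    by (simp add: sum_distrib_left mult.assoc)
  also have "\<dots> = Q \<alpha> * v j (s j) * (v (s j) j * Q \<alpha>')"
    by (subst sum_Q_mult) (intro star_gen_mult v_in_B Q_in_B s_less j refl)+
  also have "\<dots> = Q \<alpha> * v j j * Q \<alpha>'" using j by (simp add: mult.assoc v_mult_assoc)
  also have "\<dots> = v j j * (Q \<alpha> * Q \<alpha>')" by (simp add: Q_commute_v[OF j] mult.assoc)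
  also have "\<dots> = 0" using ne by (simp add: Q_mult_Q)
  finally have "(\<Sum>\<gamma>\<in>labels. ?T \<gamma>) = 0" .
  moreover have "(\<Sum>\<gamma>\<in>labels. ?T \<gamma>) = (\<Sum>\<gamma>\<in>labels. if \<gamma> = \<beta> then ?T \<beta> else 0)"
  proof (rule sum.cong[OF refl])
    fix \<gamma>
    have "?T \<gamma> = 0" if "\<gamma> \<noteq> \<beta>"
      using adj[OF nz] adj[of \<gamma>] common_neighbour_unique[OF n3, of \<alpha> \<beta> \<alpha>' \<gamma>] ne that by blast
    then show "?T \<gamma> = (if \<gamma> = \<beta> then ?T \<beta> else 0)" by auto
  qed
  ultimately show False using nz \<open>\<beta> \<in> labels\<close> by simp
qed

end

section \<open>Rigid embeddings have neither loops nor backtracks\<close>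

lemma unit_comb_sum:
  assumes "\<And>i j. i < 2 * n \<Longrightarrow> j < 2 * n \<Longrightarrow> v i j = (\<Sum>g\<in>S. w g i j)"
  shows "unit_comb n v x = (\<Sum>g\<in>S. unit_comb n (w g) x)"
proof -
  have "unit_comb n v x = (\<Sum>i<2 * n. \<Sum>j<2 * n. \<Sum>g\<in>S. scaleC (x $$ (i, j)) (w g i j))"
    unfolding unit_comb_def using assms by (intro sum.cong refl) (simp add: scaleC_sum)
  also have "\<dots> = (\<Sum>i<2 * n. \<Sum>g\<in>S. \<Sum>j<2 * n. scaleC (x $$ (i, j)) (w g i j))"
    by (rule sum.cong[OF refl], rule sum.swap)
  also have "\<dots> = (\<Sum>g\<in>S. unit_comb n (w g) x)"
    unfolding unit_comb_def by (rule sum.swap)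
  finally show ?thesis .
qed

lemma unit_comb_orthogonal:
  assumes "\<And>i j k l. i < 2 * n \<Longrightarrow> j < 2 * n \<Longrightarrow> k < 2 * n \<Longrightarrow> l < 2 * n \<Longrightarrow> v i j * w k l = 0"
  shows "unit_comb n v x * unit_comb n w y = 0"
  unfolding unit_comb_def sum_product using assms
  by (simp add: mult_scaleC_left mult_scaleC_right)

context cycle_realization
begin

text \<open>Each \<open>w j j\<close> is a minimal projection in \<open>A\<close> and so sits under
  a single label \<open>f j\<close>. Two of them under one label would be equivalent in the diagonal
  part, which properness excludes.\<close>

lemma proper_embedding_units:
  assumes n: "n \<ge> 1" and proper: "proper_embedding n A \<eta>"
  obtains w f where "cycle_units n A w" "\<And>x. x \<in> cycle_alg n \<Longrightarrow> \<eta> x = unit_comb n w x"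
    "inj_on f {..<2 * n}" "\<And>j. j < 2 * n \<Longrightarrow> Q (f j) * w j j = w j j"
    "\<And>j. j < 2 * n \<Longrightarrow> w j j * Q (f j) = w j j"
proof -
  have emb: "star_ext_embedding (cycle_alg n) A \<eta>"
    and rank: "\<And>j. j < 2 * n \<Longrightarrow> has_rank_in A (\<eta> (cycle_proj n j)) 1"
    and ineq: "\<And>i j. i < 2 * n \<Longrightarrow> j < 2 * n \<Longrightarrow> i \<noteq> j \<Longrightarrow>
      \<not> equivalent_projections_in (A \<inter> star ` A) (\<eta> (cycle_proj n i)) (\<eta> (cycle_proj n j))"
    using proper by (auto simp: proper_embedding_def multiplicity_one_def)
  obtain w where w: "cycle_units n A w" "\<And>x. x \<in> cycle_alg n \<Longrightarrow> \<eta> x = unit_comb n w x"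
    using cycle_units_of_embedding[OF n emb] by blast
  have arc: "(j, j) \<in> parcs (cycle_digraph n)" if "j < 2 * n" for j
    using that by (simp add: parcs_cycle_digraph_iff)
  have \<eta>: "\<eta> (cycle_proj n j) = w j j" if "j < 2 * n" for j
    using that w(2) unit_mat_in_cycle_alg[OF arc] by (simp add: cycle_proj_eq_unit_mat unit_comb_unit_mat)
  have min: "min_projection A (w j j)" and wA: "w j j \<in> A" if "j < 2 * n" for j
  proof -
    note D = cycle_unitsD[OF w(1) that that]
    show "min_projection A (w j j)"
      using rank[OF that] that D(3) D(4)[OF that that]
      by (intro min_projection_of_rank_one D(2)) (simp_all add: \<eta>)
    show "w j j \<in> A" by (rule D(5)[OF arc[OF that]])
  qed
  have "\<exists>\<alpha>. Q \<alpha> * w j j = w j j \<and> w j j * Q \<alpha> = w j j" if "j < 2 * n" for j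
    using min_projection_label[OF min[OF that] wA[OF that]] by blast
  then obtain f where f: "\<And>j. j < 2 * n \<Longrightarrow> Q (f j) * w j j = w j j"
    "\<And>j. j < 2 * n \<Longrightarrow> w j j * Q (f j) = w j j" by metis
  have "inj_on f {..<2 * n}"
  proof (rule inj_onI, rule ccontr)
    fix i j assume ij: "i \<in> {..<2 * n}" "j \<in> {..<2 * n}" "f i = f j" "i \<noteq> j"
    then have "equivalent_projections_in (A \<inter> star ` A) (w i i) (w j j)"
      using f[of i] f[of j] by (intro min_projections_equivalent[of _ "f j"] min) auto
    then show False using ineq[of i j] ij \<eta> by simp
  qed
  then show ?thesis using w f by (intro that) auto
qed

end

context cycle_representation
begin

lemma backtrack_freeD:
  "backtrack_free \<Longrightarrow> j < 2 * n \<Longrightarrow>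
    Q \<alpha> * v j (s j) * Q \<beta> * v (s j) (s (s j)) * Q \<alpha> = 0"
  unfolding backtrack_free_def by blast

text \<open>Each proper summand visits every label at most once, so a loop or a backtrack within one
  summand would repeat a label. Terms that mix two summands vanish by orthogonality.\<close>

lemma free_of_rigid:
  assumes rigid: "rigid_cycle_embedding n A \<rho>"
    and \<rho>: "\<And>x. x \<in> cycle_alg n \<Longrightarrow> \<rho> x = unit_comb n v x"
  shows "loop_free \<and> backtrack_free"
proof -
  have n1: "n \<ge> 1" using n3 by simp
  obtain r :: nat and \<eta> where R: "(\<forall>t<r. proper_embedding n A (\<eta> t)) \<and>
    (\<forall>t<r. \<forall>u<r. t \<noteq> u \<longrightarrow> (\<forall>x\<in>cycle_alg n. \<forall>y\<in>cycle_alg n. \<eta> t x * \<eta> u y = 0)) \<and>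
    (\<forall>x\<in>cycle_alg n. \<rho> x = (\<Sum>t<r. \<eta> t x))"
    using rigid unfolding rigid_cycle_embedding_def by iprover
  then have proper: "\<And>t. t < r \<Longrightarrow> proper_embedding n A (\<eta> t)"
    and orth: "\<And>t u x y. t < r \<Longrightarrow> u < r \<Longrightarrow> t \<noteq> u \<Longrightarrow> x \<in> cycle_alg n \<Longrightarrow> y \<in> cycle_alg n \<Longrightarrow> \<eta> t x * \<eta> u y = 0"
    and sum: "\<And>x. x \<in> cycle_alg n \<Longrightarrow> \<rho> x = (\<Sum>t<r. \<eta> t x)"
    by simp_all
  define P where "P t w f \<longleftrightarrow> cycle_units n A w \<and> (\<forall>x\<in>cycle_alg n. \<eta> t x = unit_comb n w x) \<and>
     inj_on f {..<2 * n} \<and> (\<forall>j<2 * n. Q (f j) * w j j = w j j \<and> w j j * Q (f j) = w j j)" for t w f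
  have "\<exists>w f. P t w f" if "t < r" for t
    by (rule proper_embedding_units[OF n1 proper[OF that]]) (unfold P_def, blast)
  then have "\<forall>t. \<exists>w. t < r \<longrightarrow> (\<exists>f. P t w f)" by blast
  from choice[OF this] obtain w where "\<forall>t. t < r \<longrightarrow> (\<exists>f. P t (w t) f)" by blast
  then have "\<forall>t. \<exists>f. t < r \<longrightarrow> P t (w t) f" by blast
  from choice[OF this] obtain f where P: "\<forall>t. t < r \<longrightarrow> P t (w t) (f t)" by blast
  then have w: "\<And>t. t < r \<Longrightarrow> cycle_units n A (w t)"
    and \<eta>: "\<And>t x. t < r \<Longrightarrow> x \<in> cycle_alg n \<Longrightarrow> \<eta> t x = unit_comb n (w t) x"
    and inj: "\<And>t. t < r \<Longrightarrow> inj_on (f t) {..<2 * n}"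
    and f: "\<And>t j. t < r \<Longrightarrow> j < 2 * n \<Longrightarrow> Q (f t j) * w t j j = w t j j"
      "\<And>t j. t < r \<Longrightarrow> j < 2 * n \<Longrightarrow> w t j j * Q (f t j) = w t j j"
    unfolding P_def by simp_all
  have fneq: "f t i \<noteq> f t j" if "t < r" "i < 2 * n" "j < 2 * n" "i \<noteq> j" for t i j
    using inj[OF that(1)] that by (auto dest: inj_onD)
  have arc: "v i j = (\<Sum>t<r. w t i j)" if "(j, i) \<in> parcs (cycle_digraph n)" for i j
  proof -
    have ij: "i < 2 * n" "j < 2 * n" using that by (auto simp: parcs_cycle_digraph_iff)
    note U = unit_mat_in_cycle_alg[OF that]
    have "v i j = \<rho> (unit_mat (2 * n) i j)" using \<rho>[OF U] ij by (simp add: unit_comb_unit_mat)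
    also have "\<dots> = (\<Sum>t<r. w t i j)" unfolding sum[OF U]
      by (intro sum.cong refl) (simp add: \<eta>[OF _ U] unit_comb_unit_mat ij)
    finally show ?thesis .
  qed
  \<comment> \<open>\<open>\<rho>\<close> is known on the cycle algebra only, so for odd
    \<open>j\<close> the identity is obtained for the adjoint units.\<close>
  have v: "v j (s j) = (\<Sum>t<r. w t j (s j))" if j: "j < 2 * n" for j
  proof (cases "even j")
    case True
    then show ?thesis using j by (intro arc nxt_arc)
  next
    case False
    then have "v (s j) j = (\<Sum>t<r. w t (s j) j)" using j by (intro arc nxt_arc)
    then have "star (v (s j) j) = (\<Sum>t<r. star (w t (s j) j))" by (simp add: star_sum)
    also have "\<dots> = (\<Sum>t<r. w t j (s j))"
      using j by (intro sum.cong refl) (simp add: cycle_unitsD(3)[OF w])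
    finally show ?thesis using j by (simp add: star_v)
  qed
  have wf: "Q (f t i) * w t i j = w t i j" "w t i j * Q (f t j) = w t i j"
    if "t < r" "i < 2 * n" "j < 2 * n" for t i j
  proof -
    have *: "w t i j = w t i i * w t i j" "w t i j = w t i j * w t j j"
      using that by (simp_all add: cycle_unitsD(4)[OF w])
    show "Q (f t i) * w t i j = w t i j"
      by (subst (1 2) *(1)) (simp add: mult.assoc[symmetric] f that)
    show "w t i j * Q (f t j) = w t i j"
      by (subst (1 2) *(2)) (simp add: mult.assoc f that)
  qed
  have wQ: "Q \<alpha> * w t i j = (if \<alpha> = f t i then w t i j else 0)"
    "w t i j * Q \<alpha> = (if \<alpha> = f t j then w t i j else 0)"
    if "t < r" "i < 2 * n" "j < 2 * n" for t i j \<alpha>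
  proof -
    have "Q \<alpha> * w t i j = Q \<alpha> * Q (f t i) * w t i j" using wf(1)[OF that] by (simp add: mult.assoc)
    then show "Q \<alpha> * w t i j = (if \<alpha> = f t i then w t i j else 0)"
      using wf(1)[OF that] by (auto simp: Q_mult_Q)
    have "w t i j * Q \<alpha> = w t i j * (Q (f t j) * Q \<alpha>)"
      using wf(2)[OF that] by (simp add: mult.assoc[symmetric])
    then show "w t i j * Q \<alpha> = (if \<alpha> = f t j then w t i j else 0)"
      using wf(2)[OF that] by (auto simp: Q_mult_Q)
  qed
  have ww: "w t i j * w u k l = 0"
    if "t < r" "u < r" "t \<noteq> u" "i < 2 * n" "j < 2 * n" "k < 2 * n" "l < 2 * n" for t u i j k l
  proof -
    \<comment> \<open>Orthogonality is given on the cycle algebra; for the remaining units it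
      follows by inserting the diagonal ones.\<close>
    have U: "unit_mat (2 * n) j j \<in> cycle_alg n" "unit_mat (2 * n) k k \<in> cycle_alg n"
      using that by (auto intro!: unit_mat_in_cycle_alg simp: parcs_cycle_digraph_iff)
    have "w t j j * w u k k = 0"
      using orth[OF that(1-3) U] that by (simp add: \<eta> U unit_comb_unit_mat)
    moreover have "w t i j * w u k l = w t i j * (w t j j * w u k k) * w u k l"
      using that cycle_unitsD(4)[OF w, of t i j j j] cycle_unitsD(4)[OF w, of u k k k l]
      by (metis mult.assoc)
    ultimately show ?thesis by simp
  qed
  have "Q \<alpha> * v j (s j) * Q \<alpha> = 0" if j: "j < 2 * n" for j \<alpha>
  proof -
    have "s j \<noteq> j" using even_nxt[OF j] by metis
    then have "Q \<alpha> * w t j (s j) * Q \<alpha> = 0" if "t < r" for t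
      using that j fneq[of t j "s j"] by (auto simp: wQ)
    then show ?thesis unfolding v[OF j] by (simp add: sum_distrib_left sum_distrib_right)
  qed
  moreover have "Q \<alpha> * v j (s j) * Q \<beta> * v (s j) (s (s j)) * Q \<alpha> = 0" if j: "j < 2 * n" for j \<alpha> \<beta>
  proof -
    have 0: "Q \<alpha> * w t j (s j) * Q \<beta> * w u (s j) (s (s j)) * Q \<alpha> = 0" if tu: "t < r" "u < r" for t u
    proof (cases "t = u")
      case True
      have neq: "f t j \<noteq> f t (s (s j))"
        using fneq[of t j "s (s j)"] nxt_nxt_neq[of n j] n3 j tu by simp
      have "Q \<alpha> * w t j (s j) * Q \<beta> * w t (s j) (s (s j)) * Q \<alpha>
          = Q \<alpha> * (w t j (s j) * Q \<beta>) * (w t (s j) (s (s j)) * Q \<alpha>)" by (simp add: mult.assoc)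
      also have "\<dots> = 0"
        using neq tu j by (simp add: wQ)
      finally show ?thesis using True by simp
    next
      case False
      have "Q \<alpha> * w t j (s j) * Q \<beta> * w u (s j) (s (s j)) * Q \<alpha>
          = Q \<alpha> * ((w t j (s j) * Q \<beta>) * w u (s j) (s (s j))) * Q \<alpha>" by (simp add: mult.assoc)
      also have "(w t j (s j) * Q \<beta>) * w u (s j) (s (s j)) = 0"
        using False tu j by (simp add: wQ ww)
      finally show ?thesis by simp
    qed
    have "Q \<alpha> * v j (s j) * Q \<beta> * v (s j) (s (s j)) * Q \<alpha>
        = (\<Sum>t<r. \<Sum>u<r. Q \<alpha> * w t j (s j) * Q \<beta> * w u (s j) (s (s j)) * Q \<alpha>)"
      unfolding v[OF j] v[OF s_less]
      by (simp add: sum_distrib_left sum_distrib_right) (rule sum.swap)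
    then show ?thesis using 0 by simp
  qed
  ultimately show ?thesis by (simp add: loop_free_def backtrack_free_def)
qed

text \<open>The unit \<open>v 0 j\<close> transports the block projections at vertex
  \<open>j\<close> into the corner below \<open>v 0 0\<close>, where those of different vertices can
  be multiplied with each other.\<close>

definition E :: "nat \<Rightarrow> nat \<times> nat \<Rightarrow> 'a" where
  "E j \<alpha> = v 0 j * Q \<alpha> * v j 0"

lemma E_in_B: "j < 2 * n \<Longrightarrow> E j \<alpha> \<in> B"
  unfolding E_def by (intro star_gen_mult v_in_B Q_in_B) auto

lemma star_E: "j < 2 * n \<Longrightarrow> star (E j \<alpha>) = E j \<alpha>"
  by (simp add: E_def star_mult star_v star_Q mult.assoc)

lemma E_mult_E:
  assumes "i < 2 * n" "j < 2 * n"
  shows "E i \<alpha> * E j \<beta> = v 0 i * (Q \<alpha> * v i j * Q \<beta>) * v j 0"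
  using assms by (simp add: E_def mult.assoc v_mult_assoc)

lemma E_mult_E_mult_E:
  assumes "i < 2 * n" "j < 2 * n" "k < 2 * n"
  shows "E i \<alpha> * E j \<beta> * E k \<gamma> = v 0 i * (Q \<alpha> * v i j * Q \<beta> * v j k * Q \<gamma>) * v k 0"
  using assms by (simp add: E_def mult.assoc v_mult_assoc)

lemma E_orthogonal:
  assumes "j < 2 * n"
  shows "E j \<alpha> * E j \<beta> = (if \<alpha> = \<beta> then E j \<alpha> else 0)"
proof -
  have "E j \<alpha> * E j \<beta> = v 0 j * (v j j * (Q \<alpha> * Q \<beta>)) * v j 0"
    using assms by (simp add: E_mult_E Q_commute_v mult.assoc)
  then show ?thesis using assms by (simp add: Q_mult_Q E_def mult.assoc v_mult_assoc)
qed

lemma E_mult_unit: "j < 2 * n \<Longrightarrow> E j \<alpha> * v 0 0 = E j \<alpha>" "j < 2 * n \<Longrightarrow> v 0 0 * E j \<alpha> = E j \<alpha>"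
  by (simp_all add: E_def mult.assoc v_mult v_mult_assoc)

lemma sum_E:
  assumes "j < 2 * n" shows "(\<Sum>\<alpha>\<in>labels. E j \<alpha>) = v 0 0"
proof -
  have "(\<Sum>\<alpha>\<in>labels. E j \<alpha>) = v 0 j * (\<Sum>\<alpha>\<in>labels. Q \<alpha> * v j 0)"
    by (simp add: E_def sum_distrib_left mult.assoc)
  also have "\<dots> = v 0 j * v j 0" using assms by (subst sum_Q_mult) (auto intro: v_in_B)
  finally show ?thesis using assms by (simp add: v_mult)
qed

text \<open>A product \<open>E j \<alpha> * E (s j) \<beta> * E j \<alpha>'\<close> with \<alpha>
  different from \<open>\<alpha>'\<close> vanishes. Summing over \<open>\<alpha>'\<close> therefore
  shows that \<open>E j \<alpha> * E (s j) \<beta>\<close> equals its compression by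
  \<open>E j \<alpha>\<close>, which is self-adjoint.\<close>

lemma E_commute:
  assumes lf: "loop_free" and j: "j < 2 * n"
  shows "E j \<alpha> * E (s j) \<beta> = E (s j) \<beta> * E j \<alpha>"
proof -
  have EEE: "E j \<alpha> * E (s j) \<beta> * E j \<alpha>' = 0" if "\<alpha> \<noteq> \<alpha>'" for \<alpha>'
    using block_projections_commute[OF lf j that, of \<beta>] j by (simp add: E_mult_E_mult_E)
  have *: "E j \<alpha> * E (s j) \<beta> = E j \<alpha> * E (s j) \<beta> * E j \<alpha>"
  proof -
    have "E j \<alpha> * E (s j) \<beta> = E j \<alpha> * E (s j) \<beta> * v 0 0"
      using j by (simp add: mult.assoc E_mult_unit)
    also have "\<dots> = (\<Sum>\<alpha>'\<in>labels. E j \<alpha> * E (s j) \<beta> * E j \<alpha>')"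
      unfolding sum_E[OF j, symmetric] by (simp add: sum_distrib_left)
    also have "\<dots> = (\<Sum>\<alpha>'\<in>labels. if \<alpha>' = \<alpha> then E j \<alpha> * E (s j) \<beta> * E j \<alpha> else 0)"
      using EEE by (intro sum.cong) auto
    also have "\<dots> = E j \<alpha> * E (s j) \<beta> * E j \<alpha>"
    proof (cases "\<alpha> \<in> labels")
      case False
      then have "Q \<alpha> = 0" unfolding Q_def by (intro diag_eq_zero) (auto simp: labels_def)
      then show ?thesis by (simp add: E_def)
    qed simp
    finally show ?thesis .
  qed
  have "E (s j) \<beta> * E j \<alpha> = star (E j \<alpha> * E (s j) \<beta>)" using j by (simp add: star_mult star_E)
  also have "\<dots> = star (E j \<alpha> * E (s j) \<beta> * E j \<alpha>)" using * by simp
  also have "\<dots> = E j \<alpha> * E (s j) \<beta> * E j \<alpha>" using j by (simp add: star_mult star_E mult.assoc)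
  finally show ?thesis using * by simp
qed

lemma E_block:
  assumes "j < 2 * n" "E j \<alpha> * E (s j) \<beta> \<noteq> 0"
  shows "Q \<alpha> * v j (s j) * Q \<beta> \<noteq> 0"
  using assms by (auto simp: E_mult_E)

text \<open>The labels are found one after another: once two consecutive labels hold on
  \<open>g\<close>, adjacency and the ban on turning back leave at most one candidate for the next,
  while all candidates together sum to \<open>g\<close>.\<close>

lemma walk_of_projection:
  assumes free: "loop_free" "backtrack_free" and g: "g \<noteq> 0" "g * v 0 0 = g"
    and g0: "g * E 0 \<alpha>\<^sub>0 = g" and g1: "g * E (Suc 0) \<beta>\<^sub>0 = g"
  shows "\<exists>f. \<forall>j<2 * n. g * E j (f j) = g"
proof -
  \<comment> \<open>Two consecutive labels are carried along because the next one depends on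
    both.\<close>
  have pairs: "\<exists>\<alpha> \<beta>. g * E j \<alpha> = g \<and> g * E (Suc j) \<beta> = g" if "Suc j < 2 * n" for j
    using that
  proof (induction j)
    case 0
    show ?case using g0 g1 by (intro exI[of _ \<alpha>\<^sub>0] exI[of _ \<beta>\<^sub>0]) simp
  next
    case (Suc j)
    then obtain \<alpha> \<beta> where \<alpha>: "g * E j \<alpha> = g" and \<beta>: "g * E (Suc j) \<beta> = g" by auto
    have sj: "s j = Suc j" "s (Suc j) = Suc (Suc j)" "j < 2 * n" "Suc j < 2 * n"
      using Suc.prems by (auto intro!: nxt_Suc)
    let ?F = "E (Suc (Suc j))"
    have total: "(\<Sum>\<gamma>\<in>labels. g * ?F \<gamma>) = g"
      unfolding sum_distrib_left[symmetric] sum_E[OF Suc.prems] by (rule g(2))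
    have "E j \<alpha> * E (s j) \<beta> \<noteq> 0"
    proof
      assume "E j \<alpha> * E (s j) \<beta> = 0"
      then have "g * E j \<alpha> * E (Suc j) \<beta> = 0" by (simp add: mult.assoc sj)
      then show False using g(1) by (simp add: \<alpha> \<beta>)
    qed
    then have ab: "adjacent n \<alpha> \<beta>" using block_adjacent[OF free(1) sj(3) E_block[OF sj(3)]] by blast
    have next_label: "adjacent n \<gamma> \<beta> \<and> \<gamma> \<noteq> \<alpha>" if \<gamma>: "g * ?F \<gamma> \<noteq> 0" for \<gamma>
    proof
      have "E (Suc j) \<beta> * E (s (Suc j)) \<gamma> \<noteq> 0"
      proof
        assume "E (Suc j) \<beta> * E (s (Suc j)) \<gamma> = 0"
        then have "g * E (Suc j) \<beta> * ?F \<gamma> = 0" by (simp add: mult.assoc sj)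
        then show False using \<gamma> by (simp add: \<beta>)
      qed
      then show "adjacent n \<gamma> \<beta>"
        using block_adjacent[OF free(1) sj(4) E_block[OF sj(4)]] adjacent_sym by blast
      show "\<gamma> \<noteq> \<alpha>"
      proof
        assume "\<gamma> = \<alpha>"
        then have "E j \<alpha> * E (s j) \<beta> * E (s (s j)) \<gamma> = 0"
          using free(2) sj(3) by (simp add: E_mult_E_mult_E backtrack_freeD)
        then have "g * (E j \<alpha> * E (Suc j) \<beta> * ?F \<gamma>) = 0" by (simp add: sj)
        then show False using \<gamma> by (simp add: mult.assoc[symmetric] \<alpha> \<beta>)
      qed
    qed
    obtain \<gamma> where \<gamma>: "\<gamma> \<in> labels" "g * ?F \<gamma> \<noteq> 0"
      using total g(1) by (metis (no_types, lifting) sum.neutral)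
    \<comment> \<open>The label \<beta> has two neighbours and one of them is \<alpha>, so only
      \<gamma> is left and its term is the whole sum.\<close>
    have "g * ?F \<gamma>' = 0" if "\<gamma>' \<noteq> \<gamma>" for \<gamma>'
      using neighbour_unique[OF ab, of \<gamma> \<gamma>'] next_label[OF \<gamma>(2)] next_label[of \<gamma>'] that by blast
    then have "(\<Sum>\<gamma>'\<in>labels. g * ?F \<gamma>') = (\<Sum>\<gamma>'\<in>labels. if \<gamma>' = \<gamma> then g * ?F \<gamma> else 0)"
      by (intro sum.cong) auto
    then have "g * ?F \<gamma> = g" using total \<gamma>(1) by simp
    then show ?case using \<beta> by blast
  qed
  have "\<exists>\<alpha>. g * E j \<alpha> = g" if "j < 2 * n" for j
  proof (cases j)
    case 0
    then show ?thesis using g0 by blast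
  next
    case (Suc k)
    then show ?thesis using pairs[of k] that by blast
  qed
  then show ?thesis by metis
qed

text \<open>The copy of \<open>g\<close> at vertex \<open>j\<close> lies under the label
  \<open>f j\<close>. The labels follow the arcs of the cycle, which puts the required units into
  \<open>A\<close>; they are distinct because the walk never turns back, which makes the copies
  pairwise inequivalent.\<close>

lemma proper_summand:
  assumes free: "loop_free" "backtrack_free" and g: "min_projection A g" "g * v 0 0 = g"
    and f: "\<And>j. j < 2 * n \<Longrightarrow> g * E j (f j) = g"
  shows "proper_embedding n A (unit_comb n (\<lambda>i j. v i 0 * g * v 0 j))"
proof -
  note gD = min_projectionD[OF g(1)]
  define w where "w i j = v i 0 * g * v 0 j" for i j
  have n1: "n \<ge> 1" using n3 by simp
  have vg: "v 0 0 * g = g"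
    using arg_cong[OF g(2), of star] by (simp add: star_mult star_v gD(2))
  have fg: "E j (f j) * g = g" if "j < 2 * n" for j
    using arg_cong[OF f[OF that], of star] that by (simp add: star_mult star_E gD(2))
  have EE: "E j (f j) * E (s j) (f (s j)) \<noteq> 0" if "j < 2 * n" for j
  proof
    assume "E j (f j) * E (s j) (f (s j)) = 0"
    then have "g * E j (f j) * E (s j) (f (s j)) = 0" by (simp add: mult.assoc)
    then show False using gD(4) f that by simp
  qed
  have adj: "adjacent n (f j) (f (s j))" if "j < 2 * n" for j
    using block_adjacent[OF free(1) that E_block[OF that EE[OF that]]] .
  have nb: "f (s (s j)) \<noteq> f j" if "j < 2 * n" for j
  proof
    assume *: "f (s (s j)) = f j"
    have "E j (f j) * E (s j) (f (s j)) * E (s (s j)) (f (s (s j))) = 0"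
      using free(2) that by (simp add: E_mult_E_mult_E backtrack_freeD *)
    then have "g * (E j (f j) * E (s j) (f (s j)) * E (s (s j)) (f (s (s j)))) = 0" by simp
    then show False using gD(4) f that by (simp add: mult.assoc[symmetric])
  qed
  have inj: "inj_on f {..<2 * n}"
  proof (rule nonbacktracking_walk_inj)
    fix j
    show "Suc j < 2 * n \<Longrightarrow> adjacent n (f j) (f (Suc j))"
      using adj[of j] by (simp add: nxt_Suc)
    show "Suc (Suc j) < 2 * n \<Longrightarrow> f (Suc (Suc j)) \<noteq> f j"
      using nb[of j] by (simp add: nxt_Suc)
  qed
  \<comment> \<open>The arc that closes the cycle is included: \<open>EE\<close> also holds at the
    last vertex, whose successor is 0.\<close>
  have arc: "label_arc n (f j) (f i)" if "(j, i) \<in> parcs (cycle_digraph n)" for i j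
    using that
  proof (cases rule: parcs_cycle_digraph_cases)
    case 1
    then show ?thesis using adj[of i] label_arc_refl[of "f i" n] by (simp add: adjacent_def)
  next
    case 2
    then show ?thesis using block_arc(1)[OF _ E_block[OF _ EE]] by blast
  next
    case 3
    then show ?thesis using block_arc(2)[OF _ E_block[OF _ EE]] by blast
  qed
  have wB: "w i j \<in> B" if "i < 2 * n" "j < 2 * n" for i j
    unfolding w_def using that by (intro star_gen_mult v_in_B gD(1)) auto
  have vQ: "v i 0 * E i \<alpha> = Q \<alpha> * v i 0" "E i \<alpha> * v 0 i = v 0 i * Q \<alpha>" if "i < 2 * n" for i \<alpha>
  proof -
    have "v i 0 * E i \<alpha> = v i i * Q \<alpha> * v i 0" using that by (simp add: E_def mult.assoc v_mult_assoc)
    then show "v i 0 * E i \<alpha> = Q \<alpha> * v i 0"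
      using that by (simp add: Q_commute_v[symmetric] mult.assoc v_mult)
    have "E i \<alpha> * v 0 i = v 0 i * (Q \<alpha> * v i i)" using that by (simp add: E_def mult.assoc v_mult)
    then show "E i \<alpha> * v 0 i = v 0 i * Q \<alpha>"
      using that by (simp add: Q_commute_v v_mult_assoc)
  qed
  have Qw: "Q (f i) * w i j = w i j" "w i j * Q (f j) = w i j" if "i < 2 * n" "j < 2 * n" for i j
  proof -
    have "w i j = v i 0 * (E i (f i) * g) * v 0 j" using fg that by (simp add: w_def)
    also have "\<dots> = Q (f i) * w i j" using that by (simp add: w_def mult.assoc[symmetric] vQ)
    finally show "Q (f i) * w i j = w i j" by simp
    have "w i j = v i 0 * (g * E j (f j)) * v 0 j" using f that by (simp add: w_def)
    also have "\<dots> = w i j * Q (f j)" using that by (simp add: w_def mult.assoc vQ)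
    finally show "w i j * Q (f j) = w i j" by simp
  qed
  have ggv: "g * (v 0 0 * x) = g * x" "g * (g * x) = g * x" for x
    using g(2) gD(3) by (simp_all add: mult.assoc[symmetric])
  have mult: "w i j * w k l = (if j = k then w i l else 0)"
    if "i < 2 * n" "j < 2 * n" "k < 2 * n" "l < 2 * n" for i j k l
    using that by (simp add: w_def mult.assoc v_mult_assoc ggv)
  have nz: "w i i \<noteq> 0" if "i < 2 * n" for i
  proof
    assume "w i i = 0"
    then have "v 0 i * w i i * v i 0 = 0" by simp
    then have "v 0 0 * g * v 0 0 = 0" using that by (simp add: w_def mult.assoc v_mult_assoc v_mult)
    then show False using gD(4) by (simp add: vg g(2))
  qed
  have units: "cycle_units n A w"
    unfolding cycle_units_def
  proof (intro conjI allI impI)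
    fix i j assume "i < 2 * n" "j < 2 * n"
    then show "star (w i j) = w j i"
      by (simp add: w_def star_mult star_v gD(2) mult.assoc)
  next
    fix i j assume ji: "(j, i) \<in> parcs (cycle_digraph n)"
    then have ij: "i < 2 * n" "j < 2 * n" by (auto simp: parcs_cycle_digraph_iff)
    have "Q (f i) * w i j * Q (f j) \<in> A" using wB[OF ij] arc[OF ji] by (rule Q_mult_B_mult_Q)
    then show "w i j \<in> A" using Qw[OF ij] by simp
  qed (simp_all add: wB mult nz)
  have min: "min_projection A (w j j)" if j: "j < 2 * n" for j
    unfolding min_projection_def
  proof (intro conjI ballI)
    fix x assume x: "x \<in> B"
    have "v 0 j * x * v j 0 \<in> B" using x j by (intro star_gen_mult v_in_B) auto
    then obtain c where c: "g * (v 0 j * x * v j 0) * g = scaleC c g" using gD(5) by blast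
    have "w j j * x * w j j = v j 0 * (g * (v 0 j * x * v j 0) * g) * v 0 j"
      by (simp add: w_def mult.assoc)
    also have "\<dots> = scaleC c (w j j)" unfolding c by (simp add: w_def mult_scaleC_left mult_scaleC_right)
    finally show "\<exists>c. w j j * x * w j j = scaleC c (w j j)" by blast
  qed (use j wB mult nz cycle_unitsD(3)[OF units] in auto)
  have proj: "unit_comb n w (cycle_proj n j) = w j j" if "j < 2 * n" for j
    using that by (simp add: cycle_proj_eq_unit_mat unit_comb_unit_mat)
  have "\<not> equivalent_projections_in (A \<inter> star ` A) (w i i) (w j j)"
    if "i < 2 * n" "j < 2 * n" "i \<noteq> j" for i j
    using that inj Qw mult nz
    by (intro inequivalent_projections[of "f i" _ _ "f j"]) (auto dest: inj_onD)
  then have "proper_embedding n A (unit_comb n w)"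
    unfolding proper_embedding_def multiplicity_one_def
    using star_ext_embedding_unit_comb[OF n1 units add_in_A scaleC_in_A]
      has_rank_one_of_min_projection[OF min] by (simp add: proj)
  then show ?thesis by (simp add: w_def[abs_def])
qed

text \<open>The first two labels determine the rest of the walk, so it is enough to split the
  products of the projections at vertices 0 and 1 into minimal projections.\<close>

lemma rigid_of_free:
  assumes free: "loop_free" "backtrack_free" and emb: "star_ext_embedding (cycle_alg n) A \<rho>"
    and \<rho>: "\<And>x. x \<in> cycle_alg n \<Longrightarrow> \<rho> x = unit_comb n v x"
  shows "rigid_cycle_embedding n A \<rho>"
proof -
  define I where "I = labels \<times> labels"
  define P where "P t = E 0 (fst t) * E (Suc 0) (snd t)" for t
  have n1: "Suc 0 < 2 * n" using n3 by simp
  have s0: "s 0 = Suc 0" using n1 by (simp add: nxt_Suc)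
  have comm: "E (Suc 0) \<beta> * E 0 \<alpha> = E 0 \<alpha> * E (Suc 0) \<beta>" for \<alpha> \<beta>
    using E_commute[OF free(1), of 0 \<alpha> \<beta>] by (simp add: s0)
  \<comment> \<open>The two families commute, so their products are again orthogonal projections
    with sum \<open>v 0 0\<close>.\<close>
  have PP: "P t * P u = (if t = u then P t else 0)" for t u
  proof -
    have "P t * P u = E 0 (fst t) * (E (Suc 0) (snd t) * E 0 (fst u)) * E (Suc 0) (snd u)"
      by (simp add: P_def mult.assoc)
    also have "\<dots> = (E 0 (fst t) * E 0 (fst u)) * (E (Suc 0) (snd t) * E (Suc 0) (snd u))"
      unfolding comm by (simp add: mult.assoc)
    finally show ?thesis
      using n1 by (cases t; cases u) (auto simp: E_orthogonal P_def)
  qed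
  have PB: "P t \<in> B" for t unfolding P_def using n1 by (intro star_gen_mult E_in_B) auto
  have star_P: "star (P t) = P t" for t unfolding P_def using n1 by (simp add: star_mult star_E comm)
  have sum_P: "(\<Sum>t\<in>I. P t) = v 0 0"
  proof -
    have "(\<Sum>t\<in>I. P t) = (\<Sum>\<alpha>\<in>labels. E 0 \<alpha>) * (\<Sum>\<beta>\<in>labels. E (Suc 0) \<beta>)"
      unfolding I_def P_def sum_product by (simp add: sum.cartesian_product split_def)
    also have "\<dots> = v 0 0" using sum_E[OF n1] sum_E[of 0] by (simp add: v_mult)
    finally show ?thesis .
  qed
  have "\<exists>D. finite D \<and> (\<forall>g\<in>D. min_projection A g \<and> g * P t = g) \<and>
      (\<forall>g\<in>D. \<forall>h\<in>D. g \<noteq> h \<longrightarrow> g * h = 0) \<and> \<Sum>D = P t" for t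
  proof (rule projection_decomposition[OF PB[of t] star_P])
    show "P t * P t = P t" by (simp add: PP)
    fix D assume "finite D" "\<And>g. g \<in> D \<Longrightarrow> min_projection A g" "\<And>g. g \<in> D \<Longrightarrow> g * P t = g"
      "\<And>g h. g \<in> D \<Longrightarrow> h \<in> D \<Longrightarrow> g \<noteq> h \<Longrightarrow> g * h = 0" "\<Sum>D = P t"
    then show ?thesis by (intro exI[of _ D] conjI ballI impI) simp_all
  qed
  then have "\<forall>t. \<exists>D. finite D \<and> (\<forall>g\<in>D. min_projection A g \<and> g * P t = g) \<and>
      (\<forall>g\<in>D. \<forall>h\<in>D. g \<noteq> h \<longrightarrow> g * h = 0) \<and> \<Sum>D = P t" by blast
  from choice[OF this] obtain D where "\<forall>t. finite (D t) \<and> (\<forall>g\<in>D t. min_projection A g \<and> g * P t = g) \<and>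
      (\<forall>g\<in>D t. \<forall>h\<in>D t. g \<noteq> h \<longrightarrow> g * h = 0) \<and> \<Sum>(D t) = P t" by blast
  then have D: "\<And>t. finite (D t)" "\<And>t g. g \<in> D t \<Longrightarrow> min_projection A g" "\<And>t g. g \<in> D t \<Longrightarrow> g * P t = g"
    "\<And>t g h. g \<in> D t \<Longrightarrow> h \<in> D t \<Longrightarrow> g \<noteq> h \<Longrightarrow> g * h = 0" "\<And>t. \<Sum>(D t) = P t"
    by (simp_all del: split_paired_All)
  have orthD: "g * h = 0" if "g \<in> D t" "h \<in> D u" "t \<noteq> u" for g h t u
  proof -
    have "P u * h = h"
      using arg_cong[OF D(3)[OF that(2)], of star] min_projectionD(2)[OF D(2)[OF that(2)]]
      by (simp add: star_mult star_P)
    then have "g * h = g * P t * (P u * h)" by (simp add: D(3)[OF that(1)])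
    also have "\<dots> = g * (P t * P u) * h" by (simp add: mult.assoc)
    finally show ?thesis using that(3) by (simp add: PP)
  qed
  define S where "S = (\<Union>t\<in>I. D t)"
  have finS: "finite S" unfolding S_def I_def using D(1) by auto
  have orth: "g * h = 0" if "g \<in> S" "h \<in> S" "g \<noteq> h" for g h
    using that D(4) orthD unfolding S_def by blast
  have "\<Sum>S = (\<Sum>t\<in>I. \<Sum>(D t))"
    unfolding S_def
  proof (rule sum.UNION_disjoint)
    \<comment> \<open>A common element \<open>g\<close> would satisfy
      \<open>g = g * g = 0\<close>.\<close>
    show "\<forall>t\<in>I. \<forall>u\<in>I. t \<noteq> u \<longrightarrow> D t \<inter> D u = {}"
      using orthD min_projectionD(3,4)[OF D(2)] by (metis disjoint_iff)
  qed (use D(1) in \<open>auto simp: I_def\<close>)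
  then have sumS: "\<Sum>S = v 0 0" by (simp add: D(5) sum_P)
  have min: "min_projection A g" if "g \<in> S" for g using that D(2) by (auto simp: S_def)
  have gv: "g * v 0 0 = g" and walk: "\<exists>f. \<forall>j<2 * n. g * E j (f j) = g" if "g \<in> S" for g
  proof -
    obtain t where t: "g \<in> D t" using \<open>g \<in> S\<close> by (auto simp: S_def)
    have 1: "P t * v 0 0 = P t" "P t * E 0 (fst t) = P t" "P t * E (Suc 0) (snd t) = P t"
      unfolding P_def using n1
      by (simp_all add: mult.assoc E_mult_unit E_orthogonal comm)
        (simp_all add: mult.assoc[symmetric] E_orthogonal)
    have 2: "g * x = g" if "P t * x = P t" for x
      using D(3)[OF t] that by (metis mult.assoc)
    show "g * v 0 0 = g" by (rule 2[OF 1(1)])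
    show "\<exists>f. \<forall>j<2 * n. g * E j (f j) = g"
      by (rule walk_of_projection[OF free min_projectionD(4)[OF min[OF \<open>g \<in> S\<close>]] 2[OF 1(1)] 2[OF 1(2)] 2[OF 1(3)]])
  qed
  define \<eta> where "\<eta> g = unit_comb n (\<lambda>i j. v i 0 * g * v 0 j)" for g
  show ?thesis
  proof (rule rigid_cycle_embeddingI[OF emb finS])
    fix g assume g: "g \<in> S"
    obtain f where f: "\<And>j. j < 2 * n \<Longrightarrow> g * E j (f j) = g" using walk[OF g] by blast
    show "proper_embedding n A (\<eta> g)"
      unfolding \<eta>_def by (rule proper_summand[OF free min[OF g] gv[OF g] f])
  next
    fix g h x y assume gh: "g \<in> S" "h \<in> S" "g \<noteq> h"
    show "\<eta> g x * \<eta> h y = 0"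
      unfolding \<eta>_def
    proof (rule unit_comb_orthogonal)
      fix i j k l assume "i < 2 * n" "j < 2 * n" "k < 2 * n" "l < 2 * n"
      then have "v i 0 * g * v 0 j * (v k 0 * h * v 0 l) = (if j = k then v i 0 * (g * v 0 0 * h) * v 0 l else 0)"
        by (simp add: mult.assoc v_mult_assoc)
      then show "v i 0 * g * v 0 j * (v k 0 * h * v 0 l) = 0" by (simp add: gv gh orth)
    qed
  next
    fix x assume "x \<in> cycle_alg n"
    have "unit_comb n v x = (\<Sum>g\<in>S. unit_comb n (\<lambda>i j. v i 0 * g * v 0 j) x)"
    proof (rule unit_comb_sum)
      fix i j assume ij: "i < 2 * n" "j < 2 * n"
      then have "v i j = v i 0 * \<Sum>S * v 0 j" by (simp add: sumS v_mult)
      then show "v i j = (\<Sum>g\<in>S. v i 0 * g * v 0 j)" by (simp add: sum_distrib_left sum_distrib_right)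
    qed
    then show "\<rho> x = (\<Sum>g\<in>S. \<eta> g x)" using \<rho> \<open>x \<in> cycle_alg n\<close> by (simp add: \<eta>_def)
  qed
qed

end

section \<open>Factors and composites of rigid embeddings\<close>

lemma rigid_cycle_embedding_cong:
  assumes "\<And>x. x \<in> cycle_alg n \<Longrightarrow> \<rho> x = \<sigma> x"
  shows "rigid_cycle_embedding n A \<rho> \<longleftrightarrow> rigid_cycle_embedding n A \<sigma>"
  using assms star_ext_embedding_cong[of "cycle_alg n" \<rho> \<sigma> A]
  by (simp add: rigid_cycle_embedding_def)

text \<open>The loops and backtracks of \<open>\<rho>\<close> are elements of diagonal blocks of \<open>A'\<close>, whose images under
  \<open>\<psi>\<close> commute with the block projections of \<open>A''\<close>; hence the loops and backtracks of \<open>\<psi> \<circ> \<rho>\<close>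
  detect them.\<close>

lemma rigid_cycle_embedding_factor:
  fixes A' :: "'a::complex_star_algebra set" and A'' :: "'b::complex_star_algebra set"
  assumes n3: "n \<ge> 3" and A': "cycle_algebra_sum n A'" and A'': "cycle_algebra_sum n A''"
    and \<psi>: "star_ext_embedding A' A'' \<psi>" and \<rho>: "star_ext_embedding (cycle_alg n) A' \<rho>"
    and rigid: "rigid_cycle_embedding n A'' (\<psi> \<circ> \<rho>)"
  shows "rigid_cycle_embedding n A' \<rho>"
proof -
  have n1: "n \<ge> 1" using n3 by simp
  obtain \<Psi> where hom: "star_hom (star_gen A') (star_gen A'') \<Psi>" and \<psi>\<Psi>: "\<forall>x\<in>A'. \<psi> x = \<Psi> x"
    using star_ext_embedding_extension(1)[OF \<psi>] by blast
  note img = star_ext_embedding_extension(2)[OF \<psi>] and inj = star_ext_embedding_extension(3)[OF \<psi>]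
  obtain v where v: "cycle_units n A' v" and \<rho>v: "\<And>x. x \<in> cycle_alg n \<Longrightarrow> \<rho> x = unit_comb n v x"
    using cycle_units_of_embedding[OF n1 \<rho>] by blast
  obtain Gs \<theta> N lab where real': "cycle_realization n A' Gs \<theta> N lab"
    using cycle_algebra_sumE[OF A'] by blast
  obtain Gs' \<theta>' N' lab' where real'': "cycle_realization n A'' Gs' \<theta>' N' lab'"
    using cycle_algebra_sumE[OF A''] by blast
  interpret X: cycle_representation n A' Gs \<theta> N lab v
    using real' n3 v by (simp add: cycle_representation_def cycle_representation_axioms_def)
  have A'0: "0 \<in> A'"
  proof -
    obtain x where "x \<in> A'" using X.A_nonempty by blast
    from X.scaleC_in_A[OF this, of 0] show ?thesis by simp
  qed
  have \<Psi>A: "\<Psi> x \<in> A''" if "x \<in> A'" for x using img \<psi>\<Psi> that by auto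
  have \<Psi>0: "\<Psi> 0 = 0" using star_hom_zero[OF hom X.zero_in_B] .
  have \<Psi>inj: "x = 0" if "x \<in> A'" "\<Psi> x = 0" for x
    using inj_onD[OF inj, of x 0] \<psi>\<Psi> that A'0 \<Psi>0 by simp
  define w where "w i j = \<Psi> (v i j)" for i j
  have w: "cycle_units n A'' w"
    unfolding cycle_units_def
  proof (intro conjI allI impI)
    fix i assume i: "i < 2 * n"
    then have "v i i \<in> A'" by (intro X.v_in_A) (auto simp: parcs_cycle_digraph_iff)
    then show "w i i \<noteq> 0" using \<Psi>inj cycle_unitsD(1)[OF v i i] by (auto simp: w_def)
  next
    fix i j assume "i < 2 * n" "j < 2 * n"
    then show "w i j \<in> star_gen A''" "star (w i j) = w j i"
      using X.v_in_B[of i j] X.star_v[of i j]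
      by (simp_all add: w_def star_homD(1)[OF hom] star_homD(5)[OF hom, symmetric])
  next
    fix i j k l assume "i < 2 * n" "j < 2 * n" "k < 2 * n" "l < 2 * n"
    then show "w i j * w k l = (if j = k then w i l else 0)"
      by (simp add: w_def star_homD(3)[OF hom, symmetric] X.v_in_B X.v_mult \<Psi>0)
  next
    fix i j assume ji: "(j, i) \<in> parcs (cycle_digraph n)"
    then have "v i j \<in> A'" by (intro X.v_in_A) (auto simp: parcs_cycle_digraph_iff)
    then show "w i j \<in> A''" by (simp add: w_def \<Psi>A)
  qed
  interpret Y: cycle_representation n A'' Gs' \<theta>' N' lab' w
    using real'' n3 w by (simp add: cycle_representation_def cycle_representation_axioms_def)
  have \<psi>\<rho>: "(\<psi> \<circ> \<rho>) x = unit_comb n w x" if x: "x \<in> cycle_alg n" for x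
  proof -
    have "\<rho> x \<in> A'" using star_ext_embedding_extension(2)[OF \<rho>] x by blast
    then have "(\<psi> \<circ> \<rho>) x = \<Psi> (unit_comb n v x)" using \<psi>\<Psi> \<rho>v[OF x] by simp
    also have "\<dots> = (\<Sum>i<2 * n. \<Psi> (\<Sum>j<2 * n. scaleC (x $$ (i, j)) (v i j)))"
      unfolding unit_comb_def
      by (rule star_hom_sum[OF hom X.A_nonempty])
        (auto intro!: star_gen_sum[OF X.A_nonempty] star_gen_scaleC X.v_in_B)
    also have "\<dots> = (\<Sum>i<2 * n. \<Sum>j<2 * n. \<Psi> (scaleC (x $$ (i, j)) (v i j)))"
      by (intro sum.cong refl star_hom_sum[OF hom X.A_nonempty])
        (auto intro!: star_gen_scaleC X.v_in_B)
    also have "\<dots> = unit_comb n w x"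
      unfolding unit_comb_def
      by (intro sum.cong refl) (simp add: w_def star_homD(4)[OF hom] X.v_in_B)
    finally show ?thesis .
  qed
  have free: "Y.loop_free" "Y.backtrack_free" using Y.free_of_rigid[OF rigid \<psi>\<rho>] by auto
  have commute: "Y.Q \<gamma> * \<Psi> x = \<Psi> x * Y.Q \<gamma>" if "x \<in> A'" "star x \<in> A'" for x \<gamma>
  proof (rule Y.Q_commute[OF \<Psi>A[OF that(1)]])
    show "star (\<Psi> x) \<in> A''"
      using \<Psi>A[OF that(2)] star_homD(5)[OF hom X.A_in_B[OF that(1)]] by simp
  qed
  \<comment> \<open>For diagonal \<open>x\<close> the element \<open>\<Psi> x\<close> is block
    diagonal, so it is the sum of the compressions assumed to vanish. Injectivity of
    \<open>\<Psi>\<close> is at hand on \<open>A'\<close>, hence the membership premises.\<close>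
  have zero: "x = 0"
    if x: "x \<in> A'" "star x \<in> A'" and "\<And>\<gamma>. Y.Q \<gamma> * \<Psi> x * Y.Q \<gamma> = 0" for x
  proof (rule \<Psi>inj[OF x(1)])
    have "Y.Q \<gamma> * \<Psi> x = Y.Q \<gamma> * \<Psi> x * Y.Q \<gamma>" for \<gamma>
    proof -
      have "Y.Q \<gamma> * \<Psi> x * Y.Q \<gamma> = Y.Q \<gamma> * (\<Psi> x * Y.Q \<gamma>)" by (rule mult.assoc)
      also have "\<dots> = Y.Q \<gamma> * (Y.Q \<gamma> * \<Psi> x)" by (simp only: commute[OF x])
      finally show ?thesis by (simp add: mult.assoc[symmetric] Y.Q_mult_Q)
    qed
    then have "Y.Q \<gamma> * \<Psi> x = 0" for \<gamma> using that(3) by simp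
    then show "\<Psi> x = 0" using Y.sum_Q_mult[OF Y.A_in_B[OF \<Psi>A[OF x(1)]]] by simp
  qed
  have QA: "X.Q \<alpha> \<in> A'" "star (X.Q \<alpha>) \<in> A'" for \<alpha> by (simp_all add: X.Q_in_A X.star_Q)
  have \<Psi>_mult: "\<Psi> (x * y) = \<Psi> x * \<Psi> y" if "x \<in> star_gen A'" "y \<in> star_gen A'" for x y
    using star_homD(3)[OF hom that] .
  have loop: "X.Q \<alpha> * v j (nxt n j) * X.Q \<alpha> = 0" if j: "j < 2 * n" for j \<alpha>
  proof (rule zero)
    have vB: "v j (nxt n j) \<in> star_gen A'" using j by (intro X.v_in_B) auto
    show "X.Q \<alpha> * v j (nxt n j) * X.Q \<alpha> \<in> A'" "star (X.Q \<alpha> * v j (nxt n j) * X.Q \<alpha>) \<in> A'"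
      using X.Q_block_in_A[OF vB] by auto
    fix \<gamma>
    define a where "a = \<Psi> (X.Q \<alpha>)"
    have ca: "Y.Q \<gamma> * a = a * Y.Q \<gamma>" unfolding a_def by (rule commute[OF QA])
    have "Y.Q \<gamma> * \<Psi> (X.Q \<alpha> * v j (nxt n j) * X.Q \<alpha>) * Y.Q \<gamma> = Y.Q \<gamma> * (a * w j (nxt n j) * a) * Y.Q \<gamma>"
      using vB by (simp add: \<Psi>_mult X.Q_in_B star_gen_mult a_def w_def)
    also have "\<dots> = (Y.Q \<gamma> * a) * w j (nxt n j) * (a * Y.Q \<gamma>)" by (simp add: mult.assoc)
    also have "\<dots> = (a * Y.Q \<gamma>) * w j (nxt n j) * (Y.Q \<gamma> * a)" by (simp only: ca)
    also have "\<dots> = a * (Y.Q \<gamma> * w j (nxt n j) * Y.Q \<gamma>) * a" by (simp add: mult.assoc)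
    also have "\<dots> = 0" using free(1) j unfolding Y.loop_free_def by (simp del: split_paired_All)
    finally show "Y.Q \<gamma> * \<Psi> (X.Q \<alpha> * v j (nxt n j) * X.Q \<alpha>) * Y.Q \<gamma> = 0" .
  qed
  then have lf: "X.loop_free" unfolding X.loop_free_def by blast
  have "X.Q \<alpha> * v j (nxt n j) * X.Q \<beta> * v (nxt n j) (nxt n (nxt n j)) * X.Q \<alpha> = 0"
    if j: "j < 2 * n" for j \<alpha> \<beta>
  proof -
    define k where "k = nxt n j"
    define l where "l = nxt n k"
    have kl: "k < 2 * n" "l < 2 * n" by (simp_all add: k_def l_def)
    \<comment> \<open>This takes over the role of \<open>X.Q \<beta>\<close> from the left end: it
      lies in the block of \<alpha>, and multiplied by \<open>v j k\<close> it gives the first half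
      of the backtrack (\<open>hv\<close>).\<close>
    define h where "h = X.Q \<alpha> * v j k * X.Q \<beta> * v k j"
    have hB: "h \<in> star_gen A'" unfolding h_def using j kl by (intro star_gen_mult X.v_in_B X.Q_in_B)
    have hQ: "h * X.Q \<alpha> = h"
    proof -
      have "h * X.Q \<alpha>' = 0" if "\<alpha>' \<noteq> \<alpha>" for \<alpha>'
        unfolding h_def k_def using X.block_projections_commute[OF lf j, of \<alpha> \<alpha>' \<beta>] that by simp
      then have "(\<Sum>\<alpha>'\<in>X.labels. h * X.Q \<alpha>') = (\<Sum>\<alpha>'\<in>X.labels. if \<alpha>' = \<alpha> then h * X.Q \<alpha> else 0)"
        by (intro sum.cong) auto
      then have *: "h = (if \<alpha> \<in> X.labels then h * X.Q \<alpha> else 0)" by (simp add: X.sum_mult_Q[OF hB])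
      show ?thesis
      proof (cases "\<alpha> \<in> X.labels")
        case False
        then have "h = 0" using * by simp
        then show ?thesis by simp
      qed (use * in simp)
    qed
    have hblock: "X.Q \<alpha> * (v j k * X.Q \<beta> * v k j) * X.Q \<alpha> = h"
      using hQ by (simp add: h_def mult.assoc)
    have hA: "h \<in> A'" "star h \<in> A'"
      using X.Q_block_in_A[of "v j k * X.Q \<beta> * v k j" \<alpha>] j kl
      unfolding hblock by (auto intro: star_gen_mult X.v_in_B X.Q_in_B)
    have hv: "h * v j k = X.Q \<alpha> * v j k * X.Q \<beta>"
    proof -
      have "h * v j k = X.Q \<alpha> * v j k * (X.Q \<beta> * v k k)"
        using j kl by (simp add: h_def mult.assoc X.v_mult)
      also have "\<dots> = X.Q \<alpha> * v j k * v k k * X.Q \<beta>" using kl by (simp add: X.Q_commute_v mult.assoc)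
      also have "\<dots> = X.Q \<alpha> * v j k * X.Q \<beta>" using j kl by (simp add: mult.assoc X.v_mult_assoc)
      finally show ?thesis .
    qed
    define u where "u = X.Q \<alpha> * v j k * X.Q \<beta> * v k l * X.Q \<alpha>"
    have u: "u = h * v j k * v k l * X.Q \<alpha>" unfolding u_def hv ..
    have "u = 0"
    proof (rule zero)
      have ublock: "X.Q \<alpha> * (v j k * X.Q \<beta> * v k l) * X.Q \<alpha> = u" by (simp add: u_def mult.assoc)
      show "u \<in> A'" "star u \<in> A'"
        using X.Q_block_in_A[of "v j k * X.Q \<beta> * v k l" \<alpha>] j kl
        unfolding ublock by (auto intro: star_gen_mult X.v_in_B X.Q_in_B)
      fix \<gamma>
      define a where "a = \<Psi> (X.Q \<alpha>)"
      define H where "H = \<Psi> h"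
      have ca: "Y.Q \<gamma> * a = a * Y.Q \<gamma>" unfolding a_def by (rule commute[OF QA])
      have cH: "Y.Q \<gamma> * H = H * Y.Q \<gamma>" unfolding H_def by (rule commute[OF hA])
      have "\<Psi> u = H * w j k * w k l * a"
        using j kl hB by (simp add: u \<Psi>_mult X.Q_in_B X.v_in_B star_gen_mult a_def H_def w_def)
      then have "Y.Q \<gamma> * \<Psi> u * Y.Q \<gamma> = (Y.Q \<gamma> * H) * (w j k * w k l) * (a * Y.Q \<gamma>)"
        by (simp add: mult.assoc)
      also have "\<dots> = (H * Y.Q \<gamma>) * (w j k * w k l) * (Y.Q \<gamma> * a)" by (simp only: cH ca)
      also have "\<dots> = H * (Y.Q \<gamma> * (w j k * w k l) * Y.Q \<gamma>) * a" by (simp add: mult.assoc)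
      \<comment> \<open>The block projections of \<open>A''\<close> are inserted between the two
        units, so that each term is a backtrack of \<open>\<psi> \<circ> \<rho>\<close>.\<close>
      also have "w j k * w k l = (\<Sum>\<delta>\<in>Y.labels. w j k * Y.Q \<delta>) * w k l"
        using j kl by (subst Y.sum_mult_Q) (auto intro: Y.v_in_B)
      also have "Y.Q \<gamma> * \<dots> * Y.Q \<gamma> = (\<Sum>\<delta>\<in>Y.labels. Y.Q \<gamma> * w j k * Y.Q \<delta> * w k l * Y.Q \<gamma>)"
        by (simp add: sum_distrib_left sum_distrib_right mult.assoc)
      also have "\<dots> = 0" using Y.backtrack_freeD[OF free(2) j] by (simp add: k_def l_def)
      finally show "Y.Q \<gamma> * \<Psi> u * Y.Q \<gamma> = 0" by simp
    qed
    then show ?thesis by (simp add: u_def k_def l_def)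
  qed
  then have bf: "X.backtrack_free" unfolding X.backtrack_free_def by blast
  show ?thesis by (rule X.rigid_of_free[OF lf bf \<rho> \<rho>v])
qed

section \<open>Embeddings between direct sums of cycle algebras\<close>

lemma proper_embedding_star_ext: "proper_embedding n A \<eta> \<Longrightarrow> star_ext_embedding (cycle_alg n) A \<eta>"
  by (simp add: proper_embedding_def multiplicity_one_def)

text \<open>The source of rigidity for the intertwining maps: there \<chi> is an inclusion of stages
  of a tower. Rigidity is tested on proper embeddings, so composing with such an \<eta> reduces the
  claim to \<open>rigid_cycle_embedding_factor\<close>.\<close>

lemma rigid_embedding_factor:
  assumes n: "n \<ge> 3" "cycle_algebra_sum n A'" "cycle_algebra_sum n A''"
    and \<phi>: "star_ext_embedding A A' \<phi>" and \<psi>: "star_ext_embedding A' A'' \<psi>"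
    and rigid: "rigid_embedding n A A'' \<chi>" and eq: "\<And>x. x \<in> A \<Longrightarrow> \<psi> (\<phi> x) = \<chi> x"
  shows "rigid_embedding n A A' \<phi>"
  unfolding rigid_embedding_def
proof (intro conjI allI impI)
  fix \<eta> assume \<eta>: "proper_embedding n A \<eta>"
  note emb = proper_embedding_star_ext[OF \<eta>]
  have "rigid_cycle_embedding n A'' (\<chi> \<circ> \<eta>)" using rigid \<eta> by (simp add: rigid_embedding_def)
  moreover have "(\<psi> \<circ> (\<phi> \<circ> \<eta>)) x = (\<chi> \<circ> \<eta>) x" if "x \<in> cycle_alg n" for x
    using star_ext_embedding_extension(2)[OF emb] that by (auto intro: eq)
  ultimately have "rigid_cycle_embedding n A'' (\<psi> \<circ> (\<phi> \<circ> \<eta>))"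
    using rigid_cycle_embedding_cong[of n "\<psi> \<circ> (\<phi> \<circ> \<eta>)" "\<chi> \<circ> \<eta>" A''] by blast
  then show "rigid_cycle_embedding n A' (\<phi> \<circ> \<eta>)"
    by (rule rigid_cycle_embedding_factor[OF n \<psi> star_ext_embedding_comp[OF emb \<phi>]])
qed (rule \<phi>)

text \<open>\<open>A\<close> is only a set here, and \<phi> agrees with its multiplicative extension
  on \<open>A\<close>; this explains the last premise.\<close>

lemma star_ext_embedding_mult:
  assumes "star_ext_embedding A A' \<phi>" "x \<in> A" "y \<in> A" "x * y \<in> A"
  shows "\<phi> (x * y) = \<phi> x * \<phi> y"
proof -
  obtain \<Phi> where "star_hom (star_gen A) (star_gen A') \<Phi>" "\<forall>x\<in>A. \<phi> x = \<Phi> x"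
    using star_ext_embedding_extension(1)[OF assms(1)] by blast
  then show ?thesis using assms(2-4) by (simp add: star_homD(3) star_gen_incl)
qed

lemma rigid_cycle_embeddingE:
  assumes "rigid_cycle_embedding n A \<rho>"
  shows "\<exists>r \<eta>. (\<forall>s<(r::nat). proper_embedding n A (\<eta> s)) \<and>
    (\<forall>s<r. \<forall>t<r. s \<noteq> t \<longrightarrow> (\<forall>x\<in>cycle_alg n. \<forall>y\<in>cycle_alg n. \<eta> s x * \<eta> t y = 0)) \<and>
    (\<forall>x\<in>cycle_alg n. \<rho> x = (\<Sum>s<r. \<eta> s x))"
  using assms unfolding rigid_cycle_embedding_def by iprover

text \<open>Each summand of the first map is decomposed again by the second. It is needed to pass
  from consecutive inclusions of a tower to inclusions over several stages.\<close>

lemma rigid_embedding_comp: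
  fixes A :: "'a::complex_star_algebra set" and A' :: "'b::complex_star_algebra set"
    and A'' :: "'c::complex_star_algebra set"
  assumes \<phi>: "rigid_embedding n A A' \<phi>" and \<psi>: "rigid_embedding n A' A'' \<psi>"
  shows "rigid_embedding n A A'' (\<psi> \<circ> \<phi>)"
  unfolding rigid_embedding_def
proof (intro conjI allI impI)
  have \<phi>e: "star_ext_embedding A A' \<phi>" and \<psi>e: "star_ext_embedding A' A'' \<psi>"
    using \<phi> \<psi> by (auto simp: rigid_embedding_def)
  show "star_ext_embedding A A'' (\<psi> \<circ> \<phi>)" by (rule star_ext_embedding_comp[OF \<phi>e \<psi>e])
  obtain \<Psi> where \<Psi>: "star_hom (star_gen A') (star_gen A'') \<Psi>" "\<forall>x\<in>A'. \<psi> x = \<Psi> x"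
    using star_ext_embedding_extension(1)[OF \<psi>e] by blast
  fix \<eta> assume \<eta>: "proper_embedding n A \<eta>"
  note \<eta>e = proper_embedding_star_ext[OF \<eta>]
  have "rigid_cycle_embedding n A' (\<phi> \<circ> \<eta>)" using \<phi> \<eta> by (simp add: rigid_embedding_def)
  from rigid_cycle_embeddingE[OF this] obtain r \<zeta> where
    "(\<forall>s<(r::nat). proper_embedding n A' (\<zeta> s)) \<and>
    (\<forall>s<r. \<forall>t<r. s \<noteq> t \<longrightarrow> (\<forall>x\<in>cycle_alg n. \<forall>y\<in>cycle_alg n. \<zeta> s x * \<zeta> t y = 0)) \<and>
    (\<forall>x\<in>cycle_alg n. (\<phi> \<circ> \<eta>) x = (\<Sum>s<r. \<zeta> s x))" by iprover
  then have \<zeta>: "\<And>s. s < r \<Longrightarrow> proper_embedding n A' (\<zeta> s)"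
    "\<And>s t x y. s < r \<Longrightarrow> t < r \<Longrightarrow> s \<noteq> t \<Longrightarrow> x \<in> cycle_alg n \<Longrightarrow> y \<in> cycle_alg n \<Longrightarrow> \<zeta> s x * \<zeta> t y = 0"
    "\<And>x. x \<in> cycle_alg n \<Longrightarrow> \<phi> (\<eta> x) = (\<Sum>s<r. \<zeta> s x)" by simp_all
  note \<zeta>e = proper_embedding_star_ext[OF \<zeta>(1)]
  have \<zeta>A: "\<zeta> s x \<in> A'" if "s < r" "x \<in> cycle_alg n" for s x
    using star_ext_embedding_extension(2)[OF \<zeta>e] that by blast
  define P where "P s m \<xi> \<longleftrightarrow> (\<forall>u<(m::nat). proper_embedding n A'' (\<xi> u)) \<and>
    (\<forall>u<m. \<forall>t<m. u \<noteq> t \<longrightarrow> (\<forall>x\<in>cycle_alg n. \<forall>y\<in>cycle_alg n. \<xi> u x * \<xi> t y = 0)) \<and>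
    (\<forall>x\<in>cycle_alg n. (\<psi> \<circ> \<zeta> s) x = (\<Sum>u<m. \<xi> u x))" for s m \<xi>
  have "\<exists>m \<xi>. P s m \<xi>" if "s < r" for s
  proof -
    have "rigid_cycle_embedding n A'' (\<psi> \<circ> \<zeta> s)" using \<psi> \<zeta>(1)[OF that] by (simp add: rigid_embedding_def)
    from rigid_cycle_embeddingE[OF this] show ?thesis unfolding P_def .
  qed
  then have "\<forall>s. \<exists>m. s < r \<longrightarrow> (\<exists>\<xi>. P s m \<xi>)" by blast
  from choice[OF this] obtain m where "\<forall>s. s < r \<longrightarrow> (\<exists>\<xi>. P s (m s) \<xi>)" by blast
  then have "\<forall>s. \<exists>\<xi>. s < r \<longrightarrow> P s (m s) \<xi>" by blast
  from choice[OF this] obtain \<xi> where "\<forall>s. s < r \<longrightarrow> P s (m s) (\<xi> s)" by blast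
  then have \<xi>: "\<And>s u. s < r \<Longrightarrow> u < m s \<Longrightarrow> proper_embedding n A'' (\<xi> s u)"
    "\<And>s u t x y. s < r \<Longrightarrow> u < m s \<Longrightarrow> t < m s \<Longrightarrow> u \<noteq> t \<Longrightarrow> x \<in> cycle_alg n \<Longrightarrow> y \<in> cycle_alg n \<Longrightarrow>
       \<xi> s u x * \<xi> s t y = 0"
    "\<And>s x. s < r \<Longrightarrow> x \<in> cycle_alg n \<Longrightarrow> \<psi> (\<zeta> s x) = (\<Sum>u<m s. \<xi> s u x)"
    unfolding P_def by simp_all
  let ?one = "1\<^sub>m (2 * n) :: complex mat"
  note one = one_in_cycle_alg[of n]
  \<comment> \<open>The image of the unit under the summand \<open>\<zeta> s\<close> is a unit for
    all its parts \<open>\<xi> s u\<close>. Orthogonality of parts belonging to different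
    \<open>s\<close> thereby reduces to that of these images.\<close>
  have unit: "\<xi> s u x * \<psi> (\<zeta> s ?one) = \<xi> s u x" "\<psi> (\<zeta> s ?one) * \<xi> s u x = \<xi> s u x"
    if su: "s < r" "u < m s" and x: "x \<in> cycle_alg n" for s u x
  proof -
    have xc: "x \<in> carrier_mat (2 * n) (2 * n)" using x cycle_alg_carrier by blast
    note \<xi>e = proper_embedding_star_ext[OF \<xi>(1)[OF su]]
    have 1: "\<xi> s u x * \<xi> s u ?one = \<xi> s u x" "\<xi> s u ?one * \<xi> s u x = \<xi> s u x"
      using star_ext_embedding_mult[OF \<xi>e x one] star_ext_embedding_mult[OF \<xi>e one x] x xc by simp_all
    have "\<xi> s u x * \<psi> (\<zeta> s ?one) = (\<Sum>t<m s. if t = u then \<xi> s u x else 0)"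
      unfolding \<xi>(3)[OF su(1) one] sum_distrib_left
      by (intro sum.cong) (use \<xi>(2)[OF su _ _ x one] 1 in auto)
    then show "\<xi> s u x * \<psi> (\<zeta> s ?one) = \<xi> s u x" using su(2) by simp
    have "\<psi> (\<zeta> s ?one) * \<xi> s u x = (\<Sum>t<m s. if t = u then \<xi> s u x else 0)"
      unfolding \<xi>(3)[OF su(1) one] sum_distrib_right
      by (intro sum.cong) (use \<xi>(2)[OF su(1) _ su(2) _ one x] 1 in auto)
    then show "\<psi> (\<zeta> s ?one) * \<xi> s u x = \<xi> s u x" using su(2) by simp
  qed
  have \<Psi>0: "\<Psi> (x * y) = 0" if "x \<in> A'" "y \<in> A'" "x * y = 0" for x y
  proof -
    have "0 \<in> star_gen A'" using that(1) by (intro star_gen_zero star_gen_incl)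
    then show ?thesis using star_hom_zero[OF \<Psi>(1)] that(3) by simp
  qed
  define S where "S = Sigma {..<r} (\<lambda>s. {..<m s})"
  have "rigid_cycle_embedding n A'' (\<psi> \<circ> \<phi> \<circ> \<eta>)"
  proof (rule rigid_cycle_embeddingI[where S = S and \<eta> = "\<lambda>(s, u). \<xi> s u"])
    show "star_ext_embedding (cycle_alg n) A'' (\<psi> \<circ> \<phi> \<circ> \<eta>)"
      by (rule star_ext_embedding_comp[OF \<eta>e star_ext_embedding_comp[OF \<phi>e \<psi>e]])
    show "finite S" by (simp add: S_def)
    show "proper_embedding n A'' ((\<lambda>(s, u). \<xi> s u) p)" if "p \<in> S" for p
      using that \<xi>(1) by (auto simp: S_def)
    show "(\<lambda>(s, u). \<xi> s u) p x * (\<lambda>(s, u). \<xi> s u) q y = 0"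
      if pq: "p \<in> S" "q \<in> S" "p \<noteq> q" and xy: "x \<in> cycle_alg n" "y \<in> cycle_alg n" for p q x y
    proof -
      obtain s u t u' where p: "p = (s, u)" "s < r" "u < m s" and q: "q = (t, u')" "t < r" "u' < m t"
        using pq by (auto simp: S_def)
      show ?thesis
      proof (cases "s = t")
        case True
        then show ?thesis using p q pq(3) \<xi>(2) xy by auto
      next
        case False
        have "\<psi> (\<zeta> s ?one) * \<psi> (\<zeta> t ?one) = \<Psi> (\<zeta> s ?one * \<zeta> t ?one)"
          using \<zeta>A[OF p(2) one] \<zeta>A[OF q(2) one] \<Psi>(2) by (simp add: star_homD(3)[OF \<Psi>(1)] star_gen_incl)
        also have "\<dots> = 0" by (rule \<Psi>0[OF \<zeta>A[OF p(2) one] \<zeta>A[OF q(2) one] \<zeta>(2)[OF p(2) q(2) False one one]])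
        finally have 0: "\<psi> (\<zeta> s ?one) * \<psi> (\<zeta> t ?one) = 0" .
        have "\<xi> s u x * \<xi> t u' y = \<xi> s u x * \<psi> (\<zeta> s ?one) * (\<psi> (\<zeta> t ?one) * \<xi> t u' y)"
          using p q xy by (simp add: unit)
        also have "\<dots> = \<xi> s u x * (\<psi> (\<zeta> s ?one) * \<psi> (\<zeta> t ?one)) * \<xi> t u' y" by (simp add: mult.assoc)
        finally show ?thesis using p q 0 by simp
      qed
    qed
    fix x assume x: "x \<in> cycle_alg n"
    have A'ne: "A' \<noteq> {}" using star_ext_embedding_extension(2)[OF \<phi>e] star_ext_embedding_extension(2)[OF \<eta>e] x
      by blast
    have "\<phi> (\<eta> x) \<in> A'"
      using star_ext_embedding_extension(2)[OF \<phi>e] star_ext_embedding_extension(2)[OF \<eta>e] x by blast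
    then have "(\<psi> \<circ> \<phi> \<circ> \<eta>) x = \<Psi> (\<Sum>s<r. \<zeta> s x)" using \<Psi>(2) \<zeta>(3)[OF x] by simp
    also have "\<dots> = (\<Sum>s<r. \<Psi> (\<zeta> s x))"
      by (rule star_hom_sum[OF \<Psi>(1) A'ne]) (use \<zeta>A x in \<open>auto intro: star_gen_incl\<close>)
    also have "\<dots> = (\<Sum>s<r. \<Sum>u<m s. \<xi> s u x)"
      by (intro sum.cong refl) (use \<zeta>A x \<Psi>(2) \<xi>(3) in auto)
    also have "\<dots> = (\<Sum>p\<in>S. (\<lambda>(s, u). \<xi> s u) p x)"
      unfolding S_def by (subst sum.Sigma) (auto intro!: sum.cong)
    finally show "(\<psi> \<circ> \<phi> \<circ> \<eta>) x = (\<Sum>p\<in>S. (\<lambda>(s, u). \<xi> s u) p x)" .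
  qed
  then show "rigid_cycle_embedding n A'' (\<psi> \<circ> \<phi> \<circ> \<eta>)" .
qed

section \<open>Towers and intertwining\<close>

lemma rigid_towerD:
  assumes "rigid_tower n A"
  shows "cycle_algebra_sum n (A k)" "A k \<subseteq> A (Suc k)" "rigid_embedding n (A k) (A (Suc k)) (\<lambda>x. x)"
  using assms by (auto simp: rigid_tower_def)

lemma tower_mono:
  assumes "rigid_tower n A" "k \<le> m" shows "A k \<subseteq> A m"
  using lift_Suc_mono_le[of A k m] rigid_towerD(2)[OF assms(1)] assms(2) by blast

lemma tower_inclusion_rigid:
  assumes A: "rigid_tower n A" and "k < m"
  shows "rigid_embedding n (A k) (A m) (\<lambda>x. x)"
  using \<open>k < m\<close>
proof (induction m)
  case (Suc m)
  show ?case
  proof (cases "k = m")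
    case True
    then show ?thesis using rigid_towerD(3)[OF A] by simp
  next
    case False
    then have "rigid_embedding n (A k) (A m) (\<lambda>x. x)" using Suc by simp
    from rigid_embedding_comp[OF this rigid_towerD(3)[OF A, of m]] show ?thesis by (simp add: o_def)
  qed
qed simp

lemma star_gen_tower_limit:
  assumes "rigid_tower n A"
  shows "star_gen (tower_limit A) = (\<Union>k. star_gen (A k))"
proof
  show "(\<Union>k. star_gen (A k)) \<subseteq> star_gen (tower_limit A)"
    by (auto simp: tower_limit_def intro: subsetD[OF star_gen_mono, rotated])
  show "star_gen (tower_limit A) \<subseteq> (\<Union>k. star_gen (A k))"
  proof
    fix x assume "x \<in> star_gen (tower_limit A)"
    then have "\<exists>k. x \<in> star_gen (A k)"
    proof induction
      case (star_gen_incl x)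
      then show ?case by (auto simp: tower_limit_def intro: star_gen.star_gen_incl)
    next
      case (star_gen_add x y)
      then obtain k l where "x \<in> star_gen (A k)" "y \<in> star_gen (A l)" by blast
      then have "x \<in> star_gen (A (max k l))" "y \<in> star_gen (A (max k l))"
        using subsetD[OF star_gen_mono[OF tower_mono[OF assms, of k "max k l"]]]
          subsetD[OF star_gen_mono[OF tower_mono[OF assms, of l "max k l"]]] by simp_all
      then show ?case using star_gen.star_gen_add by blast
    next
      case (star_gen_mult x y)
      then obtain k l where "x \<in> star_gen (A k)" "y \<in> star_gen (A l)" by blast
      then have "x \<in> star_gen (A (max k l))" "y \<in> star_gen (A (max k l))"
        using subsetD[OF star_gen_mono[OF tower_mono[OF assms, of k "max k l"]]]
          subsetD[OF star_gen_mono[OF tower_mono[OF assms, of l "max k l"]]] by simp_all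
      then show ?case using star_gen.star_gen_mult by blast
    next
      case (star_gen_scaleC x c)
      then show ?case using star_gen.star_gen_scaleC by blast
    next
      case (star_gen_star x)
      then show ?case using star_gen.star_gen_star by blast
    qed
    then show "x \<in> (\<Union>k. star_gen (A k))" by blast
  qed
qed

lemma image_of_stage_in_stage:
  fixes A :: "nat \<Rightarrow> 'a::complex_star_algebra set" and A' :: "nat \<Rightarrow> 'b::complex_star_algebra set"
  assumes A: "rigid_tower n A" and A': "rigid_tower n A'"
    and hom: "star_hom (star_gen (tower_limit A)) C \<Phi>" and eq: "\<And>x. x \<in> tower_limit A \<Longrightarrow> \<phi> x = \<Phi> x"
    and img: "\<phi> ` tower_limit A \<subseteq> tower_limit A'"
  shows "\<exists>l>m. \<phi> ` A k \<subseteq> A' l"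
proof -
  obtain Gs \<theta> N lab where "cycle_realization n (A k) Gs \<theta> N lab"
    using cycle_algebra_sumE[OF rigid_towerD(1)[OF A]] by blast
  then interpret X: cycle_realization n "A k" Gs \<theta> N lab .
  have sub: "A k \<subseteq> tower_limit A" by (auto simp: tower_limit_def)
  have hom_k: "star_hom (star_gen (A k)) C \<Phi>"
  proof (rule star_hom_subset[OF hom star_gen_mono[OF sub]])
    show "\<Phi> ` star_gen (A k) \<subseteq> C" using star_homD(1)[OF hom] star_gen_mono[OF sub] by blast
  qed
  obtain T :: "(nat \<times> nat) set" and \<epsilon> where T: "finite T" "\<And>t. t \<in> T \<Longrightarrow> \<epsilon> t \<in> A k"
    and span: "\<And>x. x \<in> A k \<Longrightarrow> \<exists>c. x = (\<Sum>t\<in>T. scaleC (c t) (\<epsilon> t))"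
    by (rule X.finite_spanning_set) (rule that)
  have "\<exists>l. \<Phi> (\<epsilon> t) \<in> A' l" if "t \<in> T" for t
  proof -
    have "\<epsilon> t \<in> tower_limit A" using T(2)[OF that] sub by blast
    then have "\<Phi> (\<epsilon> t) \<in> tower_limit A'" using img eq by (metis image_subset_iff)
    then show ?thesis by (simp add: tower_limit_def)
  qed
  then have "\<forall>t. \<exists>l. t \<in> T \<longrightarrow> \<Phi> (\<epsilon> t) \<in> A' l" by blast
  from choice[OF this] obtain L where L: "\<And>t. t \<in> T \<Longrightarrow> \<Phi> (\<epsilon> t) \<in> A' (L t)" by blast
  \<comment> \<open>The sum bounds every \<open>L t\<close>, also when \<open>T\<close> is empty,
    and the added \<open>Suc m\<close> gives the strict inequality.\<close>
  define l where "l = Suc (m + (\<Sum>t\<in>T. L t))"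
  have \<epsilon>l: "\<Phi> (\<epsilon> t) \<in> A' l" if "t \<in> T" for t
  proof -
    have "L t \<le> (\<Sum>t\<in>T. L t)" by (rule member_le_sum[OF that _ T(1)]) simp
    then have "A' (L t) \<subseteq> A' l" by (intro tower_mono[OF A']) (simp add: l_def)
    then show ?thesis using L[OF that] by blast
  qed
  obtain Gs' \<theta>' N' lab' where "cycle_realization n (A' l) Gs' \<theta>' N' lab'"
    using cycle_algebra_sumE[OF rigid_towerD(1)[OF A']] by blast
  then interpret Y: cycle_realization n "A' l" Gs' \<theta>' N' lab' .
  have "0 \<in> A' l"
  proof -
    obtain y where "y \<in> A' l" using Y.A_nonempty by blast
    from Y.scaleC_in_A[OF this, of 0] show ?thesis by simp
  qed
  then have sum_in: "sum f I \<in> A' l" if "\<And>t. t \<in> I \<Longrightarrow> f t \<in> A' l" for f :: "nat \<times> nat \<Rightarrow> 'b" and I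
    using that by (induction I rule: infinite_finite_induct) (auto intro: Y.add_in_A)
  have "\<phi> x \<in> A' l" if x: "x \<in> A k" for x
  proof -
    obtain c where c: "x = (\<Sum>t\<in>T. scaleC (c t) (\<epsilon> t))" using span[OF x] by blast
    have "\<phi> x = \<Phi> (\<Sum>t\<in>T. scaleC (c t) (\<epsilon> t))" using eq x sub c by blast
    also have "\<dots> = (\<Sum>t\<in>T. \<Phi> (scaleC (c t) (\<epsilon> t)))"
      by (rule star_hom_sum[OF hom_k X.A_nonempty]) (intro star_gen_scaleC star_gen_incl T(2))
    also have "\<dots> \<in> A' l"
    proof (rule sum_in)
      fix t assume t: "t \<in> T"
      have "\<Phi> (scaleC (c t) (\<epsilon> t)) = scaleC (c t) (\<Phi> (\<epsilon> t))"
        by (rule star_homD(4)[OF hom_k X.A_in_B[OF T(2)[OF t]]])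
      then show "\<Phi> (scaleC (c t) (\<epsilon> t)) \<in> A' l" using Y.scaleC_in_A[OF \<epsilon>l[OF t]] by simp
    qed
    finally show ?thesis .
  qed
  then show ?thesis by (intro exI[of _ l]) (auto simp: l_def)
qed

lemma stage_embedding:
  assumes hom: "star_hom (star_gen (tower_limit A)) C \<Phi>" and eq: "\<And>x. x \<in> tower_limit A \<Longrightarrow> \<phi> x = \<Phi> x"
    and inj: "inj_on \<phi> (tower_limit A)" and img: "\<phi> ` A k \<subseteq> A' l"
  shows "star_ext_embedding (A k) (A' l) \<phi>"
proof -
  have sub: "A k \<subseteq> tower_limit A" by (auto simp: tower_limit_def)
  have "star_hom (star_gen (A k)) C \<Phi>"
  proof (rule star_hom_subset[OF hom star_gen_mono[OF sub]])
    show "\<Phi> ` star_gen (A k) \<subseteq> C" using star_homD(1)[OF hom] star_gen_mono[OF sub] by blast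
  qed
  then have "star_extendible (A k) (A' l) \<phi>"
    by (rule star_extendibleI) (use eq sub img in auto)
  then show ?thesis using inj_on_subset[OF inj sub] by (simp add: star_ext_embedding_def)
qed

lemma star_ext_iso_inverse:
  fixes L :: "'a::complex_star_algebra set" and L' :: "'b::complex_star_algebra set"
  assumes "star_ext_iso L L' \<phi>"
  shows "star_ext_iso L' L (inv_into L \<phi>)"
proof -
  obtain \<Phi> where bij: "bij_betw \<phi> L L'" and hom: "star_hom (star_gen L) (star_gen L') \<Phi>"
    and bij\<Phi>: "bij_betw \<Phi> (star_gen L) (star_gen L')" and eq: "\<forall>x\<in>L. \<phi> x = \<Phi> x"
    using assms unfolding star_ext_iso_def by blast
  have "inv_into L \<phi> y = inv_into (star_gen L) \<Phi> y" if "y \<in> L'" for y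
  proof -
    obtain x where x: "x \<in> L" "y = \<phi> x" using bij \<open>y \<in> L'\<close> by (auto simp: bij_betw_def)
    have "inv_into L \<phi> y = x" using bij x by (simp add: bij_betw_def inv_into_f_f)
    moreover have "inv_into (star_gen L) \<Phi> y = x"
      using bij\<Phi> x eq by (simp add: bij_betw_def inv_into_f_f star_gen_incl)
    ultimately show ?thesis by simp
  qed
  then show ?thesis
    unfolding star_ext_iso_def
    using bij_betw_inv_into[OF bij] bij_betw_inv_into[OF bij\<Phi>] star_hom_inv_into[OF hom bij\<Phi>] by blast
qed

text \<open>Each stage is spanned by finitely many elements, so an isomorphism of the limits and its
  inverse carry stages into stages; every map in the resulting diagram is then the first factor of
  a rigid inclusion.\<close>

lemma intertwining_of_iso:
  fixes A :: "nat \<Rightarrow> 'a::complex_star_algebra set" and A' :: "nat \<Rightarrow> 'b::complex_star_algebra set"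
  assumes n: "n \<ge> 3" and A: "rigid_tower n A" and A': "rigid_tower n A'"
    and \<phi>: "star_ext_iso (tower_limit A) (tower_limit A') \<phi>"
    and \<psi>: "star_ext_iso (tower_limit A') (tower_limit A) \<psi>"
    and \<psi>\<phi>: "\<And>x. x \<in> tower_limit A \<Longrightarrow> \<psi> (\<phi> x) = x"
    and \<phi>\<psi>: "\<And>y. y \<in> tower_limit A' \<Longrightarrow> \<phi> (\<psi> y) = y"
  shows "\<exists>(M :: nat \<Rightarrow> nat) (N :: nat \<Rightarrow> nat). strict_mono M \<and> strict_mono N \<and>
    rigid_embedding n (A 0) (A' (N 0)) \<phi> \<and>
    (\<forall>k. rigid_embedding n (A' (N k)) (A (M k)) \<psi>) \<and>
    (\<forall>k. rigid_embedding n (A (M k)) (A' (N (Suc k))) \<phi>)"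
proof -
  obtain \<Phi> where \<Phi>: "bij_betw \<phi> (tower_limit A) (tower_limit A')"
    "star_hom (star_gen (tower_limit A)) (star_gen (tower_limit A')) \<Phi>"
    "\<forall>x\<in>tower_limit A. \<phi> x = \<Phi> x"
    using \<phi> unfolding star_ext_iso_def by blast
  obtain \<Psi> where \<Psi>: "bij_betw \<psi> (tower_limit A') (tower_limit A)"
    "star_hom (star_gen (tower_limit A')) (star_gen (tower_limit A)) \<Psi>"
    "\<forall>x\<in>tower_limit A'. \<psi> x = \<Psi> x"
    using \<psi> unfolding star_ext_iso_def by blast
  have inj: "inj_on \<phi> (tower_limit A)" "inj_on \<psi> (tower_limit A')"
    and img: "\<phi> ` tower_limit A \<subseteq> tower_limit A'" "\<psi> ` tower_limit A' \<subseteq> tower_limit A"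
    using \<Phi>(1) \<Psi>(1) by (auto simp: bij_betw_def)
  have stage\<phi>: "\<exists>l>m. \<phi> ` A k \<subseteq> A' l" for k m
    using \<Phi>(3) by (intro image_of_stage_in_stage[OF A A' \<Phi>(2) _ img(1)]) simp
  have stage\<psi>: "\<exists>l>m. \<psi> ` A' k \<subseteq> A l" for k m
    using \<Psi>(3) by (intro image_of_stage_in_stage[OF A' A \<Psi>(2) _ img(2)]) simp
  have emb\<phi>: "star_ext_embedding (A k) (A' l) \<phi>" if "\<phi> ` A k \<subseteq> A' l" for k l
    using \<Phi>(3) that by (intro stage_embedding[OF \<Phi>(2) _ inj(1)]) simp_all
  have emb\<psi>: "star_ext_embedding (A' k) (A l) \<psi>" if "\<psi> ` A' k \<subseteq> A l" for k l
    using \<Psi>(3) that by (intro stage_embedding[OF \<Psi>(2) _ inj(2)]) simp_all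
  have rigid\<phi>: "rigid_embedding n (A k) (A' l) \<phi>"
    if "\<phi> ` A k \<subseteq> A' l" "\<psi> ` A' l \<subseteq> A m" "k < m" for k l m
    using rigid_embedding_factor[OF n rigid_towerD(1)[OF A'] rigid_towerD(1)[OF A]
        emb\<phi>[OF that(1)] emb\<psi>[OF that(2)] tower_inclusion_rigid[OF A that(3)]] \<psi>\<phi>
    by (auto simp: tower_limit_def)
  have rigid\<psi>: "rigid_embedding n (A' k) (A l) \<psi>"
    if "\<psi> ` A' k \<subseteq> A l" "\<phi> ` A l \<subseteq> A' m" "k < m" for k l m
    using rigid_embedding_factor[OF n rigid_towerD(1)[OF A] rigid_towerD(1)[OF A']
        emb\<psi>[OF that(1)] emb\<phi>[OF that(2)] tower_inclusion_rigid[OF A' that(3)]] \<phi>\<psi>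
    by (auto simp: tower_limit_def)
  \<comment> \<open>A state is a pair of stages, one in each tower. The clause
    \<open>0 < snd p\<close> puts \<open>A 0\<close> strictly before \<open>A (M 0)\<close>, as
    \<open>tower_inclusion_rigid\<close> demands; at later steps \<open>R\<close> provides the
    strictness.\<close>
  define P where "P k p \<longleftrightarrow> \<psi> ` A' (fst p) \<subseteq> A (snd p) \<and> 0 < snd p \<and> (k = 0 \<longrightarrow> \<phi> ` A 0 \<subseteq> A' (fst p))"
    for k :: nat and p :: "nat \<times> nat"
  define R where "R p q \<longleftrightarrow> fst p < fst q \<and> snd p < snd q \<and> \<phi> ` A (snd p) \<subseteq> A' (fst q)"
    for p q :: "nat \<times> nat"
  have "\<exists>f. \<forall>k. P k (f k) \<and> R (f k) (f (Suc k))"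
  proof (rule dependent_nat_choice)
    obtain l where l: "\<phi> ` A 0 \<subseteq> A' l" using stage\<phi> by blast
    obtain m where "0 < m" "\<psi> ` A' l \<subseteq> A m" using stage\<psi> by blast
    then show "\<exists>p. P 0 p" using l by (intro exI[of _ "(l, m)"]) (simp add: P_def)
    fix p and k :: nat
    obtain l where l: "fst p < l" "\<phi> ` A (snd p) \<subseteq> A' l" using stage\<phi> by blast
    obtain m where m: "snd p < m" "\<psi> ` A' l \<subseteq> A m" using stage\<psi> by blast
    then show "\<exists>q. P (Suc k) q \<and> R p q" using l by (intro exI[of _ "(l, m)"]) (simp add: P_def R_def)
  qed
  then obtain f where f: "\<And>k. P k (f k)" "\<And>k. R (f k) (f (Suc k))" by blast
  define N where "N k = fst (f k)" for k
  define M where "M k = snd (f k)" for k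
  have "strict_mono M" "strict_mono N"
    using f(2) by (auto simp: strict_mono_Suc_iff R_def M_def N_def)
  moreover have "rigid_embedding n (A 0) (A' (N 0)) \<phi>"
    using f(1)[of 0] by (intro rigid\<phi>[of 0 "N 0" "M 0"]) (simp_all add: P_def N_def M_def)
  moreover have "rigid_embedding n (A' (N k)) (A (M k)) \<psi>" for k
    using f(1)[of k] f(2)[of k]
    by (intro rigid\<psi>[of "N k" "M k" "N (Suc k)"]) (simp_all add: P_def R_def N_def M_def)
  moreover have "rigid_embedding n (A (M k)) (A' (N (Suc k))) \<phi>" for k
    using f(1)[of "Suc k"] f(2)[of k]
    by (intro rigid\<phi>[of "M k" "N (Suc k)" "M (Suc k)"]) (simp_all add: P_def R_def N_def M_def)
  ultimately show ?thesis by blast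
qed

lemma rigid_embedding_star_ext: "rigid_embedding n A A' \<phi> \<Longrightarrow> star_ext_embedding A A' \<phi>"
  by (simp add: rigid_embedding_def)

text \<open>Extensions to the generated star-algebras are unique, so those of the \<open>\<phi>\<^sub>k\<close> and of the
  \<open>\<psi>\<^sub>k\<close> fit together to mutually inverse maps.\<close>

lemma iso_of_intertwining:
  fixes A :: "nat \<Rightarrow> 'a::complex_star_algebra set" and A' :: "nat \<Rightarrow> 'b::complex_star_algebra set"
  assumes A: "rigid_tower n A" and A': "rigid_tower n A'" and mono: "strict_mono M" "strict_mono N"
    and \<psi>s: "\<And>k. star_ext_embedding (A' (N k)) (A (M k)) (\<psi>s k)"
    and \<phi>s: "\<And>k. star_ext_embedding (A (M k)) (A' (N (Suc k))) \<phi>"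
    and \<psi>\<phi>: "\<And>k x. x \<in> A (M k) \<Longrightarrow> \<psi>s (Suc k) (\<phi> x) = x"
    and \<phi>\<psi>: "\<And>k y. y \<in> A' (N k) \<Longrightarrow> \<phi> (\<psi>s k y) = y"
  shows "star_ext_iso (tower_limit A) (tower_limit A') \<phi>"
proof -
  let ?L = "tower_limit A" and ?L' = "tower_limit A'"
  have AM: "A k \<subseteq> A (M l)" if "k \<le> l" for k l
    using tower_mono[OF A] seq_suble[OF mono(1), of l] that by (meson le_trans)
  have AN: "A' k \<subseteq> A' (N l)" if "k \<le> l" for k l
    using tower_mono[OF A'] seq_suble[OF mono(2), of l] that by (meson le_trans)
  note SM = star_gen_mono[OF AM] and SN = star_gen_mono[OF AN]
  have "\<forall>k. \<exists>\<Phi>. star_hom (star_gen (A (M k))) (star_gen (A' (N (Suc k)))) \<Phi> \<and> (\<forall>x\<in>A (M k). \<phi> x = \<Phi> x)"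
    using star_ext_embedding_extension(1)[OF \<phi>s] by blast
  from choice[OF this] obtain \<Phi>s where
    \<Phi>s: "\<And>k. star_hom (star_gen (A (M k))) (star_gen (A' (N (Suc k)))) (\<Phi>s k)"
    "\<And>k x. x \<in> A (M k) \<Longrightarrow> \<phi> x = \<Phi>s k x" by blast
  have "\<forall>k. \<exists>\<Psi>. star_hom (star_gen (A' (N k))) (star_gen (A (M k))) \<Psi> \<and> (\<forall>x\<in>A' (N k). \<psi>s k x = \<Psi> x)"
    using star_ext_embedding_extension(1)[OF \<psi>s] by blast
  from choice[OF this] obtain \<Psi>s where
    \<Psi>s: "\<And>k. star_hom (star_gen (A' (N k))) (star_gen (A (M k))) (\<Psi>s k)"
    "\<And>k x. x \<in> A' (N k) \<Longrightarrow> \<psi>s k x = \<Psi>s k x" by blast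
  have MM: "A (M k) \<subseteq> A (M l)" if "k \<le> l" for k l
    using tower_mono[OF A] mono(1) that by (simp add: strict_mono_less_eq)
  have \<Phi>s_eq: "\<Phi>s l x = \<Phi>s k x" if "k \<le> l" "x \<in> star_gen (A (M k))" for k l x
  proof (rule star_hom_eq_on_star_gen[of "A (M k)"])
    show "star_hom (star_gen (A (M k))) (star_gen (A' (N (Suc l)))) (\<Phi>s l)"
    proof (rule star_hom_subset[OF \<Phi>s(1)[of l] star_gen_mono[OF MM[OF that(1)]]])
      show "\<Phi>s l ` star_gen (A (M k)) \<subseteq> star_gen (A' (N (Suc l)))"
        using star_homD(1)[OF \<Phi>s(1)[of l]] star_gen_mono[OF MM[OF that(1)]] by blast
    qed
    show "\<Phi>s l y = \<Phi>s k y" if "y \<in> A (M k)" for y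
      using \<Phi>s(2)[OF that] \<Phi>s(2)[of y l] MM[OF \<open>k \<le> l\<close>] that by auto
  qed (rule \<Phi>s(1), rule that(2))
  have \<Psi>\<Phi>: "\<Psi>s (Suc k) (\<Phi>s k x) = x" if "x \<in> star_gen (A (M k))" for k x
  proof -
    have "(\<Psi>s (Suc k) \<circ> \<Phi>s k) x = x"
    proof (rule star_hom_eq_on_star_gen[OF star_hom_comp[OF \<Phi>s(1) \<Psi>s(1)] star_hom_ident _ that])
      fix y assume y: "y \<in> A (M k)"
      then have "\<phi> y \<in> A' (N (Suc k))" using star_ext_embedding_extension(2)[OF \<phi>s] by blast
      then show "(\<Psi>s (Suc k) \<circ> \<Phi>s k) y = y" using \<Psi>s(2) \<Phi>s(2)[OF y] \<psi>\<phi>[OF y] by simp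
    qed
    then show ?thesis by simp
  qed
  have \<Phi>\<Psi>: "\<Phi>s k (\<Psi>s k y) = y" if "y \<in> star_gen (A' (N k))" for k y
  proof -
    have "(\<Phi>s k \<circ> \<Psi>s k) y = y"
    proof (rule star_hom_eq_on_star_gen[OF star_hom_comp[OF \<Psi>s(1) \<Phi>s(1)] star_hom_ident _ that])
      fix z assume z: "z \<in> A' (N k)"
      then have "\<psi>s k z \<in> A (M k)" using star_ext_embedding_extension(2)[OF \<psi>s] by blast
      then show "(\<Phi>s k \<circ> \<Psi>s k) z = z" using \<Psi>s(2)[OF z] \<Phi>s(2) \<phi>\<psi>[OF z] by simp
    qed
    then show ?thesis by simp
  qed
  \<comment> \<open>One function is needed on the whole limit algebra. The least stage is merely a
    definite choice: by \<open>\<Phi>s_eq\<close> every later stage gives the same value.\<close>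
  define stage where "stage x = (LEAST k. x \<in> star_gen (A (M k)))" for x
  define \<Phi> where "\<Phi> x = \<Phi>s (stage x) x" for x
  have \<Phi>: "\<Phi> x = \<Phi>s k x" if "x \<in> star_gen (A (M k))" for x k
  proof -
    have "x \<in> star_gen (A (M (stage x)))" "stage x \<le> k"
      unfolding stage_def using that by (auto intro: LeastI Least_le)
    then show ?thesis unfolding \<Phi>_def using \<Phi>s_eq[of "stage x" k x] by simp
  qed
  have SL: "\<exists>k0. \<forall>k\<ge>k0. x \<in> star_gen (A (M k))" if "x \<in> star_gen ?L" for x
    using that SM unfolding star_gen_tower_limit[OF A] by blast
  have SL2: "\<exists>k. x \<in> star_gen (A (M k)) \<and> y \<in> star_gen (A (M k))"
    if "x \<in> star_gen ?L" "y \<in> star_gen ?L" for x y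
    using SL[OF that(1)] SL[OF that(2)] by (meson nat_le_linear)
  have SL': "\<exists>k. y \<in> star_gen (A' (N k))" if "y \<in> star_gen ?L'" for y
    using that SN unfolding star_gen_tower_limit[OF A'] by blast
  have inL': "star_gen (A' k) \<subseteq> star_gen ?L'" and inL: "star_gen (A k) \<subseteq> star_gen ?L" for k
    unfolding star_gen_tower_limit[OF A] star_gen_tower_limit[OF A'] by auto
  have hom: "star_hom (star_gen ?L) (star_gen ?L') \<Phi>"
    unfolding star_hom_def
  proof (intro conjI ballI allI)
    show "\<Phi> ` star_gen ?L \<subseteq> star_gen ?L'"
    proof
      fix y assume "y \<in> \<Phi> ` star_gen ?L"
      then obtain x k where x: "x \<in> star_gen (A (M k))" "y = \<Phi> x" using SL by blast
      then show "y \<in> star_gen ?L'"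
        using subsetD[OF inL' star_homD(1)[OF \<Phi>s(1) x(1)]] \<Phi>[OF x(1)] by simp
    qed
    fix x y assume "x \<in> star_gen ?L" "y \<in> star_gen ?L"
    then obtain k where k: "x \<in> star_gen (A (M k))" "y \<in> star_gen (A (M k))" using SL2 by blast
    show "\<Phi> (x + y) = \<Phi> x + \<Phi> y" "\<Phi> (x * y) = \<Phi> x * \<Phi> y"
      using \<Phi>[OF k(1)] \<Phi>[OF k(2)] \<Phi>[OF star_gen_add[OF k]] \<Phi>[OF star_gen_mult[OF k]]
        star_homD(2,3)[OF \<Phi>s(1) k] by simp_all
  next
    fix c x assume "x \<in> star_gen ?L"
    then obtain k where k: "x \<in> star_gen (A (M k))" using SL by blast
    show "\<Phi> (scaleC c x) = scaleC c (\<Phi> x)"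
      using \<Phi>[OF k] \<Phi>[OF star_gen_scaleC[OF k]] star_homD(4)[OF \<Phi>s(1) k] by simp
  next
    fix x assume "x \<in> star_gen ?L"
    then obtain k where k: "x \<in> star_gen (A (M k))" using SL by blast
    show "\<Phi> (star x) = star (\<Phi> x)"
      using \<Phi>[OF k] \<Phi>[OF star_gen_star[OF k]] star_homD(5)[OF \<Phi>s(1) k] by simp
  qed
  have inj: "inj_on \<Phi> (star_gen ?L)"
  proof (rule inj_onI)
    fix x y assume "x \<in> star_gen ?L" "y \<in> star_gen ?L" and eq: "\<Phi> x = \<Phi> y"
    then obtain k where k: "x \<in> star_gen (A (M k))" "y \<in> star_gen (A (M k))" using SL2 by blast
    have "x = \<Psi>s (Suc k) (\<Phi> x)" "y = \<Psi>s (Suc k) (\<Phi> y)" using k by (simp_all add: \<Phi> \<Psi>\<Phi>)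
    then show "x = y" using eq by metis
  qed
  have surj: "star_gen ?L' \<subseteq> \<Phi> ` star_gen ?L"
  proof
    fix y assume "y \<in> star_gen ?L'"
    then obtain k where k: "y \<in> star_gen (A' (N k))" using SL' by blast
    have *: "\<Psi>s k y \<in> star_gen (A (M k))" by (rule star_homD(1)[OF \<Psi>s(1) k])
    have "y = \<Phi> (\<Psi>s k y)" using \<Phi>[OF *] \<Phi>\<Psi>[OF k] by simp
    then show "y \<in> \<Phi> ` star_gen ?L" using * inL by blast
  qed
  have bij\<Phi>: "bij_betw \<Phi> (star_gen ?L) (star_gen ?L')"
    using hom inj surj by (auto simp: bij_betw_def star_hom_def)
  have \<phi>\<Phi>: "\<phi> x = \<Phi> x" if "x \<in> ?L" for x
  proof -
    obtain k where x: "x \<in> A (M k)" using \<open>x \<in> ?L\<close> AM by (fastforce simp: tower_limit_def)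
    show ?thesis using \<Phi>s(2)[OF x] \<Phi>[OF star_gen_incl[OF x]] by simp
  qed
  have "\<phi> ` ?L = ?L'"
  proof
    show "\<phi> ` ?L \<subseteq> ?L'"
    proof
      fix y assume "y \<in> \<phi> ` ?L"
      then obtain x k where "x \<in> A (M k)" "y = \<phi> x" using AM by (fastforce simp: tower_limit_def)
      then have "y \<in> A' (N (Suc k))" using star_ext_embedding_extension(2)[OF \<phi>s] by blast
      then show "y \<in> ?L'" by (auto simp: tower_limit_def)
    qed
    show "?L' \<subseteq> \<phi> ` ?L"
    proof
      fix y assume "y \<in> ?L'"
      then obtain k where k: "y \<in> A' (N k)" using AN by (fastforce simp: tower_limit_def)
      then have "\<psi>s k y \<in> A (M k)" using star_ext_embedding_extension(2)[OF \<psi>s] by blast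
      then have "\<psi>s k y \<in> ?L" by (auto simp: tower_limit_def)
      then show "y \<in> \<phi> ` ?L" using \<phi>\<psi>[OF k] by (metis imageI)
    qed
  qed
  moreover have "inj_on \<phi> ?L"
    using inj_on_subset[OF inj subset_star_gen] \<phi>\<Phi> by (simp cong: inj_on_cong)
  ultimately have "bij_betw \<phi> ?L ?L'" by (simp add: bij_betw_def)
  then show ?thesis using hom bij\<Phi> \<phi>\<Phi> unfolding star_ext_iso_def by blast
qed

theorem theorem2p4:
  fixes n :: nat
    and A :: "nat \<Rightarrow> 'a::complex_star_algebra set"
    and A' :: "nat \<Rightarrow> 'b::complex_star_algebra set"
    and \<phi> :: "'a \<Rightarrow> 'b"
  assumes "n \<ge> 3"
    and "rigid_tower n A"
    and "rigid_tower n A'"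
  shows "(\<exists>\<psi>. star_ext_iso (tower_limit A) (tower_limit A') \<phi> \<and>
              star_ext_iso (tower_limit A') (tower_limit A) \<psi> \<and>
              (\<forall>x\<in>tower_limit A. \<psi> (\<phi> x) = x) \<and>
              (\<forall>y\<in>tower_limit A'. \<phi> (\<psi> y) = y))
     \<longleftrightarrow>
     (\<exists>(M :: nat \<Rightarrow> nat) (N :: nat \<Rightarrow> nat) (\<phi>s :: nat \<Rightarrow> 'a \<Rightarrow> 'b) (\<psi>s :: nat \<Rightarrow> 'b \<Rightarrow> 'a).
        strict_mono M \<and> strict_mono N \<and>
        rigid_embedding n (A 0) (A' (N 0)) (\<phi>s 0) \<and>
        (\<forall>k. rigid_embedding n (A' (N k)) (A (M k)) (\<psi>s k)) \<and>
        (\<forall>k. rigid_embedding n (A (M k)) (A' (N (Suc k))) (\<phi>s (Suc k))) \<and>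
        (\<forall>x\<in>A 0. \<psi>s 0 (\<phi>s 0 x) = x) \<and>
        (\<forall>k. \<forall>x\<in>A (M k). \<psi>s (Suc k) (\<phi>s (Suc k) x) = x) \<and>
        (\<forall>k. \<forall>y\<in>A' (N k). \<phi>s (Suc k) (\<psi>s k y) = y) \<and>
        (\<forall>x\<in>A 0. \<phi> x = \<phi>s 0 x) \<and>
        (\<forall>k. \<forall>x\<in>A (M k). \<phi> x = \<phi>s (Suc k) x))"
    (is "?iso \<longleftrightarrow> ?diagram")
proof
  assume ?iso
  then obtain \<psi> where \<psi>: "star_ext_iso (tower_limit A) (tower_limit A') \<phi>"
    "star_ext_iso (tower_limit A') (tower_limit A) \<psi>"
    "\<forall>x\<in>tower_limit A. \<psi> (\<phi> x) = x" "\<forall>y\<in>tower_limit A'. \<phi> (\<psi> y) = y" by blast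
  obtain M N :: "nat \<Rightarrow> nat" where MN: "strict_mono M" "strict_mono N"
    "rigid_embedding n (A 0) (A' (N 0)) \<phi>"
    "\<forall>k. rigid_embedding n (A' (N k)) (A (M k)) \<psi>"
    "\<forall>k. rigid_embedding n (A (M k)) (A' (N (Suc k))) \<phi>"
    using intertwining_of_iso[OF assms \<psi>(1,2)] \<psi>(3,4) by blast
  have inverse: "x \<in> A k \<Longrightarrow> \<psi> (\<phi> x) = x" "y \<in> A' k \<Longrightarrow> \<phi> (\<psi> y) = y" for k x y
    using \<psi>(3,4) by (auto simp: tower_limit_def)
  \<comment> \<open>All maps of the diagram are restrictions of one pair \<phi>, \<psi>, so the two
    families are constant and the diagram commutes because the pair is mutually inverse.\<close>
  show ?diagram
    by (rule exI[of _ M], rule exI[of _ N], rule exI[of _ "\<lambda>_. \<phi>"], rule exI[of _ "\<lambda>_. \<psi>"])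
      (use MN in \<open>auto intro: inverse\<close>)
next
  assume ?diagram
  then obtain M N :: "nat \<Rightarrow> nat" and \<phi>s :: "nat \<Rightarrow> 'a \<Rightarrow> 'b" and \<psi>s :: "nat \<Rightarrow> 'b \<Rightarrow> 'a" where
    "strict_mono M \<and> strict_mono N \<and>
      rigid_embedding n (A 0) (A' (N 0)) (\<phi>s 0) \<and>
      (\<forall>k. rigid_embedding n (A' (N k)) (A (M k)) (\<psi>s k)) \<and>
      (\<forall>k. rigid_embedding n (A (M k)) (A' (N (Suc k))) (\<phi>s (Suc k))) \<and>
      (\<forall>x\<in>A 0. \<psi>s 0 (\<phi>s 0 x) = x) \<and>
      (\<forall>k. \<forall>x\<in>A (M k). \<psi>s (Suc k) (\<phi>s (Suc k) x) = x) \<and>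
      (\<forall>k. \<forall>y\<in>A' (N k). \<phi>s (Suc k) (\<psi>s k y) = y) \<and>
      (\<forall>x\<in>A 0. \<phi> x = \<phi>s 0 x) \<and>
      (\<forall>k. \<forall>x\<in>A (M k). \<phi> x = \<phi>s (Suc k) x)"
    by (elim exE) (rule that)
  then have mono: "strict_mono M" "strict_mono N"
    and \<psi>s: "\<And>k. rigid_embedding n (A' (N k)) (A (M k)) (\<psi>s k)"
    and \<phi>s: "\<And>k. rigid_embedding n (A (M k)) (A' (N (Suc k))) (\<phi>s (Suc k))"
    and \<psi>\<phi>: "\<And>k x. x \<in> A (M k) \<Longrightarrow> \<psi>s (Suc k) (\<phi>s (Suc k) x) = x"
    and \<phi>\<psi>: "\<And>k y. y \<in> A' (N k) \<Longrightarrow> \<phi>s (Suc k) (\<psi>s k y) = y"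
    and eq: "\<And>k x. x \<in> A (M k) \<Longrightarrow> \<phi> x = \<phi>s (Suc k) x"
    by simp_all
  have iso: "star_ext_iso (tower_limit A) (tower_limit A') \<phi>"
  proof (rule iso_of_intertwining[OF assms(2,3) mono rigid_embedding_star_ext[OF \<psi>s]])
    show "star_ext_embedding (A (M k)) (A' (N (Suc k))) \<phi>" for k
      using star_ext_embedding_cong[of "A (M k)" \<phi> "\<phi>s (Suc k)"] eq rigid_embedding_star_ext[OF \<phi>s[of k]]
      by blast
    show "\<psi>s (Suc k) (\<phi> x) = x" if "x \<in> A (M k)" for k x using \<psi>\<phi>[OF that] eq[OF that] by simp
    show "\<phi> (\<psi>s k y) = y" if "y \<in> A' (N k)" for k y
    proof -
      have "\<psi>s k y \<in> A (M k)"
        using star_ext_embedding_extension(2)[OF rigid_embedding_star_ext[OF \<psi>s[of k]]] that by blast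
      from eq[OF this] show ?thesis using \<phi>\<psi>[OF that] by simp
    qed
  qed
  have "bij_betw \<phi> (tower_limit A) (tower_limit A')" using iso by (simp add: star_ext_iso_def)
  then show ?iso
    using iso star_ext_iso_inverse[OF iso]
    by (intro exI[of _ "inv_into (tower_limit A) \<phi>"]) (auto simp: bij_betw_def f_inv_into_f)
qed

end
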